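(* (Quantum Lindström's lemma) Let $q\in\mathbb C^*$ be not a root of unity, $(w_1,w_2)\in S_{n+1}\times S_{n+1}$, and $\mathbf i=(i_1,\dots,i_m)$ a reduced expression of $(w_1,w_2)$. Let $A,B\subset\{1,\dots,n+1\}$ with $|A|=|B|$. Then $$\tilde\pi_{\mathbf i}(\Delta_{q,A,B})=\sum_{\mathbf p\in\Gamma(\mathbf i)_{A,B}}I(\mathbf p),$$ where the sum is over all families of disjoint paths of type $(A,B)$ in the wiring diagram $\Gamma(\mathbf i)$.
   Context: $\mathbb C_q[SL_{n+1}]$ is generated by $x_{ij}$, $1\le i,j\le n+1$, with relations $x_{ij}x_{il}=qx_{il}x_{ij}$ ($j<l$), $x_{ij}x_{kj}=qx_{kj}x_{ij}$ ($i<k$), $x_{il}x_{kj}=x_{kj}x_{il}$ and $x_{ij}x_{kl}-x_{kl}x_{ij}=(q-q^{-1})x_{il}x_{kj}$ ($i<k$, $j<l$), $\det_q(x_{ij})=1$, where $\det_q(y_{ij})_{1\le i,j\le k}=\sum_{\tau\in S_k}(-q)^{l(\tau)}y_{1\tau(1)}\cdots y_{k\tau(k)}$; coproduct $\Delta(x_{ij})=\sum_kx_{ik}\otimes x_{kj}$. The quantum minor $\Delta_{q,A,B}$ is the quantum determinant of the submatrix of $(x_{ij})$ with rows $A$ and columns $B$ (indices in increasing order). A reduced expression of $(w_1,w_2)$ is $\mathbf i=(i_1,\dots,i_m)$, $m=l(w_1)+l(w_2)$, $i_k\in\{\pm1,\dots,\pm n\}$, such that the ordered product of the simple transpositions $s_{|i_k|}=(|i_k|,|i_k|+1)$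 over $i_k<0$ is $w_1$ and over $i_k>0$ is $w_2$. $L_q(2)$ is generated by $x^{\pm1},y^{\pm1}$ with $xy=qyx$; $L_q(\mathbf i)=L_q(2)^{\otimes m}$, with $x_k^{\pm1},y_k^{\pm1}$ the generators of the $k$-th factor. For each $k$ let $\psi_k:\mathbb C_q[SL_{n+1}]\to L_q(2)$ be the algebra homomorphism with, for $h=|i_k|$: $\psi_k(x_{ii})=1$ for $i\notin\{h,h+1\}$, $\psi_k(x_{hh})=x$, $\psi_k(x_{h+1,h+1})=x^{-1}$, $\psi_k(x_{h,h+1})=y$ if $i_k>0$, $\psi_k(x_{h+1,h})=y$ if $i_k<0$, and $\psi_k(x_{ij})=0$ otherwise. $\tilde\pi_{\mathbf i}=(\psi_1\otimes\cdots\otimes\psi_m)\circ\Delta^{(m-1)}:\mathbb C_q[SL_{n+1}]\to L_q(\mathbf i)$. Wiring diagram $\Gamma(\mathbf i)$: the directed graph with vertices $(k,l)$, $0\le k\le m$, $1\le l\le n+1$ ($l$ is the level), and, for each $1\le k\le m$, the following edges oriented from left to right: horizontal edges $(k-1,l)\to(k,l)$ for every $l$, of weight $x_k$ if $l=|i_k|$, $x_k^{-1}$ if $l=|i_k|+1$, and $1$ otherwise; and one diagonal edge of weight $y_k$, namely $(k-1,|i_k|)\to(k,|i_k|+1)$ if $i_k>0$ and $(k-1,|i_k|+1)\to(k,|i_k|)$ if $i_k<0$. The weight $I(p)\in L_q(\mathbf i)$ of a path $p$ from the left side to the right side is the tensor product (over $k$) of the weights of its edges. $\Gamma(\mathbf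 i)_{A,B}$ is the set of families $\mathbf p=\{p_1,\dots,p_r\}$, $r=|A|$, of pairwise (vertex-)disjoint paths from the levels in $A$ on the left side to the levels in $B$ on the right side; $I(\mathbf p)=I(p_1)\cdots I(p_r)$, which does not depend on the order of the factors. *)

theory Defs
  imports
    "HOL-Algebra.QuotRing"
    "HOL-Algebra.Module"
    "HOL-Library.Poly_Mapping"
    "HOL-Combinatorics.Permutations"
    "Graph_Theory.Vertex_Walk"
    "Graph_Theory.Pair_Digraph"
begin

section \<open>Complex algebras\<close>

text \<open>
  An associative unital complex algebra, not necessarily commutative, is a record of type
  \<open>(complex, 'a) module\<close>: a ring together with a scalar multiplication. (The locale
  \<open>algebra\<close> of the library is restricted to commutative algebras and is not used.)
\<close>

definition list_prod :: "('a, 'b) monoid_scheme \<Rightarrow> 'a list \<Rightarrow> 'a" where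
  "list_prod M as = foldr (\<otimes>\<^bsub>M\<^esub>) as \<one>\<^bsub>M\<^esub>"

text \<open>The vector space with basis \<open>carrier M\<close>, multiplied through \<open>M\<close>:\<close>

definition monoid_alg :: "'a monoid \<Rightarrow> (complex, 'a \<Rightarrow>\<^sub>0 complex) module" where
  "monoid_alg M =
    \<lparr>carrier = {f. Poly_Mapping.keys f \<subseteq> carrier M},
     monoid.mult = (\<lambda>f g. \<Sum>u\<in>Poly_Mapping.keys f. \<Sum>v\<in>Poly_Mapping.keys g.
        Poly_Mapping.single (u \<otimes>\<^bsub>M\<^esub> v) (Poly_Mapping.lookup f u * Poly_Mapping.lookup g v)),
     one = Poly_Mapping.single \<one>\<^bsub>M\<^esub> 1,
     zero = 0,
     add = (+),
     smult = (\<lambda>c. Poly_Mapping.map ((*) c))\<rparr>"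

definition alg_quot ::
  "(complex, 'a) module \<Rightarrow> 'a set \<Rightarrow> (complex, 'a set) module" where
  "alg_quot A I =
    \<lparr>carrier = carrier (A Quot I),
     monoid.mult = monoid.mult (A Quot I),
     one = one (A Quot I),
     zero = zero (A Quot I),
     add = add (A Quot I),
     smult = (\<lambda>c X. \<Union>a\<in>X. I +>\<^bsub>A\<^esub> (c \<odot>\<^bsub>A\<^esub> a))\<rparr>"

text \<open>
  The linear map into \<open>V\<close> with value \<open>F u\<close> on the basis element \<open>u\<close>, and the map it induces
  on cosets (of any subspace on which it vanishes).
\<close>

definition lin_ext :: "(complex, 'b) module \<Rightarrow> ('a \<Rightarrow> 'b) \<Rightarrow> ('a \<Rightarrow>\<^sub>0 complex) \<Rightarrow> 'b" where
  "lin_ext V F f =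
    (\<Oplus>\<^bsub>V\<^esub>u\<in>Poly_Mapping.keys f. Poly_Mapping.lookup f u \<odot>\<^bsub>V\<^esub> F u)"

definition induced_lin ::
  "(complex, 'b) module \<Rightarrow> ('a \<Rightarrow> 'b) \<Rightarrow> ('a \<Rightarrow>\<^sub>0 complex) set \<Rightarrow> 'b" where
  "induced_lin V F X = the_elem (lin_ext V F ` X)"


section \<open>Algebras given by generators and relations\<close>

definition free_monoid :: "'g set \<Rightarrow> 'g list monoid" where
  "free_monoid G = \<lparr>carrier = lists G, monoid.mult = (@), one = []\<rparr>"

abbreviation free_alg :: "'g set \<Rightarrow> (complex, 'g list \<Rightarrow>\<^sub>0 complex) module" where
  "free_alg G \<equiv> monoid_alg (free_monoid G)"

definition var :: "'g \<Rightarrow> 'g list \<Rightarrow>\<^sub>0 complex" where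
  "var g = Poly_Mapping.single [g] 1"

text \<open>A relation \<open>l = r\<close> is given as the pair \<open>(l, r)\<close>.\<close>

definition rel_ideal ::
  "'g set \<Rightarrow> (('g list \<Rightarrow>\<^sub>0 complex) \<times> ('g list \<Rightarrow>\<^sub>0 complex)) set \<Rightarrow>
    ('g list \<Rightarrow>\<^sub>0 complex) set" where
  "rel_ideal G R = Idl\<^bsub>free_alg G\<^esub> ((\<lambda>(l, r). l - r) ` R)"

definition presented_alg ::
  "'g set \<Rightarrow> (('g list \<Rightarrow>\<^sub>0 complex) \<times> ('g list \<Rightarrow>\<^sub>0 complex)) set \<Rightarrow>
    (complex, ('g list \<Rightarrow>\<^sub>0 complex) set) module" where
  "presented_alg G R = alg_quot (free_alg G) (rel_ideal G R)"

definition presented_gen ::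
  "'g set \<Rightarrow> (('g list \<Rightarrow>\<^sub>0 complex) \<times> ('g list \<Rightarrow>\<^sub>0 complex)) set \<Rightarrow>
    'g \<Rightarrow> ('g list \<Rightarrow>\<^sub>0 complex) set" where
  "presented_gen G R g = rel_ideal G R +>\<^bsub>free_alg G\<^esub> var g"

text \<open>
  The algebra homomorphism from a presented algebra to \<open>B\<close> that sends each generator \<open>g\<close> to
  \<open>\<phi> g\<close> (provided the \<open>\<phi> g\<close> satisfy the relations).
\<close>

definition presented_hom ::
  "(complex, 'b) module \<Rightarrow> ('g \<Rightarrow> 'b) \<Rightarrow> ('g list \<Rightarrow>\<^sub>0 complex) set \<Rightarrow> 'b" where
  "presented_hom B \<phi> = induced_lin B (\<lambda>w. list_prod B (map \<phi> w))"


section \<open>Tensor powers\<close>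

text \<open>
  The \<open>m\<close>-th tensor power of \<open>A\<close> is the vector space with basis the \<open>m\<close>-tuples of elements of
  \<open>A\<close> modulo the multilinearity relations; pure tensors are multiplied componentwise. The
  multilinearity relations span a two-sided ideal, so it makes no difference that the ideal
  generated by them is taken instead of their span.
\<close>

definition tuple_monoid :: "(complex, 'a) module \<Rightarrow> nat \<Rightarrow> 'a list monoid" where
  "tuple_monoid A m =
    \<lparr>carrier = {u. length u = m \<and> set u \<subseteq> carrier A},
     monoid.mult = map2 (\<otimes>\<^bsub>A\<^esub>),
     one = replicate m \<one>\<^bsub>A\<^esub>\<rparr>"

definition multilinear_relators ::
  "(complex, 'a) module \<Rightarrow> nat \<Rightarrow> ('a list \<Rightarrow>\<^sub>0 complex) set" where
  "multilinear_relators A m =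
    {Poly_Mapping.single (u[k := a \<oplus>\<^bsub>A\<^esub> b]) 1
        - Poly_Mapping.single (u[k := a]) 1 - Poly_Mapping.single (u[k := b]) 1 | u k a b.
      u \<in> carrier (tuple_monoid A m) \<and> k < m \<and> a \<in> carrier A \<and> b \<in> carrier A} \<union>
    {Poly_Mapping.single (u[k := c \<odot>\<^bsub>A\<^esub> a]) 1 - Poly_Mapping.single (u[k := a]) c | u k c a.
      u \<in> carrier (tuple_monoid A m) \<and> k < m \<and> a \<in> carrier A}"

definition tensor_ideal ::
  "(complex, 'a) module \<Rightarrow> nat \<Rightarrow> ('a list \<Rightarrow>\<^sub>0 complex) set" where
  "tensor_ideal A m = Idl\<^bsub>monoid_alg (tuple_monoid A m)\<^esub> (multilinear_relators A m)"

definition tensor_power ::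
  "(complex, 'a) module \<Rightarrow> nat \<Rightarrow> (complex, ('a list \<Rightarrow>\<^sub>0 complex) set) module" where
  "tensor_power A m = alg_quot (monoid_alg (tuple_monoid A m)) (tensor_ideal A m)"

text \<open>The pure tensor of the entries of a list \<open>u\<close>, in the \<open>length u\<close>-th tensor power:\<close>

definition pure_tensor ::
  "(complex, 'a) module \<Rightarrow> 'a list \<Rightarrow> ('a list \<Rightarrow>\<^sub>0 complex) set" where
  "pure_tensor A u =
    tensor_ideal A (length u) +>\<^bsub>monoid_alg (tuple_monoid A (length u))\<^esub>
      Poly_Mapping.single u 1"

text \<open>The tensor product of a list of linear maps into \<open>B\<close>:\<close>

definition tensor_map ::
  "(complex, 'b) module \<Rightarrow> ('a \<Rightarrow> 'b) list \<Rightarrow>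
    ('a list \<Rightarrow>\<^sub>0 complex) set \<Rightarrow> ('b list \<Rightarrow>\<^sub>0 complex) set" where
  "tensor_map B fs =
    induced_lin (tensor_power B (length fs)) (\<lambda>u. pure_tensor B (map2 (\<lambda>f a. f a) fs u))"


section \<open>Permutations and the quantum determinant\<close>

definition simple_prod :: "nat list \<Rightarrow> nat \<Rightarrow> nat" where
  "simple_prod js = foldr (\<lambda>j. (\<circ>) (transpose j (Suc j))) js id"

text \<open>The Coxeter length in the symmetric group on \<open>{1..k}\<close>:\<close>

definition perm_length :: "nat \<Rightarrow> (nat \<Rightarrow> nat) \<Rightarrow> nat" where
  "perm_length k w =
    (LEAST r. \<exists>js. length js = r \<and> set js \<subseteq> {1..<k} \<and> simple_prod js = w)"

definition qdet :: "(complex, 'a) module \<Rightarrow> complex \<Rightarrow> nat \<Rightarrow> (nat \<Rightarrow> nat \<Rightarrow> 'a) \<Rightarrow> 'a" where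
  "qdet A q k y =
    (\<Oplus>\<^bsub>A\<^esub>\<tau>\<in>{\<tau>. \<tau> permutes {1..k}}.
      ((- q) ^ perm_length k \<tau>) \<odot>\<^bsub>A\<^esub> list_prod A (map (\<lambda>i. y i (\<tau> i)) [1..<Suc k]))"


section \<open>The quantized coordinate ring of \<open>SL\<^bsub>n+1\<^esub>\<close>\<close>

type_synonym qsl_elem = "((nat \<times> nat) list \<Rightarrow>\<^sub>0 complex) set"

definition qsl_gens :: "nat \<Rightarrow> (nat \<times> nat) set" where
  "qsl_gens n = {1..n+1} \<times> {1..n+1}"

definition qsl_rels ::
  "complex \<Rightarrow> nat \<Rightarrow>
    (((nat \<times> nat) list \<Rightarrow>\<^sub>0 complex) \<times> ((nat \<times> nat) list \<Rightarrow>\<^sub>0 complex)) set" where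
  "qsl_rels q n =
    (let F = free_alg (qsl_gens n); N = {1..n+1}; x = (\<lambda>i j. var (i, j)) in
      {(x i j \<otimes>\<^bsub>F\<^esub> x i l, q \<odot>\<^bsub>F\<^esub> (x i l \<otimes>\<^bsub>F\<^esub> x i j)) | i j l.
        i \<in> N \<and> j \<in> N \<and> l \<in> N \<and> j < l} \<union>
      {(x i j \<otimes>\<^bsub>F\<^esub> x k j, q \<odot>\<^bsub>F\<^esub> (x k j \<otimes>\<^bsub>F\<^esub> x i j)) | i j k.
        i \<in> N \<and> j \<in> N \<and> k \<in> N \<and> i < k} \<union>
      {(x i l \<otimes>\<^bsub>F\<^esub> x k j, x k j \<otimes>\<^bsub>F\<^esub> x i l) | i j k l.
        i \<in> N \<and> j \<in> N \<and> k \<in> N \<and> l \<in> N \<and> i < k \<and> j < l} \<union>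
      {(x i j \<otimes>\<^bsub>F\<^esub> x k l - x k l \<otimes>\<^bsub>F\<^esub> x i j,
        (q - inverse q) \<odot>\<^bsub>F\<^esub> (x i l \<otimes>\<^bsub>F\<^esub> x k j)) | i j k l.
        i \<in> N \<and> j \<in> N \<and> k \<in> N \<and> l \<in> N \<and> i < k \<and> j < l} \<union>
      {(qdet F q (n+1) x, \<one>\<^bsub>F\<^esub>)})"

definition qsl :: "complex \<Rightarrow> nat \<Rightarrow> (complex, qsl_elem) module" where
  "qsl q n = presented_alg (qsl_gens n) (qsl_rels q n)"

definition qsl_x :: "complex \<Rightarrow> nat \<Rightarrow> nat \<Rightarrow> nat \<Rightarrow> qsl_elem" where
  "qsl_x q n i j = presented_gen (qsl_gens n) (qsl_rels q n) (i, j)"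

definition comult :: "complex \<Rightarrow> nat \<Rightarrow> qsl_elem \<Rightarrow> (qsl_elem list \<Rightarrow>\<^sub>0 complex) set" where
  "comult q n = presented_hom (tensor_power (qsl q n) 2)
    (\<lambda>(i, j). \<Oplus>\<^bsub>tensor_power (qsl q n) 2\<^esub>k\<in>{1..n+1}.
      pure_tensor (qsl q n) [qsl_x q n i k, qsl_x q n k j])"

text \<open>The counit, with values in the zeroth tensor power (a copy of the complex numbers):\<close>

definition counit :: "complex \<Rightarrow> nat \<Rightarrow> qsl_elem \<Rightarrow> (qsl_elem list \<Rightarrow>\<^sub>0 complex) set" where
  "counit q n = presented_hom (tensor_power (qsl q n) 0)
    (\<lambda>(i, j). if i = j then \<one>\<^bsub>tensor_power (qsl q n) 0\<^esub> else \<zero>\<^bsub>tensor_power (qsl q n) 0\<^esub>)"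

text \<open>
  The comultiplication applied to the first of \<open>m \<ge> 1\<close> tensor factors: the basis tuple
  \<open>(u\<^sub>1, \<dots>, u\<^sub>m)\<close> is sent to \<open>\<Delta>(u\<^sub>1) \<otimes> u\<^sub>2 \<otimes> \<dots> \<otimes> u\<^sub>m\<close>.
\<close>

definition comult_first ::
  "complex \<Rightarrow> nat \<Rightarrow> nat \<Rightarrow>
    (qsl_elem list \<Rightarrow>\<^sub>0 complex) set \<Rightarrow> (qsl_elem list \<Rightarrow>\<^sub>0 complex) set" where
  "comult_first q n m =
    induced_lin (tensor_power (qsl q n) (Suc m))
      (\<lambda>u. induced_lin (tensor_power (qsl q n) (Suc m))
        (\<lambda>v. pure_tensor (qsl q n) (v @ tl u)) (comult q n (hd u)))"

text \<open>
  \<open>iter_comult q n m\<close> is \<open>\<Delta>\<^bsup>(m-1)\<^esup>\<close>, with \<open>m\<close> tensor factors in the target; it is the counit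
  for \<open>m = 0\<close> and (up to the identification of an algebra with its first tensor power) the
  identity for \<open>m = 1\<close>.
\<close>

fun iter_comult ::
  "complex \<Rightarrow> nat \<Rightarrow> nat \<Rightarrow> qsl_elem \<Rightarrow> (qsl_elem list \<Rightarrow>\<^sub>0 complex) set" where
  "iter_comult q n 0 = counit q n"
| "iter_comult q n (Suc 0) = (\<lambda>a. pure_tensor (qsl q n) [a])"
| "iter_comult q n (Suc (Suc m)) = comult_first q n (Suc m) \<circ> iter_comult q n (Suc m)"

definition quantum_minor :: "complex \<Rightarrow> nat \<Rightarrow> nat set \<Rightarrow> nat set \<Rightarrow> qsl_elem" where
  "quantum_minor q n A B =
    qdet (qsl q n) q (card A)
      (\<lambda>i j. qsl_x q n (sorted_list_of_set A ! (i - 1)) (sorted_list_of_set B ! (j - 1)))"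


section \<open>The algebras \<open>L\<^sub>q(2)\<close> and \<open>L\<^sub>q(\<^bold>i)\<close>\<close>

text \<open>\<open>X'\<close> and \<open>Y'\<close> are the inverses of \<open>X\<close> and \<open>Y\<close>.\<close>

datatype Lq2_gen = X | X' | Y | Y'

type_synonym Lq2_elem = "(Lq2_gen list \<Rightarrow>\<^sub>0 complex) set"

definition Lq2_rels ::
  "complex \<Rightarrow> ((Lq2_gen list \<Rightarrow>\<^sub>0 complex) \<times> (Lq2_gen list \<Rightarrow>\<^sub>0 complex)) set" where
  "Lq2_rels q =
    (let F = free_alg UNIV in
      {(var X \<otimes>\<^bsub>F\<^esub> var X', \<one>\<^bsub>F\<^esub>), (var X' \<otimes>\<^bsub>F\<^esub> var X, \<one>\<^bsub>F\<^esub>),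
       (var Y \<otimes>\<^bsub>F\<^esub> var Y', \<one>\<^bsub>F\<^esub>), (var Y' \<otimes>\<^bsub>F\<^esub> var Y, \<one>\<^bsub>F\<^esub>),
       (var X \<otimes>\<^bsub>F\<^esub> var Y, q \<odot>\<^bsub>F\<^esub> (var Y \<otimes>\<^bsub>F\<^esub> var X))})"

definition Lq2 :: "complex \<Rightarrow> (complex, Lq2_elem) module" where
  "Lq2 q = presented_alg UNIV (Lq2_rels q)"

definition Lq2_of :: "complex \<Rightarrow> Lq2_gen \<Rightarrow> Lq2_elem" where
  "Lq2_of q = presented_gen UNIV (Lq2_rels q)"

abbreviation Lq :: "complex \<Rightarrow> int list \<Rightarrow> (complex, (Lq2_elem list \<Rightarrow>\<^sub>0 complex) set) module"
  where "Lq q is \<equiv> tensor_power (Lq2 q) (length is)"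


section \<open>Reduced expressions and the map \<open>\<pi>\<^bsub>i\<^esub>\<close>\<close>

text \<open>
  The expression \<open>(i\<^sub>1, \<dots>, i\<^sub>m)\<close> is the list \<open>is\<close>, so that \<open>i\<^sub>k\<close> is \<open>is ! (k - 1)\<close>.
\<close>

definition reduced_expression ::
  "nat \<Rightarrow> (nat \<Rightarrow> nat) \<Rightarrow> (nat \<Rightarrow> nat) \<Rightarrow> int list \<Rightarrow> bool" where
  "reduced_expression n w1 w2 is \<longleftrightarrow>
    length is = perm_length (n+1) w1 + perm_length (n+1) w2 \<and>
    set is \<subseteq> {- int n..int n} - {0} \<and>
    simple_prod (map (\<lambda>i. nat \<bar>i\<bar>) (filter (\<lambda>i. i < 0) is)) = w1 \<and>
    simple_prod (map (\<lambda>i. nat \<bar>i\<bar>) (filter (\<lambda>i. i > 0) is)) = w2"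

definition psi :: "complex \<Rightarrow> int \<Rightarrow> qsl_elem \<Rightarrow> Lq2_elem" where
  "psi q ik =
    (let h = nat \<bar>ik\<bar> in
      presented_hom (Lq2 q)
        (\<lambda>(i, j).
          if i = j then
            (if i = h then Lq2_of q X else if i = h + 1 then Lq2_of q X' else \<one>\<^bsub>Lq2 q\<^esub>)
          else if ik > 0 \<and> (i, j) = (h, h + 1) \<or> ik < 0 \<and> (i, j) = (h + 1, h) then Lq2_of q Y
          else \<zero>\<^bsub>Lq2 q\<^esub>))"

definition pi_tilde ::
  "complex \<Rightarrow> nat \<Rightarrow> int list \<Rightarrow> qsl_elem \<Rightarrow> (Lq2_elem list \<Rightarrow>\<^sub>0 complex) set" where
  "pi_tilde q n is = tensor_map (Lq2 q) (map (psi q) is) \<circ> iter_comult q n (length is)"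


section \<open>The wiring diagram\<close>

text \<open>
  The vertex \<open>(k, l)\<close> lies in column \<open>k\<close>, on level \<open>l\<close>. The arcs from column \<open>k\<close> to column
  \<open>k + 1\<close> are governed by \<open>is ! k\<close>, the \<open>(k + 1)\<close>-st entry of the expression. There are no
  parallel arcs, so a path is determined by its list of vertices.
\<close>

definition wiring_diagram :: "nat \<Rightarrow> int list \<Rightarrow> (nat \<times> nat) pair_pre_digraph" where
  "wiring_diagram n is =
    \<lparr>pverts = {0..length is} \<times> {1..n+1},
     parcs =
       {((k, l), (k + 1, l)) | k l. k < length is \<and> l \<in> {1..n+1}} \<union>
       {((k, nat \<bar>is ! k\<bar>), (k + 1, nat \<bar>is ! k\<bar> + 1)) | k. k < length is \<and> is ! k > 0} \<union>
       {((k, nat \<bar>is ! k\<bar> + 1), (k + 1, nat \<bar>is ! k\<bar>)) | k. k < length is \<and> is ! k < 0}\<rparr>"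

fun arc_weight :: "complex \<Rightarrow> int list \<Rightarrow> (nat \<times> nat) \<times> (nat \<times> nat) \<Rightarrow> Lq2_elem" where
  "arc_weight q is ((k, l), (k', l')) =
    (if l = l' then
      (if l = nat \<bar>is ! k\<bar> then Lq2_of q X
       else if l = nat \<bar>is ! k\<bar> + 1 then Lq2_of q X'
       else \<one>\<^bsub>Lq2 q\<^esub>)
     else Lq2_of q Y)"

definition path_weight ::
  "complex \<Rightarrow> int list \<Rightarrow> (nat \<times> nat) list \<Rightarrow> (Lq2_elem list \<Rightarrow>\<^sub>0 complex) set" where
  "path_weight q is p = pure_tensor (Lq2 q) (map (arc_weight q is) (vwalk_arcs p))"

definition path_families ::
  "nat \<Rightarrow> int list \<Rightarrow> nat set \<Rightarrow> nat set \<Rightarrow> (nat \<times> nat) list set set" where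
  "path_families n is A B =
    {P. finite P \<and> card P = card A \<and>
      (\<forall>p\<in>P. vpath p (with_proj (wiring_diagram n is)) \<and>
        hd p \<in> {0} \<times> A \<and> last p \<in> {length is} \<times> B) \<and>
      (\<forall>p\<in>P. \<forall>p'\<in>P. p \<noteq> p' \<longrightarrow> set p \<inter> set p' = {})}"

text \<open>
  The factors are multiplied in the order of increasing starting level. For pairwise disjoint
  paths they commute, so any other order gives the same product.
\<close>

definition family_weight ::
  "complex \<Rightarrow> int list \<Rightarrow> (nat \<times> nat) list set \<Rightarrow> (Lq2_elem list \<Rightarrow>\<^sub>0 complex) set" where
  "family_weight q is P =
    list_prod (Lq q is)
      (map (path_weight q is) (sorted_key_list_of_set (\<lambda>p. snd (hd p)) P))"

end

theory Submission
  imports Defs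
begin

text \<open>
  The quadratic relations of the quantized coordinate ring say that \<open>(x i j)\<close> commutes with the
  R-matrix, a condition stable under matrix products; this makes the comultiplication well
  defined. The same relations give the behaviour of quantum determinants under adjacent row swaps
  (a factor \<open>- q\<close>, or zero for equal rows), whence the quantum Cauchy-Binet formula:
  \<open>\<Delta>(\<Delta>\<^bsub>A,B\<^esub>) = \<Sum>\<^bsub>C\<^esub> \<Delta>\<^bsub>A,C\<^esub> \<otimes> \<Delta>\<^bsub>C,B\<^esub>\<close>. Iterating, a quantum minor is sent to a sum over chains
  \<open>A = C\<^sub>0, C\<^sub>1, \<dots>, C\<^sub>m = B\<close> of equinumerous sets. The matrices \<open>\<psi>\<^sub>k(x i j)\<close> are bidiagonal, so in each of
  their minors only the identity permutation contributes. The minor is therefore the product of the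
  weights of the arcs in column \<open>k\<close> which join the \<open>i\<close>-th element of \<open>C\<^bsub>k-1\<^esub>\<close> to the \<open>i\<close>-th element
  of \<open>C\<^sub>k\<close>, or zero if one of these arcs is missing. Since disjoint paths cannot cross, the chains
  without missing arcs are exactly the families of disjoint paths.
\<close>

text \<open>The maps in the statement are read off cosets with \<open>the_elem\<close>, so each has
  a usable value only after its linear extension is shown to vanish on the defining ideal. For the
  comultiplication this means that the product matrix must satisfy the quadratic relations and have
  quantum determinant 1; the latter is the case \<open>r = n + 1\<close> of Cauchy-Binet, whose only
  index set is \<open>{1..n+1}\<close>. Hence Cauchy-Binet is proved for an arbitrary quantum matrix
  and an abstract bilinear product \<open>P\<close>, before the comultiplication is known to be well
  defined, and is then used a second time for the minors. Its proof chooses an index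
  \<open>c i\<close> for each row; an injective choice is an increasing enumeration after a
  permutation, whose power of \<open>- q\<close> completes the minor in the left factor. The final
  comparison works term by term because paths that do not cross keep their order: the i-th path,
  counted by starting level, is at the i-th smallest level of every column. So the product over
  paths in \<open>family_weight\<close> has, in each tensor factor, the same order of factors as the
  diagonal product of the minor.\<close>

no_notation vwalk_join (infixr "\<oplus>" 65)

section \<open>Complex algebras and linear maps\<close>

text \<open>Scalars range over the type \<open>complex\<close> instead of the carrier of a
  coefficient ring, so no closure condition on them appears. The last two axioms make the product
  bilinear.\<close>

locale calg = ring V for V :: "(complex, 'a) module" (structure) +
  assumes smult_closed [simp, intro]: "x \<in> carrier V \<Longrightarrow> c \<odot> x \<in> carrier V"
    and smult_add_left: "x \<in> carrier V \<Longrightarrow> (c + d) \<odot> x = c \<odot> x \<oplus> d \<odot> x"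
    and smult_add_right:
      "x \<in> carrier V \<Longrightarrow> y \<in> carrier V \<Longrightarrow> c \<odot> (x \<oplus> y) = c \<odot> x \<oplus> c \<odot> y"
    and smult_smult: "x \<in> carrier V \<Longrightarrow> c \<odot> (d \<odot> x) = (c * d) \<odot> x"
    and smult_one [simp]: "x \<in> carrier V \<Longrightarrow> 1 \<odot> x = x"
    and smult_mult_left:
      "x \<in> carrier V \<Longrightarrow> y \<in> carrier V \<Longrightarrow> (c \<odot> x) \<otimes> y = c \<odot> (x \<otimes> y)"
    and smult_mult_right:
      "x \<in> carrier V \<Longrightarrow> y \<in> carrier V \<Longrightarrow> x \<otimes> (c \<odot> y) = c \<odot> (x \<otimes> y)"
begin

lemma smult_zero_left [simp]: "x \<in> carrier V \<Longrightarrow> 0 \<odot> x = \<zero>"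
  using smult_add_left[of x 0 0] by (simp add: add.l_cancel_one')

lemma smult_zero_right [simp]: "c \<odot> \<zero> = \<zero>"
  using smult_add_right[of \<zero> \<zero> c] by (simp add: add.l_cancel_one')

lemma smult_minus_left: "x \<in> carrier V \<Longrightarrow> (- c) \<odot> x = \<ominus> (c \<odot> x)"
  using smult_add_left[of x "-c" c] by (intro minus_equality[symmetric]) auto

text \<open>\<open>lin_map\<close> asks only for sums and scalar multiples; this turns differences
  into a case of both.\<close>

lemma smult_minus_one: "x \<in> carrier V \<Longrightarrow> \<ominus> x = (- 1) \<odot> x"
  by (simp add: smult_minus_left)

lemma finsum_smult:
  "f \<in> S \<rightarrow> carrier V \<Longrightarrow> c \<odot> (\<Oplus>i\<in>S. f i) = (\<Oplus>i\<in>S. c \<odot> f i)"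
proof (induction S rule: infinite_finite_induct)
  case (insert a S)
  then have "f a \<in> carrier V" "f \<in> S \<rightarrow> carrier V" by auto
  with insert show ?case
    by (subst finsum_insert; auto simp: finsum_closed smult_add_right Pi_iff)
\<comment> \<open>A sum over an infinite set has the default value zero, which scalars fix.\<close>
qed (auto simp: finsum_infinite)

lemma list_prod_closed [simp, intro]: "set as \<subseteq> carrier V \<Longrightarrow> list_prod V as \<in> carrier V"
  by (induction as) (auto simp: list_prod_def)

lemma list_prod_Cons: "list_prod V (a # as) = a \<otimes> list_prod V as"
  by (simp add: list_prod_def)

lemma list_prod_Nil [simp]: "list_prod V [] = \<one>"
  by (simp add: list_prod_def)

lemma list_prod_append:
  "set as \<subseteq> carrier V \<Longrightarrow> set bs \<subseteq> carrier V \<Longrightarrow>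
    list_prod V (as @ bs) = list_prod V as \<otimes> list_prod V bs"
proof (induction as)
  case (Cons a as)
  then show ?case by (auto simp: list_prod_Cons m_assoc)
qed (auto)

lemma list_prod_zero:
  "set as \<subseteq> carrier V \<Longrightarrow> \<zero> \<in> set as \<Longrightarrow> list_prod V as = \<zero>"
  by (induction as) (auto simp: list_prod_Cons)

end

section \<open>Finite sums in an abelian monoid\<close>

context abelian_monoid
begin

text \<open>For infinite \<open>A\<close> the left side and every inner sum on the right take the
  default value zero, so finiteness is asked of \<open>B\<close> only.\<close>

lemma finsum_swap:
  assumes "finite B" "\<And>i j. i \<in> A \<Longrightarrow> j \<in> B \<Longrightarrow> f i j \<in> carrier G"
  shows "(\<Oplus>i\<in>A. \<Oplus>j\<in>B. f i j) = (\<Oplus>j\<in>B. \<Oplus>i\<in>A. f i j)"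
  using assms(2)
proof (induction A rule: infinite_finite_induct)
  case (insert a A)
  have "(\<Oplus>i\<in>insert a A. \<Oplus>j\<in>B. f i j) = (\<Oplus>j\<in>B. f a j) \<oplus> (\<Oplus>i\<in>A. \<Oplus>j\<in>B. f i j)"
    using insert by (intro finsum_insert) (auto intro!: finsum_closed)
  also have "\<dots> = (\<Oplus>j\<in>B. f a j) \<oplus> (\<Oplus>j\<in>B. \<Oplus>i\<in>A. f i j)"
    using insert by auto
  also have "\<dots> = (\<Oplus>j\<in>B. f a j \<oplus> (\<Oplus>i\<in>A. f i j))"
    using insert by (intro finsum_addf[symmetric]) (auto intro!: finsum_closed)
  also have "\<dots> = (\<Oplus>j\<in>B. \<Oplus>i\<in>insert a A. f i j)"
    using insert by (intro finsum_cong') (auto intro!: finsum_closed)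
  finally show ?case .
qed (auto simp: finsum_infinite)

lemma finsum_Times:
  assumes "finite A" "finite B" "\<And>i j. i \<in> A \<Longrightarrow> j \<in> B \<Longrightarrow> f i j \<in> carrier G"
  shows "(\<Oplus>i\<in>A. \<Oplus>j\<in>B. f i j) = (\<Oplus>p\<in>A \<times> B. f (fst p) (snd p))"
  using assms(1,3)
proof (induction A)
  case (insert a A)
  have "(\<Oplus>p\<in>Pair a ` B. f (fst p) (snd p)) = (\<Oplus>j\<in>B. f a j)"
    using insert assms(2) by (subst finsum_reindex) (auto simp: inj_on_def)
  moreover have "insert a A \<times> B = (Pair a ` B) \<union> (A \<times> B)" by auto
  moreover have "(\<Oplus>p\<in>(Pair a ` B) \<union> (A \<times> B). f (fst p) (snd p)) =
      (\<Oplus>p\<in>Pair a ` B. f (fst p) (snd p)) \<oplus> (\<Oplus>p\<in>A \<times> B. f (fst p) (snd p))"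
    using insert assms(2) by (intro finsum_Un_disjoint) auto
  moreover have "(\<Oplus>i\<in>insert a A. \<Oplus>j\<in>B. f i j) = (\<Oplus>j\<in>B. f a j) \<oplus> (\<Oplus>i\<in>A. \<Oplus>j\<in>B. f i j)"
    using insert by (intro finsum_insert) (auto intro!: finsum_closed)
  ultimately show ?case using insert by simp
qed auto

lemma finsum_bij_betw:
  assumes "bij_betw h A B" "f \<in> B \<rightarrow> carrier G"
  shows "(\<Oplus>i\<in>B. f i) = (\<Oplus>i\<in>A. f (h i))"
  using assms finsum_reindex[of f h A] by (auto simp: bij_betw_def)

lemma finsum_neutral_subset:
  assumes "finite B" "A \<subseteq> B" "\<And>i. i \<in> B - A \<Longrightarrow> f i = \<zero>" "f \<in> A \<rightarrow> carrier G"
  shows "(\<Oplus>i\<in>B. f i) = (\<Oplus>i\<in>A. f i)"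
  using assms by (intro add.finprod_mono_neutral_cong_right) auto

end

section \<open>Linear maps and algebra homomorphisms\<close>

definition lin_map :: "(complex, 'a) module \<Rightarrow> (complex, 'b) module \<Rightarrow> ('a \<Rightarrow> 'b) \<Rightarrow> bool" where
  "lin_map V W T \<longleftrightarrow> T \<in> carrier V \<rightarrow> carrier W \<and>
    (\<forall>x\<in>carrier V. \<forall>y\<in>carrier V. T (x \<oplus>\<^bsub>V\<^esub> y) = T x \<oplus>\<^bsub>W\<^esub> T y) \<and>
    (\<forall>c. \<forall>x\<in>carrier V. T (c \<odot>\<^bsub>V\<^esub> x) = c \<odot>\<^bsub>W\<^esub> T x)"

definition alg_map :: "(complex, 'a) module \<Rightarrow> (complex, 'b) module \<Rightarrow> ('a \<Rightarrow> 'b) \<Rightarrow> bool" where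
  "alg_map V W T \<longleftrightarrow> lin_map V W T \<and> T \<one>\<^bsub>V\<^esub> = \<one>\<^bsub>W\<^esub> \<and>
    (\<forall>x\<in>carrier V. \<forall>y\<in>carrier V. T (x \<otimes>\<^bsub>V\<^esub> y) = T x \<otimes>\<^bsub>W\<^esub> T y)"

lemma lin_mapI:
  assumes "\<And>x. x \<in> carrier V \<Longrightarrow> T x \<in> carrier W"
    "\<And>x y. x \<in> carrier V \<Longrightarrow> y \<in> carrier V \<Longrightarrow> T (x \<oplus>\<^bsub>V\<^esub> y) = T x \<oplus>\<^bsub>W\<^esub> T y"
    "\<And>c x. x \<in> carrier V \<Longrightarrow> T (c \<odot>\<^bsub>V\<^esub> x) = c \<odot>\<^bsub>W\<^esub> T x"
  shows "lin_map V W T"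
  using assms by (auto simp: lin_map_def)

lemma lin_mapD:
  assumes "lin_map V W T"
  shows "x \<in> carrier V \<Longrightarrow> T x \<in> carrier W"
    "x \<in> carrier V \<Longrightarrow> y \<in> carrier V \<Longrightarrow> T (x \<oplus>\<^bsub>V\<^esub> y) = T x \<oplus>\<^bsub>W\<^esub> T y"
    "x \<in> carrier V \<Longrightarrow> T (c \<odot>\<^bsub>V\<^esub> x) = c \<odot>\<^bsub>W\<^esub> T x"
  using assms by (auto simp: lin_map_def)

lemma alg_mapD:
  assumes "alg_map V W T"
  shows "lin_map V W T" "T \<one>\<^bsub>V\<^esub> = \<one>\<^bsub>W\<^esub>"
    "x \<in> carrier V \<Longrightarrow> y \<in> carrier V \<Longrightarrow> T (x \<otimes>\<^bsub>V\<^esub> y) = T x \<otimes>\<^bsub>W\<^esub> T y"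
  using assms by (auto simp: alg_map_def)

lemma alg_mapI:
  assumes "lin_map V W T" "T \<one>\<^bsub>V\<^esub> = \<one>\<^bsub>W\<^esub>"
    "\<And>x y. x \<in> carrier V \<Longrightarrow> y \<in> carrier V \<Longrightarrow> T (x \<otimes>\<^bsub>V\<^esub> y) = T x \<otimes>\<^bsub>W\<^esub> T y"
  shows "alg_map V W T"
  using assms by (auto simp: alg_map_def)

context
  fixes V :: "(complex, 'a) module" and W :: "(complex, 'b) module" and T
  assumes V: "calg V" and W: "calg W" and T: "lin_map V W T"
begin

lemma lin_map_zero: "T \<zero>\<^bsub>V\<^esub> = \<zero>\<^bsub>W\<^esub>"
proof -
  interpret V: calg V by (rule V)
  interpret W: calg W by (rule W)
  have "T (0 \<odot>\<^bsub>V\<^esub> \<zero>\<^bsub>V\<^esub>) = 0 \<odot>\<^bsub>W\<^esub> T \<zero>\<^bsub>V\<^esub>"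
    by (rule lin_mapD[OF T]) simp
  then show ?thesis using lin_mapD[OF T] by simp
qed

lemma lin_map_minus:
  assumes "x \<in> carrier V" "y \<in> carrier V"
  shows "T (x \<ominus>\<^bsub>V\<^esub> y) = T x \<ominus>\<^bsub>W\<^esub> T y"
proof -
  interpret V: calg V by (rule V)
  interpret W: calg W by (rule W)
  show ?thesis
    using assms lin_mapD[OF T] by (simp add: a_minus_def V.smult_minus_one W.smult_minus_one)
qed

lemma lin_map_finsum:
  assumes "f \<in> S \<rightarrow> carrier V"
  shows "T (\<Oplus>\<^bsub>V\<^esub>i\<in>S. f i) = (\<Oplus>\<^bsub>W\<^esub>i\<in>S. T (f i))"
proof -
  interpret V: calg V by (rule V)
  interpret W: calg W by (rule W)
  show ?thesis using assms
  proof (induction S rule: infinite_finite_induct)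
    case (insert a S)
    then show ?case
      by (subst V.finsum_insert; (subst W.finsum_insert)?)
        (auto simp: lin_mapD[OF T] Pi_iff)
  qed (auto simp: lin_map_zero V.finsum_infinite W.finsum_infinite)
qed

end

lemma alg_map_list_prod:
  assumes V: "calg V" and W: "calg W" and T: "alg_map V W T" and "set as \<subseteq> carrier V"
  shows "T (list_prod V as) = list_prod W (map T as)"
proof -
  interpret V: calg V by (rule V)
  interpret W: calg W by (rule W)
  show ?thesis using assms(4)
    by (induction as) (auto simp: V.list_prod_Cons W.list_prod_Cons alg_mapD[OF T])
qed

section \<open>Quantum determinants of arbitrary matrices\<close>

lemma permutes_in_interval:
  "\<tau> permutes {1..k::nat} \<Longrightarrow> i \<in> {1..k} \<Longrightarrow> \<tau> i \<in> {1..k}"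
  by (simp only: permutes_in_image)

context calg
begin

lemma qdet_factors_closed:
  assumes "y \<in> {1..k} \<rightarrow> {1..k} \<rightarrow> carrier V" "\<tau> permutes {1..k}"
  shows "set (map (\<lambda>i. y i (\<tau> i)) [1..<Suc k]) \<subseteq> carrier V"
proof -
  have "y i (\<tau> i) \<in> carrier V" if "i \<in> {1..k}" for i
    using that assms(1) permutes_in_interval[OF assms(2) that] by blast
  then show ?thesis by (auto simp del: upt_Suc)
qed

lemma qdet_term_closed:
  assumes "y \<in> {1..k} \<rightarrow> {1..k} \<rightarrow> carrier V" "\<tau> permutes {1..k}"
  shows "c \<odot> list_prod V (map (\<lambda>i. y i (\<tau> i)) [1..<Suc k]) \<in> carrier V"
  using qdet_factors_closed[OF assms] by blast

lemma qdet_closed: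
  assumes "y \<in> {1..k} \<rightarrow> {1..k} \<rightarrow> carrier V"
  shows "qdet V q k y \<in> carrier V"
  unfolding qdet_def using qdet_term_closed[OF assms] by (intro finsum_closed) blast

text \<open>Matrices are total functions, but only the block \<open>{1..k} \<times> {1..k}\<close>
  is read, since a permutation of \<open>{1..k}\<close> keeps the column index inside. This lets
  extensional index functions be replaced by plain ones.\<close>

lemma qdet_cong:
  assumes yz: "\<And>i j. i \<in> {1..k} \<Longrightarrow> j \<in> {1..k} \<Longrightarrow> y i j = z i j"
    and z: "z \<in> {1..k} \<rightarrow> {1..k} \<rightarrow> carrier V"
  shows "qdet V q k y = qdet V q k z"
proof -
  have *: "map (\<lambda>i. y i (\<tau> i)) [1..<Suc k] = map (\<lambda>i. z i (\<tau> i)) [1..<Suc k]"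
    if "\<tau> permutes {1..k}" for \<tau>
  proof (rule map_cong[OF refl])
    fix i assume "i \<in> set [1..<Suc k]"
    then have "i \<in> {1..k}" by auto
    then show "y i (\<tau> i) = z i (\<tau> i)"
      using yz permutes_in_interval[OF that] by blast
  qed
  show ?thesis unfolding qdet_def
  proof (rule finsum_cong')
    show "(\<lambda>\<tau>. (- q) ^ perm_length k \<tau> \<odot> list_prod V (map (\<lambda>i. z i (\<tau> i)) [1..<Suc k]))
        \<in> {\<tau>. \<tau> permutes {1..k}} \<rightarrow> carrier V"
      using qdet_term_closed[OF z] by blast
  next
    fix \<tau> assume "\<tau> \<in> {\<tau>. \<tau> permutes {1..k}}"
    then have "\<tau> permutes {1..k}" by simp
    from *[OF this] show "(- q) ^ perm_length k \<tau> \<odot> list_prod V (map (\<lambda>i. y i (\<tau> i)) [1..<Suc k]) =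
        (- q) ^ perm_length k \<tau> \<odot> list_prod V (map (\<lambda>i. z i (\<tau> i)) [1..<Suc k])"
      by (rule arg_cong)
  qed simp
qed

end

lemma alg_map_qdet:
  assumes V: "calg V" and W: "calg W" and T: "alg_map V W T"
    and y: "y \<in> {1..k} \<rightarrow> {1..k} \<rightarrow> carrier V"
  shows "T (qdet V q k y) = qdet W q k (\<lambda>i j. T (y i j))"
proof -
  interpret V: calg V by (rule V)
  interpret W: calg W by (rule W)
  have yT: "(\<lambda>i j. T (y i j)) \<in> {1..k} \<rightarrow> {1..k} \<rightarrow> carrier W"
    using y lin_mapD(1)[OF alg_mapD(1)[OF T]] by (force simp: Pi_iff)
  note cl = V.qdet_factors_closed[OF y] and clT = W.qdet_term_closed[OF yT]
  show ?thesis unfolding qdet_def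
    apply (subst lin_map_finsum[OF V W alg_mapD(1)[OF T]])
    using V.qdet_term_closed[OF y] apply blast
    apply (rule W.finsum_cong'[OF refl])
    using clT apply blast
    subgoal for \<tau>
      using cl[of \<tau>]
      by (simp add: lin_mapD(3)[OF alg_mapD(1)[OF T]] V.list_prod_closed alg_map_list_prod[OF V W T] comp_def del: upt_Suc)
    done
qed

section \<open>Monoid algebras\<close>

lemma lookup_map_times [simp]: "Poly_Mapping.lookup (Poly_Mapping.map ((*) c) f) u = c * Poly_Mapping.lookup (f :: _ \<Rightarrow>\<^sub>0 complex) u"
  by (simp add: map.rep_eq when_def)

lemma keys_map_times_subset:
  "Poly_Mapping.keys (Poly_Mapping.map ((*) c) (f :: _ \<Rightarrow>\<^sub>0 complex)) \<subseteq> Poly_Mapping.keys f"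
  by (auto simp: in_keys_iff)

lemma poly_mapping_sum_singles:
  fixes f :: "'a \<Rightarrow>\<^sub>0 'b::comm_monoid_add"
  shows "f = (\<Sum>u\<in>Poly_Mapping.keys f. Poly_Mapping.single u (Poly_Mapping.lookup f u))"
proof (rule poly_mapping_eqI)
  fix v
  have "(\<Sum>u\<in>Poly_Mapping.keys f. Poly_Mapping.lookup (Poly_Mapping.single u (Poly_Mapping.lookup f u)) v) =
      (\<Sum>u\<in>Poly_Mapping.keys f. if u = v then Poly_Mapping.lookup f v else 0)"
    by (intro sum.cong) (auto simp: lookup_single when_def)
  then show "Poly_Mapping.lookup f v = Poly_Mapping.lookup (\<Sum>u\<in>Poly_Mapping.keys f. Poly_Mapping.single u (Poly_Mapping.lookup f u)) v"
    by (auto simp: lookup_sum in_keys_iff)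
qed

text \<open>Every element is the finite sum of its monomials. Zero is a case of its own because
  \<open>C\<close> may be empty.\<close>

lemma poly_mapping_single_induct [consumes 1, case_names zero single add]:
  fixes f :: "'a \<Rightarrow>\<^sub>0 'b::comm_monoid_add"
  assumes "Poly_Mapping.keys f \<subseteq> C" "P 0" "\<And>u c. u \<in> C \<Longrightarrow> P (Poly_Mapping.single u c)"
    "\<And>f g. Poly_Mapping.keys f \<subseteq> C \<Longrightarrow> Poly_Mapping.keys g \<subseteq> C \<Longrightarrow> P f \<Longrightarrow> P g \<Longrightarrow> P (f + g)"
  shows "P f"
proof -
  have "P (\<Sum>u\<in>S. Poly_Mapping.single u (Poly_Mapping.lookup f u)) \<and>
      Poly_Mapping.keys (\<Sum>u\<in>S. Poly_Mapping.single u (Poly_Mapping.lookup f u)) \<subseteq> C"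
    if "finite S" "S \<subseteq> C" for S
    using that
  proof (induction S)
    case (insert a S)
    moreover have "Poly_Mapping.keys (Poly_Mapping.single a (Poly_Mapping.lookup f a)) \<subseteq> C"
      using insert by auto
    ultimately show ?case
      using assms(3,4) keys_add[of "Poly_Mapping.single a (Poly_Mapping.lookup f a)"
          "\<Sum>u\<in>S. Poly_Mapping.single u (Poly_Mapping.lookup f u)"] by auto
  qed (use assms in auto)
  from this[of "Poly_Mapping.keys f"] show ?thesis
    using assms(1) poly_mapping_sum_singles[of f] by simp
qed

locale basis_monoid = monoid G for G :: "'a monoid" (structure)
begin

text \<open>Cancellation can make the support of a sum smaller than the union of the supports.
  Summing over arbitrary finite supersets puts both sides of a distributive law over the same index
  set.\<close>

lemma monoid_alg_mult:
  assumes "finite S" "finite T" "Poly_Mapping.keys f \<subseteq> S" "Poly_Mapping.keys g \<subseteq> T"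
  shows "f \<otimes>\<^bsub>monoid_alg G\<^esub> g =
    (\<Sum>u\<in>S. \<Sum>v\<in>T. Poly_Mapping.single (u \<otimes>\<^bsub>G\<^esub> v) (Poly_Mapping.lookup f u * Poly_Mapping.lookup g v))"
proof -
  have "f \<otimes>\<^bsub>monoid_alg G\<^esub> g = (\<Sum>u\<in>Poly_Mapping.keys f. \<Sum>v\<in>Poly_Mapping.keys g.
      Poly_Mapping.single (u \<otimes>\<^bsub>G\<^esub> v) (Poly_Mapping.lookup f u * Poly_Mapping.lookup g v))"
    by (simp add: monoid_alg_def)
  also have "\<dots> = (\<Sum>u\<in>Poly_Mapping.keys f. \<Sum>v\<in>T.
      Poly_Mapping.single (u \<otimes>\<^bsub>G\<^esub> v) (Poly_Mapping.lookup f u * Poly_Mapping.lookup g v))"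
    using assms by (intro sum.cong sum.mono_neutral_left) (auto simp: in_keys_iff)
  also have "\<dots> = (\<Sum>u\<in>S. \<Sum>v\<in>T. Poly_Mapping.single (u \<otimes>\<^bsub>G\<^esub> v) (Poly_Mapping.lookup f u * Poly_Mapping.lookup g v))"
    using assms by (intro sum.mono_neutral_left) (auto simp: in_keys_iff)
  finally show ?thesis .
qed

lemma monoid_alg_simps:
  "carrier (monoid_alg G) = {f. Poly_Mapping.keys f \<subseteq> carrier G}"
  "\<one>\<^bsub>monoid_alg G\<^esub> = Poly_Mapping.single \<one>\<^bsub>G\<^esub> 1"
  "\<zero>\<^bsub>monoid_alg G\<^esub> = 0"
  "f \<oplus>\<^bsub>monoid_alg G\<^esub> g = f + g"
  "c \<odot>\<^bsub>monoid_alg G\<^esub> f = Poly_Mapping.map ((*) c) f"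
  by (simp_all add: monoid_alg_def)

lemma monoid_alg_mult_single [simp]:
  "Poly_Mapping.single u a \<otimes>\<^bsub>monoid_alg G\<^esub> Poly_Mapping.single v b = Poly_Mapping.single (u \<otimes>\<^bsub>G\<^esub> v) (a * b)"
  by (subst monoid_alg_mult[of "{u}" "{v}"]) auto

lemma monoid_alg_mult_add_left:
  "(f + g) \<otimes>\<^bsub>monoid_alg G\<^esub> h = f \<otimes>\<^bsub>monoid_alg G\<^esub> h + g \<otimes>\<^bsub>monoid_alg G\<^esub> h"
  using keys_add[of f g]
  by (subst (1 2 3) monoid_alg_mult[of "Poly_Mapping.keys f \<union> Poly_Mapping.keys g" "Poly_Mapping.keys h"])
    (auto simp: lookup_add distrib_right single_add sum.distrib)

lemma monoid_alg_mult_add_right: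
  "h \<otimes>\<^bsub>monoid_alg G\<^esub> (f + g) = h \<otimes>\<^bsub>monoid_alg G\<^esub> f + h \<otimes>\<^bsub>monoid_alg G\<^esub> g"
  using keys_add[of f g]
  by (subst (1 2 3) monoid_alg_mult[of "Poly_Mapping.keys h" "Poly_Mapping.keys f \<union> Poly_Mapping.keys g"])
    (auto simp: lookup_add distrib_left single_add sum.distrib)

lemma monoid_alg_mult_zero:
  "0 \<otimes>\<^bsub>monoid_alg G\<^esub> h = 0" "h \<otimes>\<^bsub>monoid_alg G\<^esub> 0 = 0"
  by (simp_all add: monoid_alg_def)

lemma monoid_alg_mult_closed:
  assumes "Poly_Mapping.keys f \<subseteq> carrier G" "Poly_Mapping.keys g \<subseteq> carrier G"
  shows "Poly_Mapping.keys (f \<otimes>\<^bsub>monoid_alg G\<^esub> g) \<subseteq> carrier G"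
  using assms(1)
proof (induction f rule: poly_mapping_single_induct)
  case (single u c)
  show ?case using assms(2)
  proof (induction g rule: poly_mapping_single_induct)
    case (single v d)
    then show ?case using \<open>u \<in> carrier G\<close> by auto
  next
    case (add g h)
    then show ?case
      using keys_add[of "Poly_Mapping.single u c \<otimes>\<^bsub>monoid_alg G\<^esub> g" "Poly_Mapping.single u c \<otimes>\<^bsub>monoid_alg G\<^esub> h"]
      by (auto simp: monoid_alg_mult_add_right)
  qed (simp add: monoid_alg_mult_zero)
next
  case (add f h)
  then show ?case
    using keys_add[of "f \<otimes>\<^bsub>monoid_alg G\<^esub> g" "h \<otimes>\<^bsub>monoid_alg G\<^esub> g"]
    by (auto simp: monoid_alg_mult_add_left)
qed (simp add: monoid_alg_mult_zero)

lemma monoid_alg_mult_assoc: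
  assumes f: "Poly_Mapping.keys f \<subseteq> carrier G" and g: "Poly_Mapping.keys g \<subseteq> carrier G"
    and h: "Poly_Mapping.keys h \<subseteq> carrier G"
  shows "(f \<otimes>\<^bsub>monoid_alg G\<^esub> g) \<otimes>\<^bsub>monoid_alg G\<^esub> h = f \<otimes>\<^bsub>monoid_alg G\<^esub> (g \<otimes>\<^bsub>monoid_alg G\<^esub> h)"
  using f
proof (induction f rule: poly_mapping_single_induct)
  case (single u a)
  show ?case using g
  proof (induction g rule: poly_mapping_single_induct)
    case (single v b)
    show ?case using h
    proof (induction h rule: poly_mapping_single_induct)
      case (single w c)
      then show ?case using \<open>u \<in> carrier G\<close> \<open>v \<in> carrier G\<close> by (simp add: m_assoc mult.assoc)
    qed (simp_all add: monoid_alg_mult_zero monoid_alg_mult_add_right del: monoid_alg_mult_single)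
  qed (simp_all add: monoid_alg_mult_zero monoid_alg_mult_add_right monoid_alg_mult_add_left)
qed (simp_all add: monoid_alg_mult_zero monoid_alg_mult_add_left)

text \<open>A scalar acts as the corresponding multiple of the unit, from either side. The
  compatibility of scalars with products thereby becomes associativity.\<close>

lemma smult_eq_mult:
  assumes "Poly_Mapping.keys f \<subseteq> carrier G"
  shows "Poly_Mapping.map ((*) c) f = Poly_Mapping.single \<one>\<^bsub>G\<^esub> c \<otimes>\<^bsub>monoid_alg G\<^esub> f"
    "Poly_Mapping.map ((*) c) f = f \<otimes>\<^bsub>monoid_alg G\<^esub> Poly_Mapping.single \<one>\<^bsub>G\<^esub> c"
proof -
  have add: "Poly_Mapping.map ((*) c) (f + g) = Poly_Mapping.map ((*) c) f + Poly_Mapping.map ((*) c) g"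
    for f g :: "'a \<Rightarrow>\<^sub>0 complex"
    by (rule poly_mapping_eqI) (simp add: lookup_add distrib_left)
  have zero: "Poly_Mapping.map ((*) c) (0 :: 'a \<Rightarrow>\<^sub>0 complex) = 0"
    by (rule poly_mapping_eqI) simp
  have single: "Poly_Mapping.map ((*) c) (Poly_Mapping.single u d) = Poly_Mapping.single u (c * d)"
    "Poly_Mapping.map ((*) c) (Poly_Mapping.single u d) = Poly_Mapping.single u (d * c)"
    for u :: 'a and d :: complex
    by (rule poly_mapping_eqI; simp add: lookup_single when_def)+
  show "Poly_Mapping.map ((*) c) f = Poly_Mapping.single \<one>\<^bsub>G\<^esub> c \<otimes>\<^bsub>monoid_alg G\<^esub> f"
    using assms by (induction f rule: poly_mapping_single_induct)
      (simp_all add: zero add single(1) monoid_alg_mult_zero monoid_alg_mult_add_right)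
  show "Poly_Mapping.map ((*) c) f = f \<otimes>\<^bsub>monoid_alg G\<^esub> Poly_Mapping.single \<one>\<^bsub>G\<^esub> c"
    using assms by (induction f rule: poly_mapping_single_induct)
      (simp_all add: zero add single(2) monoid_alg_mult_zero monoid_alg_mult_add_left del: map_single)
qed

lemma calg_monoid_alg: "calg (monoid_alg G)"
proof -
  have map_1: "Poly_Mapping.map ((*) 1) f = f" for f :: "'a \<Rightarrow>\<^sub>0 complex"
    by (rule poly_mapping_eqI) simp
  have "ring (monoid_alg G)"
  proof (rule ringI)
    show "abelian_group (monoid_alg G)"
    proof (rule abelian_groupI)
      fix f assume "f \<in> carrier (monoid_alg G)"
      then show "\<exists>g\<in>carrier (monoid_alg G). g \<oplus>\<^bsub>monoid_alg G\<^esub> f = \<zero>\<^bsub>monoid_alg G\<^esub>"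
        by (intro bexI[of _ "- f"]) (auto simp: monoid_alg_simps in_keys_iff)
    next
      fix f g assume "f \<in> carrier (monoid_alg G)" "g \<in> carrier (monoid_alg G)"
      then show "f \<oplus>\<^bsub>monoid_alg G\<^esub> g \<in> carrier (monoid_alg G)"
        using keys_add[of f g] by (auto simp: monoid_alg_simps)
    qed (simp_all add: monoid_alg_simps ac_simps)
    show "Group.monoid (monoid_alg G)"
      \<comment> \<open>For the scalar 1 the two equations are the two unit laws.\<close>
      using smult_eq_mult[of _ 1] map_1
      by (intro Group.monoidI) (auto simp: monoid_alg_simps monoid_alg_mult_closed monoid_alg_mult_assoc)
  qed (simp_all add: monoid_alg_simps monoid_alg_mult_add_left monoid_alg_mult_add_right)
  then show ?thesis
  proof (rule calg.intro)
    show "calg_axioms (monoid_alg G)"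
    proof
      fix f g :: "'a \<Rightarrow>\<^sub>0 complex" and c d
      assume f: "f \<in> carrier (monoid_alg G)"
      note K = this[unfolded monoid_alg_simps mem_Collect_eq]
      show "c \<odot>\<^bsub>monoid_alg G\<^esub> f \<in> carrier (monoid_alg G)"
        using K keys_map_times_subset[of c f] by (auto simp: monoid_alg_simps)
      show "(c + d) \<odot>\<^bsub>monoid_alg G\<^esub> f = c \<odot>\<^bsub>monoid_alg G\<^esub> f \<oplus>\<^bsub>monoid_alg G\<^esub> d \<odot>\<^bsub>monoid_alg G\<^esub> f"
        by (rule poly_mapping_eqI) (simp add: monoid_alg_simps lookup_add distrib_right)
      show "c \<odot>\<^bsub>monoid_alg G\<^esub> (d \<odot>\<^bsub>monoid_alg G\<^esub> f) = (c * d) \<odot>\<^bsub>monoid_alg G\<^esub> f"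
        by (rule poly_mapping_eqI) (simp add: monoid_alg_simps)
      show "1 \<odot>\<^bsub>monoid_alg G\<^esub> f = f"
        by (simp add: monoid_alg_simps map_1)
      assume g: "g \<in> carrier (monoid_alg G)"
      note K' = this[unfolded monoid_alg_simps mem_Collect_eq]
      show "c \<odot>\<^bsub>monoid_alg G\<^esub> (f \<oplus>\<^bsub>monoid_alg G\<^esub> g) = c \<odot>\<^bsub>monoid_alg G\<^esub> f \<oplus>\<^bsub>monoid_alg G\<^esub> c \<odot>\<^bsub>monoid_alg G\<^esub> g"
        by (rule poly_mapping_eqI) (simp add: monoid_alg_simps lookup_add distrib_left)
      note KK = monoid_alg_mult_closed[OF K K']
      have c: "Poly_Mapping.keys (Poly_Mapping.single \<one>\<^bsub>G\<^esub> c) \<subseteq> carrier G" by simp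
      show "c \<odot>\<^bsub>monoid_alg G\<^esub> f \<otimes>\<^bsub>monoid_alg G\<^esub> g = c \<odot>\<^bsub>monoid_alg G\<^esub> (f \<otimes>\<^bsub>monoid_alg G\<^esub> g)"
        unfolding monoid_alg_simps smult_eq_mult(1)[OF K] smult_eq_mult(1)[OF KK]
        by (rule monoid_alg_mult_assoc[OF c K K'])
      show "f \<otimes>\<^bsub>monoid_alg G\<^esub> (c \<odot>\<^bsub>monoid_alg G\<^esub> g) = c \<odot>\<^bsub>monoid_alg G\<^esub> (f \<otimes>\<^bsub>monoid_alg G\<^esub> g)"
        unfolding monoid_alg_simps smult_eq_mult(2)[OF K'] smult_eq_mult(2)[OF KK]
        by (rule monoid_alg_mult_assoc[OF K K' c, symmetric])
    qed
  qed
qed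

end

section \<open>Quotients and induced maps\<close>

text \<open>Equational laws survive a surjection that respects the operations, and a negative in
  \<open>W\<close> is the image of a negative in \<open>V\<close>. A quotient record is thus checked
  on representatives only.\<close>

lemma calg_image:
  assumes V: "calg V" and carr: "carrier W = p ` carrier V"
    and add: "\<And>x y. x \<in> carrier V \<Longrightarrow> y \<in> carrier V \<Longrightarrow> p x \<oplus>\<^bsub>W\<^esub> p y = p (x \<oplus>\<^bsub>V\<^esub> y)"
    and mult: "\<And>x y. x \<in> carrier V \<Longrightarrow> y \<in> carrier V \<Longrightarrow> p x \<otimes>\<^bsub>W\<^esub> p y = p (x \<otimes>\<^bsub>V\<^esub> y)"
    and smult: "\<And>x c. x \<in> carrier V \<Longrightarrow> c \<odot>\<^bsub>W\<^esub> p x = p (c \<odot>\<^bsub>V\<^esub> x)"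
    and one: "\<one>\<^bsub>W\<^esub> = p \<one>\<^bsub>V\<^esub>" and zero: "\<zero>\<^bsub>W\<^esub> = p \<zero>\<^bsub>V\<^esub>"
  shows "calg W"
proof -
  interpret V: calg V by (rule V)
  have "abelian_group W"
  proof (rule abelian_groupI)
    fix x assume "x \<in> carrier W"
    then obtain a where "a \<in> carrier V" "x = p a" using carr by auto
    then show "\<exists>y\<in>carrier W. y \<oplus>\<^bsub>W\<^esub> x = \<zero>\<^bsub>W\<^esub>"
      by (intro bexI[of _ "p (\<ominus>\<^bsub>V\<^esub> a)"]) (auto simp: add zero carr V.l_neg)
  qed (auto simp: carr add zero V.a_ac)
  then have "ring W"
  proof (rule ringI)
    show "Group.monoid W"
      by (rule Group.monoidI) (auto simp: carr mult one V.m_assoc)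
  qed (auto simp: carr mult add V.l_distr V.r_distr)
  then show ?thesis
    by (rule calg.intro, unfold_locales)
      (auto simp: carr add mult smult V.smult_add_left V.smult_add_right V.smult_smult
        V.smult_mult_left V.smult_mult_right)
qed

locale calg_ideal = calg A + ideal I A for A (structure) and I
begin

text \<open>A ring ideal is automatically a subspace, because a scalar acts as multiplication by the
  element \<open>c \<odot> \<one>\<close>.\<close>

lemma smult_in_ideal: "x \<in> I \<Longrightarrow> c \<odot> x \<in> I"
  using smult_mult_left[of \<one> x c] I_l_closed[of x "c \<odot> \<one>"] Icarr by simp

lemma coset_eq_iff: "x \<in> carrier A \<Longrightarrow> y \<in> carrier A \<Longrightarrow> I +> x = I +> y \<longleftrightarrow> x \<ominus> y \<in> I"
  using quotient_eq_iff_same_a_r_cos[OF ideal_axioms] by auto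

text \<open>The scalar multiple of a coset is defined as a union over its members. All sets in that
  union coincide, since the ideal is a subspace.\<close>

lemma alg_quot_smult:
  assumes "x \<in> carrier A"
  shows "c \<odot>\<^bsub>alg_quot A I\<^esub> (I +> x) = I +> (c \<odot> x)"
proof -
  have "I +> (c \<odot> a) = I +> (c \<odot> x)" if "a \<in> I +> x" for a
  proof -
    have a: "a \<in> carrier A" "I +> a = I +> x"
      using a_elemrcos_carrier[OF assms that] a_repr_independence[OF that assms a_subgroup] by blast+
    then have "a \<ominus> x \<in> I" using assms coset_eq_iff by blast
    moreover have "c \<odot> (a \<ominus> x) = c \<odot> a \<ominus> c \<odot> x"
      using a assms by (simp add: a_minus_def smult_add_right smult_minus_one smult_smult)
    ultimately show ?thesis
      using a assms smult_in_ideal[of "a \<ominus> x" c] by (subst coset_eq_iff) auto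
  qed
  moreover have "x \<in> I +> x" using assms a_rcos_self by blast
  ultimately have "(\<Union>a\<in>I +> x. I +> (c \<odot> a)) = I +> (c \<odot> x)" by blast
  then show ?thesis by (simp add: alg_quot_def)
qed

lemma alg_quot_simps:
  "carrier (alg_quot A I) = (+>) I ` carrier A"
  "\<one>\<^bsub>alg_quot A I\<^esub> = I +> \<one>"
  "\<zero>\<^bsub>alg_quot A I\<^esub> = I +> \<zero>"
  "x \<in> carrier A \<Longrightarrow> y \<in> carrier A \<Longrightarrow> (I +> x) \<oplus>\<^bsub>alg_quot A I\<^esub> (I +> y) = I +> (x \<oplus> y)"
  "x \<in> carrier A \<Longrightarrow> y \<in> carrier A \<Longrightarrow> (I +> x) \<otimes>\<^bsub>alg_quot A I\<^esub> (I +> y) = I +> (x \<otimes> y)"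
  using a_rcos_const[of \<zero>]
  by (auto simp: alg_quot_def FactRing_simps rcoset_mult_add a_rcos_sum)

lemma calg_alg_quot: "calg (alg_quot A I)"
  by (rule calg_image[OF calg_axioms alg_quot_simps(1)])
    (simp_all only: alg_quot_simps alg_quot_smult)

lemma alg_map_coset: "alg_map A (alg_quot A I) ((+>) I)"
  by (intro alg_mapI lin_mapI) (simp_all only: alg_quot_simps alg_quot_smult imageI)

text \<open>A linear map that vanishes on the ideal is constant on each coset; the singleton image
  is what \<open>the_elem\<close> in \<open>induced_lin\<close> needs.\<close>

lemma image_coset:
  assumes V: "calg V" and T: "lin_map A V T" and "\<And>x. x \<in> I \<Longrightarrow> T x = \<zero>\<^bsub>V\<^esub>" and f: "f \<in> carrier A"
  shows "T ` (I +> f) = {T f}"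
proof -
  interpret V: calg V by (rule V)
  have "T y = T f" if "y \<in> I +> f" for y
  proof -
    from that obtain i where i: "i \<in> I" "y = i \<oplus> f"
      by (auto simp: a_r_coset_def r_coset_def)
    with Icarr have "i \<in> carrier A" by blast
    then show ?thesis
      using f i assms(3)[OF i(1)] lin_mapD(1)[OF T f] by (simp add: lin_mapD(2)[OF T])
  qed
  then show ?thesis using a_rcos_self[OF f] by blast
qed

end

text \<open>\<open>T\<close> is only linear, so its kernel need not be an ideal and the test on
  generators must include their two-sided multiples.\<close>

lemma lin_map_vanishes_on_ideal:
  assumes A: "calg A" and V: "calg V" and T: "lin_map A V T" and S: "S \<subseteq> carrier A"
    and zero: "\<And>g r h. r \<in> S \<Longrightarrow> g \<in> carrier A \<Longrightarrow> h \<in> carrier A \<Longrightarrow>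
      T (g \<otimes>\<^bsub>A\<^esub> r \<otimes>\<^bsub>A\<^esub> h) = \<zero>\<^bsub>V\<^esub>"
    and x: "x \<in> Idl\<^bsub>A\<^esub> S"
  shows "T x = \<zero>\<^bsub>V\<^esub>"
proof -
  interpret A: calg A by (rule A)
  interpret V: calg V by (rule V)
  \<comment> \<open>The largest two-sided ideal inside the kernel of \<open>T\<close>: it contains
    the generators, hence the ideal generated by them.\<close>
  define K where "K = {f \<in> carrier A. \<forall>g\<in>carrier A. \<forall>h\<in>carrier A. T (g \<otimes>\<^bsub>A\<^esub> f \<otimes>\<^bsub>A\<^esub> h) = \<zero>\<^bsub>V\<^esub>}"
  have "ideal K A"
  proof (rule idealI[OF A.ring_axioms])
    show "subgroup K (add_monoid A)"
    proof (rule A.add.subgroupI)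
      show "K \<subseteq> carrier A" by (auto simp: K_def)
      show "K \<noteq> {}"
        using lin_map_zero[OF A V T] by (auto simp: K_def intro!: exI[of _ "\<zero>\<^bsub>A\<^esub>"])
      fix a b assume ab: "a \<in> K" "b \<in> K"
      show "\<ominus>\<^bsub>A\<^esub> a \<in> K"
        using ab lin_mapD(3)[OF T]
        by (auto simp: K_def A.smult_minus_one A.smult_mult_left A.smult_mult_right)
      show "a \<oplus>\<^bsub>A\<^esub> b \<in> K"
        using ab lin_mapD(2)[OF T] by (auto simp: K_def A.l_distr A.r_distr)
    qed
    fix a x assume ax: "a \<in> K" "x \<in> carrier A"
    then have a: "a \<in> carrier A" by (auto simp: K_def)
    show "x \<otimes>\<^bsub>A\<^esub> a \<in> K" "a \<otimes>\<^bsub>A\<^esub> x \<in> K"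
      unfolding K_def
    proof safe
      fix g h assume gh: "g \<in> carrier A" "h \<in> carrier A"
      have "T ((g \<otimes>\<^bsub>A\<^esub> x) \<otimes>\<^bsub>A\<^esub> a \<otimes>\<^bsub>A\<^esub> h) = \<zero>\<^bsub>V\<^esub>" "T (g \<otimes>\<^bsub>A\<^esub> a \<otimes>\<^bsub>A\<^esub> (x \<otimes>\<^bsub>A\<^esub> h)) = \<zero>\<^bsub>V\<^esub>"
        using ax gh unfolding K_def by blast+
      then show "T (g \<otimes>\<^bsub>A\<^esub> (x \<otimes>\<^bsub>A\<^esub> a) \<otimes>\<^bsub>A\<^esub> h) = \<zero>\<^bsub>V\<^esub>" "T (g \<otimes>\<^bsub>A\<^esub> (a \<otimes>\<^bsub>A\<^esub> x) \<otimes>\<^bsub>A\<^esub> h) = \<zero>\<^bsub>V\<^esub>"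
        using a ax gh by (simp_all add: A.m_assoc)
    qed (use a ax in auto)
  qed
  moreover have "S \<subseteq> K" using S zero by (auto simp: K_def)
  ultimately have "x \<in> K" using x A.genideal_minimal by blast
  then have "T (\<one>\<^bsub>A\<^esub> \<otimes>\<^bsub>A\<^esub> x \<otimes>\<^bsub>A\<^esub> \<one>\<^bsub>A\<^esub>) = \<zero>\<^bsub>V\<^esub>" "x \<in> carrier A" unfolding K_def by blast+
  then show ?thesis by simp
qed

text \<open>A homomorphism that kills an element kills its two-sided multiples too, so the
  generators alone have to be tested.\<close>

lemma alg_map_vanishes_on_ideal:
  assumes A: "calg A" and V: "calg V" and T: "alg_map A V T" and S: "S \<subseteq> carrier A"
    and zero: "\<And>r. r \<in> S \<Longrightarrow> T r = \<zero>\<^bsub>V\<^esub>" and x: "x \<in> Idl\<^bsub>A\<^esub> S"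
  shows "T x = \<zero>\<^bsub>V\<^esub>"
proof (rule lin_map_vanishes_on_ideal[OF A V alg_mapD(1)[OF T] S _ x])
  interpret A: calg A by (rule A)
  interpret V: calg V by (rule V)
  fix g r h assume "r \<in> S" and gh: "g \<in> carrier A" "h \<in> carrier A"
  moreover from this have "r \<in> carrier A" using S by blast
  ultimately show "T (g \<otimes>\<^bsub>A\<^esub> r \<otimes>\<^bsub>A\<^esub> h) = \<zero>\<^bsub>V\<^esub>"
    using lin_mapD(1)[OF alg_mapD(1)[OF T]] by (simp add: alg_mapD(3)[OF T] zero)
qed

context basis_monoid
begin

lemma single_in_monoid_alg [simp, intro]: "u \<in> carrier G \<Longrightarrow> Poly_Mapping.single u c \<in> carrier (monoid_alg G)"
  by (simp add: monoid_alg_simps)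

lemma smult_single [simp]:
  "c \<odot>\<^bsub>monoid_alg G\<^esub> Poly_Mapping.single u d = Poly_Mapping.single u (c * d)"
  by (rule poly_mapping_eqI) (simp add: monoid_alg_simps lookup_single when_def)

lemma monoid_alg_minus:
  assumes "f \<in> carrier (monoid_alg G)" "g \<in> carrier (monoid_alg G)"
  shows "f - g = f \<ominus>\<^bsub>monoid_alg G\<^esub> g"
proof -
  interpret M: calg "monoid_alg G" by (rule calg_monoid_alg)
  have "\<ominus>\<^bsub>monoid_alg G\<^esub> g = - g"
    using assms by (intro M.minus_equality) (auto simp: monoid_alg_simps in_keys_iff)
  then show ?thesis by (simp add: a_minus_def monoid_alg_simps)
qed

lemma monoid_alg_induct [consumes 1, case_names single add]:
  assumes "f \<in> carrier (monoid_alg G)"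
    and "\<And>u c. u \<in> carrier G \<Longrightarrow> P (Poly_Mapping.single u c)"
    and "\<And>f g. f \<in> carrier (monoid_alg G) \<Longrightarrow> g \<in> carrier (monoid_alg G) \<Longrightarrow> P f \<Longrightarrow> P g \<Longrightarrow>
      P (f \<oplus>\<^bsub>monoid_alg G\<^esub> g)"
  shows "P f"
proof -
  \<comment> \<open>The carrier contains the unit, so zero is a monomial with coefficient zero and
    needs no case of its own.\<close>
  have "P (Poly_Mapping.single \<one> 0)" by (rule assms(2)) simp
  then have "P 0" by simp
  from assms(1) have "Poly_Mapping.keys f \<subseteq> carrier G" by (simp add: monoid_alg_simps)
  then show ?thesis
    by (induction f rule: poly_mapping_single_induct) (use assms \<open>P 0\<close> in \<open>auto simp: monoid_alg_simps\<close>)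
qed

context
  fixes V :: "(complex, 'b) module" and F :: "'a \<Rightarrow> 'b"
  assumes V: "calg V" and F: "F \<in> carrier G \<rightarrow> carrier V"
begin

text \<open>As for products, one common finite index set makes additivity a termwise matter.\<close>

lemma lin_ext_superset:
  assumes "finite S" "Poly_Mapping.keys f \<subseteq> S" "S \<subseteq> carrier G"
  shows "lin_ext V F f = (\<Oplus>\<^bsub>V\<^esub>u\<in>S. Poly_Mapping.lookup f u \<odot>\<^bsub>V\<^esub> F u)"
proof -
  interpret V: calg V by (rule V)
  show ?thesis unfolding lin_ext_def
    using assms F by (intro V.finsum_neutral_subset[symmetric]) (auto simp: in_keys_iff subset_iff Pi_iff)
qed

lemma lin_ext_single [simp]: "u \<in> carrier G \<Longrightarrow> lin_ext V F (Poly_Mapping.single u c) = c \<odot>\<^bsub>V\<^esub> F u"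
proof -
  assume u: "u \<in> carrier G"
  interpret V: calg V by (rule V)
  show ?thesis using u F by (subst lin_ext_superset[of "{u}"]) (auto simp: Pi_iff V.finsum_insert)
qed

lemma lin_map_lin_ext: "lin_map (monoid_alg G) V (lin_ext V F)"
proof -
  interpret V: calg V by (rule V)
  show ?thesis
  proof (rule lin_mapI)
    fix f g :: "'a \<Rightarrow>\<^sub>0 complex" and c
    assume f: "f \<in> carrier (monoid_alg G)"
    then have K: "Poly_Mapping.keys f \<subseteq> carrier G" by (simp add: monoid_alg_simps)
    then show "lin_ext V F f \<in> carrier V"
      using F by (subst lin_ext_superset[of "Poly_Mapping.keys f"]) (auto intro!: V.finsum_closed)
    show "lin_ext V F (c \<odot>\<^bsub>monoid_alg G\<^esub> f) = c \<odot>\<^bsub>V\<^esub> lin_ext V F f"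
      using K F keys_map_times_subset[of c f]
      apply (subst (1 2) lin_ext_superset[of "Poly_Mapping.keys f"])
      apply (auto simp: monoid_alg_simps)[4]
      apply (subst V.finsum_smult)
      apply (auto simp: V.smult_smult Pi_iff subset_iff monoid_alg_simps intro!: V.finsum_cong')
      done
    assume "g \<in> carrier (monoid_alg G)"
    then have "Poly_Mapping.keys g \<subseteq> carrier G" by (simp add: monoid_alg_simps)
    with K have S: "finite (Poly_Mapping.keys f \<union> Poly_Mapping.keys g)"
       "Poly_Mapping.keys f \<union> Poly_Mapping.keys g \<subseteq> carrier G" by auto
    show "lin_ext V F (f \<oplus>\<^bsub>monoid_alg G\<^esub> g) = lin_ext V F f \<oplus>\<^bsub>V\<^esub> lin_ext V F g"
      using S F keys_add[of f g]
      apply (subst (1 2 3) lin_ext_superset[OF S(1) _ S(2)])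
      apply (auto simp: monoid_alg_simps)[3]
      apply (subst V.finsum_addf[symmetric])
      apply (auto simp: V.smult_add_left lookup_add Pi_iff subset_iff monoid_alg_simps intro!: V.finsum_cong')
      done
  qed
qed

lemma alg_map_lin_ext:
  assumes one: "F \<one> = \<one>\<^bsub>V\<^esub>"
    and mult: "\<And>u v. u \<in> carrier G \<Longrightarrow> v \<in> carrier G \<Longrightarrow> F (u \<otimes> v) = F u \<otimes>\<^bsub>V\<^esub> F v"
  shows "alg_map (monoid_alg G) V (lin_ext V F)"
proof -
  interpret V: calg V by (rule V)
  interpret M: calg "monoid_alg G" by (rule calg_monoid_alg)
  note L = lin_mapD[OF lin_map_lin_ext]
  have Fc: "F u \<in> carrier V" if "u \<in> carrier G" for u using that F by blast
  show ?thesis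
  proof (rule alg_mapI[OF lin_map_lin_ext])
    show "lin_ext V F \<one>\<^bsub>monoid_alg G\<^esub> = \<one>\<^bsub>V\<^esub>" by (simp add: monoid_alg_simps one)
    fix f g assume f: "f \<in> carrier (monoid_alg G)" and g: "g \<in> carrier (monoid_alg G)"
    show "lin_ext V F (f \<otimes>\<^bsub>monoid_alg G\<^esub> g) = lin_ext V F f \<otimes>\<^bsub>V\<^esub> lin_ext V F g"
      using f
    proof (induction f rule: monoid_alg_induct)
      case (single u c)
      show ?case using g
      proof (induction g rule: monoid_alg_induct)
        case (single v d)
        with \<open>u \<in> carrier G\<close> show ?case
          by (simp add: mult Fc V.smult_mult_left V.smult_mult_right V.smult_smult mult.commute[of d c])
      next
        case (add f g)
        with \<open>u \<in> carrier G\<close> show ?case by (simp add: L M.r_distr V.r_distr Fc del: lin_ext_single)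
      qed
    next
      case (add f h)
      with g show ?case by (simp add: L M.l_distr V.l_distr)
    qed
  qed
qed

context
  fixes I
  assumes I: "ideal I (monoid_alg G)" and zero: "\<And>f. f \<in> I \<Longrightarrow> lin_ext V F f = \<zero>\<^bsub>V\<^esub>"
begin

lemma induced_lin_coset:
  "f \<in> carrier (monoid_alg G) \<Longrightarrow> induced_lin V F (I +>\<^bsub>monoid_alg G\<^esub> f) = lin_ext V F f"
proof -
  interpret I: calg_ideal "monoid_alg G" I
    using calg_monoid_alg I by (rule calg_ideal.intro)
  assume "f \<in> carrier (monoid_alg G)"
  then show ?thesis by (simp add: induced_lin_def I.image_coset[OF V lin_map_lin_ext zero])
qed

lemma lin_map_induced_lin: "lin_map (alg_quot (monoid_alg G) I) V (induced_lin V F)"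
proof -
  interpret I: calg_ideal "monoid_alg G" I
    using calg_monoid_alg I by (rule calg_ideal.intro)
  show ?thesis
    by (rule lin_mapI) (auto simp: I.alg_quot_simps I.alg_quot_smult induced_lin_coset lin_mapD[OF lin_map_lin_ext])
qed

end

end

end

section \<open>Generators and relations\<close>

lemma basis_monoid_free_monoid: "basis_monoid (free_monoid S)"
  by (intro basis_monoid.intro Group.monoidI) (auto simp: free_monoid_def)

lemma calg_free_alg: "calg (free_alg S)"
  by (rule basis_monoid.calg_monoid_alg[OF basis_monoid_free_monoid])

lemma var_closed: "g \<in> S \<Longrightarrow> var g \<in> carrier (free_alg S)"
  by (auto simp: var_def monoid_alg_def free_monoid_def)

lemma free_alg_minus:
  "f \<in> carrier (free_alg S) \<Longrightarrow> g \<in> carrier (free_alg S) \<Longrightarrow> f - g = f \<ominus>\<^bsub>free_alg S\<^esub> g"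
  by (rule basis_monoid.monoid_alg_minus[OF basis_monoid_free_monoid])

lemma (in calg) list_prod_map_closed:
  "\<phi> \<in> S \<rightarrow> carrier V \<Longrightarrow> set w \<subseteq> S \<Longrightarrow> list_prod V (map \<phi> w) \<in> carrier V"
  by (rule list_prod_closed) (auto simp: subset_iff Pi_iff)

text \<open>The homomorphism on the free algebra that \<open>presented_hom B \<phi>\<close> induces
  on cosets once the relations are respected.\<close>

definition free_hom ::
  "(complex, 'b) module \<Rightarrow> ('g \<Rightarrow> 'b) \<Rightarrow> ('g list \<Rightarrow>\<^sub>0 complex) \<Rightarrow> 'b" where
  "free_hom B \<phi> = lin_ext B (\<lambda>w. list_prod B (map \<phi> w))"

context
  fixes B :: "(complex, 'b) module" and \<phi> :: "'g \<Rightarrow> 'b" and S :: "'g set"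
  assumes B: "calg B" and \<phi>: "\<phi> \<in> S \<rightarrow> carrier B"
begin

lemma alg_map_free_hom: "alg_map (free_alg S) B (free_hom B \<phi>)"
proof -
  interpret B: calg B by (rule B)
  have "list_prod B (map \<phi> (u @ v)) = list_prod B (map \<phi> u) \<otimes>\<^bsub>B\<^esub> list_prod B (map \<phi> v)"
    if "u \<in> lists S" "v \<in> lists S" for u v
    using that \<phi> by (simp, intro B.list_prod_append) (auto simp: Pi_iff)
  then show ?thesis unfolding free_hom_def
    using \<phi> by (intro basis_monoid.alg_map_lin_ext[OF basis_monoid_free_monoid B])
      (auto simp: free_monoid_def intro!: B.list_prod_map_closed[OF \<phi>])
qed

lemma free_hom_var: "g \<in> S \<Longrightarrow> free_hom B \<phi> (var g) = \<phi> g"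
proof -
  interpret B: calg B by (rule B)
  assume g: "g \<in> S"
  then have "\<phi> g \<in> carrier B" using \<phi> by blast
  moreover have "(\<lambda>w. list_prod B (map \<phi> w)) \<in> carrier (free_monoid S) \<rightarrow> carrier B"
    by (auto simp: free_monoid_def intro!: B.list_prod_map_closed[OF \<phi>])
  ultimately show ?thesis
    using g basis_monoid.lin_ext_single[OF basis_monoid_free_monoid B, of _ S "[g]" 1]
    by (simp add: free_hom_def var_def B.list_prod_Cons) (simp add: free_monoid_def B.list_prod_Cons)
qed

end

locale presentation =
  fixes gens :: "'g set" and rels :: "(('g list \<Rightarrow>\<^sub>0 complex) \<times> ('g list \<Rightarrow>\<^sub>0 complex)) set"
  assumes rels_carrier: "rels \<subseteq> carrier (free_alg gens) \<times> carrier (free_alg gens)"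
begin

lemma relators_carrier: "(\<lambda>(l, r). l - r) ` rels \<subseteq> carrier (free_alg gens)"
proof -
  interpret F: calg "free_alg gens" by (rule calg_free_alg)
  show ?thesis using rels_carrier by (auto simp: free_alg_minus[where S = gens] subset_iff)
qed

sublocale calg_ideal "free_alg gens" "rel_ideal gens rels"
proof -
  interpret F: calg "free_alg gens" by (rule calg_free_alg)
  show "calg_ideal (free_alg gens) (rel_ideal gens rels)"
    using relators_carrier
    by (intro calg_ideal.intro calg_free_alg) (simp add: rel_ideal_def F.genideal_ideal)
qed

lemma calg_presented: "calg (presented_alg gens rels)"
  unfolding presented_alg_def by (rule calg_alg_quot)

lemma alg_map_presented_coset:
  "alg_map (free_alg gens) (presented_alg gens rels) ((+>\<^bsub>free_alg gens\<^esub>) (rel_ideal gens rels))"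
  unfolding presented_alg_def by (rule alg_map_coset)

lemma presented_gen_closed: "g \<in> gens \<Longrightarrow> presented_gen gens rels g \<in> carrier (presented_alg gens rels)"
  unfolding presented_gen_def
  by (rule lin_mapD(1)[OF alg_mapD(1)[OF alg_map_presented_coset] var_closed])

lemma relation_holds:
  assumes "(l, r) \<in> rels"
  shows "rel_ideal gens rels +>\<^bsub>free_alg gens\<^esub> l = rel_ideal gens rels +>\<^bsub>free_alg gens\<^esub> r"
proof -
  have lr: "l \<in> carrier (free_alg gens)" "r \<in> carrier (free_alg gens)"
    using assms rels_carrier by auto
  have "l - r \<in> rel_ideal gens rels"
    unfolding rel_ideal_def using genideal_self[OF relators_carrier] assms by fast
  then show ?thesis by (simp add: coset_eq_iff lr free_alg_minus[where S = gens])
qed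

context
  fixes B :: "(complex, 'b) module" and \<phi> :: "'g \<Rightarrow> 'b"
  assumes B: "calg B" and \<phi>: "\<phi> \<in> gens \<rightarrow> carrier B"
    and rels: "\<And>l r. (l, r) \<in> rels \<Longrightarrow> free_hom B \<phi> l = free_hom B \<phi> r"
begin

lemma free_hom_vanishes: "f \<in> rel_ideal gens rels \<Longrightarrow> free_hom B \<phi> f = \<zero>\<^bsub>B\<^esub>"
  unfolding rel_ideal_def
proof (rule alg_map_vanishes_on_ideal[OF calg_free_alg B alg_map_free_hom[OF B \<phi>] relators_carrier])
  interpret B: calg B by (rule B)
  fix f assume "f \<in> (\<lambda>(l, r). l - r) ` rels"
  then obtain l r where lr: "(l, r) \<in> rels" "f = l - r" by auto
  then have c: "l \<in> carrier (free_alg gens)" "r \<in> carrier (free_alg gens)"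
    using rels_carrier by auto
  note H = alg_mapD(1)[OF alg_map_free_hom[OF B \<phi>]]
  have "free_hom B \<phi> f = free_hom B \<phi> l \<ominus>\<^bsub>B\<^esub> free_hom B \<phi> r"
    unfolding lr(2) free_alg_minus[OF c] by (rule lin_map_minus[OF calg_free_alg B H c])
  then show "free_hom B \<phi> f = \<zero>\<^bsub>B\<^esub>"
    using rels[OF lr(1)] lin_mapD(1)[OF H c(2)] by (simp add: a_minus_def B.r_neg)
qed

lemma presented_hom_coset:
  assumes "f \<in> carrier (free_alg gens)"
  shows "presented_hom B \<phi> (rel_ideal gens rels +>\<^bsub>free_alg gens\<^esub> f) = free_hom B \<phi> f"
proof -
  interpret B: calg B by (rule B)
  show ?thesis
    unfolding presented_hom_def free_hom_def using \<phi>
    by (intro basis_monoid.induced_lin_coset[OF basis_monoid_free_monoid B _ ideal_axioms _ assms])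
      (auto simp: free_monoid_def free_hom_vanishes[unfolded free_hom_def] intro!: B.list_prod_map_closed[OF \<phi>])
qed

lemma alg_map_presented_hom: "alg_map (presented_alg gens rels) B (presented_hom B \<phi>)"
proof -
  interpret B: calg B by (rule B)
  note H = alg_map_free_hom[OF B \<phi>]
  show ?thesis
  proof (intro alg_mapI lin_mapI)
    show "presented_hom B \<phi> \<one>\<^bsub>presented_alg gens rels\<^esub> = \<one>\<^bsub>B\<^esub>"
      by (simp add: presented_alg_def alg_quot_simps presented_hom_coset alg_mapD(2)[OF H])
  qed (auto simp: presented_alg_def alg_quot_simps alg_quot_smult presented_hom_coset alg_mapD(3)[OF H]
      lin_mapD[OF alg_mapD(1)[OF H]])
qed

lemma presented_hom_gen: "g \<in> gens \<Longrightarrow> presented_hom B \<phi> (presented_gen gens rels g) = \<phi> g"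
  by (simp add: presented_gen_def presented_hom_coset var_closed free_hom_var[OF B \<phi>])

end

end

section \<open>Tensor powers\<close>

lemma in_tuple_monoid [simp]: "u \<in> carrier (tuple_monoid A m) \<longleftrightarrow> length u = m \<and> set u \<subseteq> carrier A"
  by (simp add: tuple_monoid_def)

text \<open>Linearity in one slot is expressed by list update, so that the two conditions mirror the
  two families of \<open>multilinear_relators\<close>.\<close>

definition multilin ::
  "(complex, 'a) module \<Rightarrow> nat \<Rightarrow> (complex, 'b) module \<Rightarrow> ('a list \<Rightarrow> 'b) \<Rightarrow> bool" where
  "multilin A m V F \<longleftrightarrow> F \<in> carrier (tuple_monoid A m) \<rightarrow> carrier V \<and>
    (\<forall>u k a b. u \<in> carrier (tuple_monoid A m) \<longrightarrow> k < m \<longrightarrow> a \<in> carrier A \<longrightarrow> b \<in> carrier A \<longrightarrow>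
      F (u[k := a \<oplus>\<^bsub>A\<^esub> b]) = F (u[k := a]) \<oplus>\<^bsub>V\<^esub> F (u[k := b])) \<and>
    (\<forall>u k c a. u \<in> carrier (tuple_monoid A m) \<longrightarrow> k < m \<longrightarrow> a \<in> carrier A \<longrightarrow>
      F (u[k := c \<odot>\<^bsub>A\<^esub> a]) = c \<odot>\<^bsub>V\<^esub> F (u[k := a]))"

lemma multilinI:
  assumes "\<And>u. length u = m \<Longrightarrow> set u \<subseteq> carrier A \<Longrightarrow> F u \<in> carrier V"
    "\<And>u k a b. length u = m \<Longrightarrow> set u \<subseteq> carrier A \<Longrightarrow> k < m \<Longrightarrow> a \<in> carrier A \<Longrightarrow> b \<in> carrier A \<Longrightarrow>
      F (u[k := a \<oplus>\<^bsub>A\<^esub> b]) = F (u[k := a]) \<oplus>\<^bsub>V\<^esub> F (u[k := b])"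
    "\<And>u k c a. length u = m \<Longrightarrow> set u \<subseteq> carrier A \<Longrightarrow> k < m \<Longrightarrow> a \<in> carrier A \<Longrightarrow>
      F (u[k := c \<odot>\<^bsub>A\<^esub> a]) = c \<odot>\<^bsub>V\<^esub> F (u[k := a])"
  shows "multilin A m V F"
  using assms unfolding multilin_def by auto

lemma multilinD:
  assumes "multilin A m V F" "length u = m" "set u \<subseteq> carrier A"
  shows "F u \<in> carrier V"
    "k < m \<Longrightarrow> a \<in> carrier A \<Longrightarrow> b \<in> carrier A \<Longrightarrow>
      F (u[k := a \<oplus>\<^bsub>A\<^esub> b]) = F (u[k := a]) \<oplus>\<^bsub>V\<^esub> F (u[k := b])"
    "k < m \<Longrightarrow> a \<in> carrier A \<Longrightarrow> F (u[k := c \<odot>\<^bsub>A\<^esub> a]) = c \<odot>\<^bsub>V\<^esub> F (u[k := a])"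
  using assms unfolding multilin_def by auto

lemma map2_list_update:
  assumes "length u = length v" "k < length v"
  shows "map2 f (u[k := a]) v = (map2 f u v)[k := f a (v ! k)]"
    "map2 f u (v[k := b]) = (map2 f u v)[k := f (u ! k) b]"
  using assms by (auto intro!: nth_equalityI simp: nth_list_update)

context calg
begin

lemma set_map2_mult:
  assumes "set u \<subseteq> carrier V" "set v \<subseteq> carrier V"
  shows "set (map2 (\<otimes>) u v) \<subseteq> carrier V"
proof -
  have "u ! i \<otimes> v ! i \<in> carrier V" if "i < length u" "i < length v" for i
    using that assms nth_mem by (blast intro: m_closed)
  then show ?thesis by (auto simp: set_zip)
qed

lemma set_list_update:
  "set u \<subseteq> carrier V \<Longrightarrow> a \<in> carrier V \<Longrightarrow> set (u[k := a]) \<subseteq> carrier V"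
  using set_update_subset_insert[of u k a] by auto

lemma basis_monoid_tuple_monoid: "basis_monoid (tuple_monoid V m)"
proof (intro basis_monoid.intro Group.monoidI)
  fix u v w
  assume "u \<in> carrier (tuple_monoid V m)" "v \<in> carrier (tuple_monoid V m)" "w \<in> carrier (tuple_monoid V m)"
  then show "u \<otimes>\<^bsub>tuple_monoid V m\<^esub> v \<otimes>\<^bsub>tuple_monoid V m\<^esub> w =
      u \<otimes>\<^bsub>tuple_monoid V m\<^esub> (v \<otimes>\<^bsub>tuple_monoid V m\<^esub> w)"
    unfolding in_tuple_monoid
    by (auto simp: tuple_monoid_def m_assoc subset_iff intro!: nth_equalityI)
next
  fix u v
  assume "u \<in> carrier (tuple_monoid V m)" "v \<in> carrier (tuple_monoid V m)"
  then show "u \<otimes>\<^bsub>tuple_monoid V m\<^esub> v \<in> carrier (tuple_monoid V m)"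
    unfolding in_tuple_monoid using set_map2_mult[of u v] by (auto simp: tuple_monoid_def)
next
  fix u
  assume "u \<in> carrier (tuple_monoid V m)"
  then show "\<one>\<^bsub>tuple_monoid V m\<^esub> \<otimes>\<^bsub>tuple_monoid V m\<^esub> u = u"
    "u \<otimes>\<^bsub>tuple_monoid V m\<^esub> \<one>\<^bsub>tuple_monoid V m\<^esub> = u"
    unfolding in_tuple_monoid by (auto simp: tuple_monoid_def subset_iff intro!: nth_equalityI)
qed (auto simp: tuple_monoid_def)

lemma tuple_mult: "u \<otimes>\<^bsub>tuple_monoid V m\<^esub> v = map2 (\<otimes>) u v"
  by (simp add: tuple_monoid_def)

lemma multilinear_relators_carrier: "multilinear_relators V m \<subseteq> carrier (monoid_alg (tuple_monoid V m))"
proof -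
  interpret T: basis_monoid "tuple_monoid V m" by (rule basis_monoid_tuple_monoid)
  interpret TA: calg "monoid_alg (tuple_monoid V m)" by (rule T.calg_monoid_alg)
  have sgl: "Poly_Mapping.single (u[k := a]) c \<in> carrier (monoid_alg (tuple_monoid V m))"
    if "u \<in> carrier (tuple_monoid V m)" "a \<in> carrier V" for u k a c
    using that by (intro T.single_in_monoid_alg) (auto simp: set_list_update)
  show ?thesis
    unfolding multilinear_relators_def
    by (intro Un_least subsetI; elim CollectE exE conjE; hypsubst)
      (intro sgl TA.minus_closed smult_closed a_closed | subst T.monoid_alg_minus | assumption)+
qed

lemma calg_ideal_tensor_ideal: "calg_ideal (monoid_alg (tuple_monoid V m)) (tensor_ideal V m)"
proof -
  interpret TA: calg "monoid_alg (tuple_monoid V m)"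
    by (rule basis_monoid.calg_monoid_alg[OF basis_monoid_tuple_monoid])
  show ?thesis
    unfolding tensor_ideal_def
    by (intro calg_ideal.intro TA.calg_axioms TA.genideal_ideal multilinear_relators_carrier)
qed

lemma calg_tensor_power: "calg (tensor_power V m)"
  unfolding tensor_power_def by (rule calg_ideal.calg_alg_quot[OF calg_ideal_tensor_ideal])

lemma pure_tensor_closed:
  assumes "set u \<subseteq> carrier V" "length u = m"
  shows "pure_tensor V u \<in> carrier (tensor_power V m)"
proof -
  interpret T: basis_monoid "tuple_monoid V m" by (rule basis_monoid_tuple_monoid)
  interpret I: calg_ideal "monoid_alg (tuple_monoid V m)" "tensor_ideal V m" by (rule calg_ideal_tensor_ideal)
  show ?thesis using assms by (auto simp: tensor_power_def I.alg_quot_simps pure_tensor_def)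
qed

lemma pure_tensor_mult:
  assumes "set u \<subseteq> carrier V" "length u = m" "set v \<subseteq> carrier V" "length v = m"
  shows "pure_tensor V u \<otimes>\<^bsub>tensor_power V m\<^esub> pure_tensor V v = pure_tensor V (map2 (\<otimes>) u v)"
proof -
  interpret T: basis_monoid "tuple_monoid V m" by (rule basis_monoid_tuple_monoid)
  interpret I: calg_ideal "monoid_alg (tuple_monoid V m)" "tensor_ideal V m" by (rule calg_ideal_tensor_ideal)
  show ?thesis
    using assms by (simp add: tensor_power_def I.alg_quot_simps pure_tensor_def T.single_in_monoid_alg tuple_mult)
qed

lemma pure_tensor_one: "\<one>\<^bsub>tensor_power V m\<^esub> = pure_tensor V (replicate m \<one>)"
proof -
  interpret T: basis_monoid "tuple_monoid V m" by (rule basis_monoid_tuple_monoid)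
  interpret I: calg_ideal "monoid_alg (tuple_monoid V m)" "tensor_ideal V m" by (rule calg_ideal_tensor_ideal)
  show ?thesis
    by (simp add: tensor_power_def I.alg_quot_simps pure_tensor_def T.monoid_alg_simps) (simp add: tuple_monoid_def)
qed

lemma multilin_pure_tensor: "multilin V m (tensor_power V m) (pure_tensor V)"
proof -
  interpret T: basis_monoid "tuple_monoid V m" by (rule basis_monoid_tuple_monoid)
  interpret I: calg_ideal "monoid_alg (tuple_monoid V m)" "tensor_ideal V m" by (rule calg_ideal_tensor_ideal)
  have sgl: "Poly_Mapping.single (u[k := a]) c \<in> carrier (monoid_alg (tuple_monoid V m))"
    if "length u = m" "set u \<subseteq> carrier V" "a \<in> carrier V" for u k a c
    using that by (intro T.single_in_monoid_alg) (auto simp: set_list_update)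
  note self = subsetD[OF I.genideal_self[OF multilinear_relators_carrier[of m]], folded tensor_ideal_def]
  show ?thesis
  proof (rule multilinI)
    fix u assume "length u = m" "set u \<subseteq> carrier V"
    then show "pure_tensor V u \<in> carrier (tensor_power V m)" by (simp add: pure_tensor_closed)
  next
    fix u k a b
    assume u: "length u = m" "set u \<subseteq> carrier V" and k: "k < m" and ab: "a \<in> carrier V" "b \<in> carrier V"
    let ?s = "\<lambda>x. Poly_Mapping.single (u[k := x]) (1::complex)"
    note s = sgl[OF u, of _ k 1]
    have "?s (a \<oplus> b) - ?s a - ?s b \<in> tensor_ideal V m"
      using u k ab by (intro self) (force simp: multilinear_relators_def)
    moreover have "?s (a \<oplus> b) - ?s a - ?s b = ?s (a \<oplus> b) - (?s a + ?s b)" by simp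
    ultimately have "?s (a \<oplus> b) \<ominus>\<^bsub>monoid_alg (tuple_monoid V m)\<^esub> (?s a \<oplus>\<^bsub>monoid_alg (tuple_monoid V m)\<^esub> ?s b) \<in> tensor_ideal V m"
      using ab s I.add.m_closed[OF s[OF ab(1)] s[OF ab(2)]]
      by (subst T.monoid_alg_minus[symmetric]) (simp_all add: T.monoid_alg_simps(4))
    then have "tensor_ideal V m +>\<^bsub>monoid_alg (tuple_monoid V m)\<^esub> ?s (a \<oplus> b) =
        tensor_ideal V m +>\<^bsub>monoid_alg (tuple_monoid V m)\<^esub> (?s a \<oplus>\<^bsub>monoid_alg (tuple_monoid V m)\<^esub> ?s b)"
      using ab s by (subst I.coset_eq_iff) (auto intro!: I.add.m_closed)
    then show "pure_tensor V (u[k := a \<oplus> b]) =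
        pure_tensor V (u[k := a]) \<oplus>\<^bsub>tensor_power V m\<^esub> pure_tensor V (u[k := b])"
      using u ab s by (simp add: pure_tensor_def tensor_power_def I.alg_quot_simps)
  next
    fix u k c a
    assume u: "length u = m" "set u \<subseteq> carrier V" and k: "k < m" and a: "a \<in> carrier V"
    let ?s = "\<lambda>x c. Poly_Mapping.single (u[k := x]) (c::complex)"
    note s = sgl[OF u, of _ k]
    have "?s (c \<odot> a) 1 - ?s a c \<in> tensor_ideal V m"
      using u k a by (intro self) (force simp: multilinear_relators_def)
    then have "tensor_ideal V m +>\<^bsub>monoid_alg (tuple_monoid V m)\<^esub> ?s (c \<odot> a) 1 =
        tensor_ideal V m +>\<^bsub>monoid_alg (tuple_monoid V m)\<^esub> ?s a c"
      using a s by (subst I.coset_eq_iff) (auto simp: T.monoid_alg_minus[symmetric])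
    moreover have "?s a c = c \<odot>\<^bsub>monoid_alg (tuple_monoid V m)\<^esub> ?s a 1"
      using u a by (subst T.smult_single) (auto simp: set_list_update)
    ultimately show "pure_tensor V (u[k := c \<odot> a]) = c \<odot>\<^bsub>tensor_power V m\<^esub> pure_tensor V (u[k := a])"
      using u a s by (simp add: pure_tensor_def tensor_power_def I.alg_quot_smult del: T.smult_single)
  qed
qed

end

context
  fixes A :: "(complex, 'a) module" and W :: "(complex, 'b) module" and m F
  assumes A: "calg A" and W: "calg W" and F: "multilin A m W F"
begin

text \<open>Multiplying a relator in slot \<open>k\<close> by tuples on both sides multiplies
  entries slot by slot. The result is a combination of tuples that differ only in slot
  \<open>k\<close>, and linearity of \<open>F\<close> in that slot kills it. Behind this is the fact
  that the relators span an ideal.\<close>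

lemma lin_ext_multilinear_relator:
  assumes r: "r \<in> multilinear_relators A m" and v: "v \<in> carrier (tuple_monoid A m)"
    and w: "w \<in> carrier (tuple_monoid A m)"
  shows "lin_ext W F (Poly_Mapping.single v c \<otimes>\<^bsub>monoid_alg (tuple_monoid A m)\<^esub> r
    \<otimes>\<^bsub>monoid_alg (tuple_monoid A m)\<^esub> Poly_Mapping.single w d) = \<zero>\<^bsub>W\<^esub>"
proof -
  interpret A: calg A by (rule A)
  interpret W: calg W by (rule W)
  interpret T: basis_monoid "tuple_monoid A m" by (rule A.basis_monoid_tuple_monoid)
  interpret TA: calg "monoid_alg (tuple_monoid A m)" by (rule T.calg_monoid_alg)
  define T where "T = (\<lambda>r. lin_ext W F (Poly_Mapping.single v c \<otimes>\<^bsub>monoid_alg (tuple_monoid A m)\<^esub> r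
    \<otimes>\<^bsub>monoid_alg (tuple_monoid A m)\<^esub> Poly_Mapping.single w d))"
  have Fc: "F \<in> carrier (tuple_monoid A m) \<rightarrow> carrier W"
    using multilinD(1)[OF F] by auto
  note L = lin_mapD[OF T.lin_map_lin_ext[OF W Fc]]
  have sv: "Poly_Mapping.single v c \<in> carrier (monoid_alg (tuple_monoid A m))"
    and sw: "Poly_Mapping.single w d \<in> carrier (monoid_alg (tuple_monoid A m))"
    using v w by (blast intro: T.single_in_monoid_alg)+
  have T: "lin_map (monoid_alg (tuple_monoid A m)) W T"
    unfolding T_def
    by (rule lin_mapI)
      (simp_all add: L sv sw TA.l_distr TA.r_distr TA.smult_mult_left TA.smult_mult_right del: T.smult_single)
  \<comment> \<open>The slotwise product of \<open>v\<close>, \<open>u[k := x]\<close> and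
    \<open>w\<close>, written as an update in slot \<open>k\<close> of a tuple that does not depend
    on \<open>x\<close>.\<close>
  let ?p = "\<lambda>u k x. (map2 (\<otimes>\<^bsub>A\<^esub>) (map2 (\<otimes>\<^bsub>A\<^esub>) v u) w)[k := v ! k \<otimes>\<^bsub>A\<^esub> x \<otimes>\<^bsub>A\<^esub> w ! k]"
  have Ts: "T (Poly_Mapping.single (u[k := x]) e) = (c * e * d) \<odot>\<^bsub>W\<^esub> F (?p u k x)"
    and cl: "F (?p u k x) \<in> carrier W"
    and len: "length (map2 (\<otimes>\<^bsub>A\<^esub>) (map2 (\<otimes>\<^bsub>A\<^esub>) v u) w) = m"
    and st: "set (map2 (\<otimes>\<^bsub>A\<^esub>) (map2 (\<otimes>\<^bsub>A\<^esub>) v u) w) \<subseteq> carrier A"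
    if u: "length u = m" "set u \<subseteq> carrier A" and k: "k < m" and x: "x \<in> carrier A" for u k x e
  proof -
    show len: "length (map2 (\<otimes>\<^bsub>A\<^esub>) (map2 (\<otimes>\<^bsub>A\<^esub>) v u) w) = m"
      using u v w by simp
    show st: "set (map2 (\<otimes>\<^bsub>A\<^esub>) (map2 (\<otimes>\<^bsub>A\<^esub>) v u) w) \<subseteq> carrier A"
      using u v w by (intro A.set_map2_mult) auto
    have "v ! k \<in> carrier A" "w ! k \<in> carrier A" using v w k by (auto simp: subset_iff)
    then have p: "?p u k x \<in> carrier (tuple_monoid A m)"
      using len A.set_list_update[OF st] x unfolding in_tuple_monoid by simp
    then show "F (?p u k x) \<in> carrier W" using Fc by blast
    note p moreover have "T (Poly_Mapping.single (u[k := x]) e) =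
        lin_ext W F (Poly_Mapping.single (?p u k x) (c * e * d))"
      using u v w k unfolding T_def
      by (simp add: A.tuple_mult map2_list_update)
    ultimately show "T (Poly_Mapping.single (u[k := x]) e) = (c * e * d) \<odot>\<^bsub>W\<^esub> F (?p u k x)"
      by (simp add: T.lin_ext_single[OF W Fc])
  qed
  have sgl: "Poly_Mapping.single (u[k := x]) e \<in> carrier (monoid_alg (tuple_monoid A m))"
    if "length u = m" "set u \<subseteq> carrier A" "x \<in> carrier A" for u k x e
    using that by (intro T.single_in_monoid_alg) (auto simp: A.set_list_update)
  have vwk: "v ! k \<in> carrier A" "w ! k \<in> carrier A" if "k < m" for k
    using v w that by (auto simp: subset_iff)
  from r consider
    (add) u k a b where "length u = m" "set u \<subseteq> carrier A" "k < m" "a \<in> carrier A" "b \<in> carrier A"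
      "r = Poly_Mapping.single (u[k := a \<oplus>\<^bsub>A\<^esub> b]) 1
        - Poly_Mapping.single (u[k := a]) 1 - Poly_Mapping.single (u[k := b]) 1"
  | (smult) u k e a where "length u = m" "set u \<subseteq> carrier A" "k < m" "a \<in> carrier A"
      "r = Poly_Mapping.single (u[k := e \<odot>\<^bsub>A\<^esub> a]) 1 - Poly_Mapping.single (u[k := a]) e"
    unfolding multilinear_relators_def in_tuple_monoid by blast
  then have "T r = \<zero>\<^bsub>W\<^esub>"
  proof cases
    case (add u k a b)
    have cancel: "x \<oplus>\<^bsub>W\<^esub> y \<ominus>\<^bsub>W\<^esub> x \<ominus>\<^bsub>W\<^esub> y = \<zero>\<^bsub>W\<^esub>"
      if "x \<in> carrier W" "y \<in> carrier W" for x y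
    proof -
      have "x \<oplus>\<^bsub>W\<^esub> y \<ominus>\<^bsub>W\<^esub> x \<ominus>\<^bsub>W\<^esub> y = (x \<oplus>\<^bsub>W\<^esub> \<ominus>\<^bsub>W\<^esub> x) \<oplus>\<^bsub>W\<^esub> (y \<oplus>\<^bsub>W\<^esub> \<ominus>\<^bsub>W\<^esub> y)"
        using that by (simp add: a_minus_def W.add.m_ac del: W.r_neg)
      then show ?thesis using that by (simp add: W.r_neg)
    qed
    note s = sgl[OF add(1,2), of _ k 1] and t = Ts[OF add(1-3), of _ 1]
    note P = multilinD[OF F len[OF add(1-4)] st[OF add(1-4)]]
    have c: "F (?p u k a) \<in> carrier W" "F (?p u k b) \<in> carrier W"
      using cl[OF add(1-3)] add by blast+
    have "F (?p u k (a \<oplus>\<^bsub>A\<^esub> b)) = F (?p u k a) \<oplus>\<^bsub>W\<^esub> F (?p u k b)"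
      using P(2)[OF add(3), of "v ! k \<otimes>\<^bsub>A\<^esub> a \<otimes>\<^bsub>A\<^esub> w ! k" "v ! k \<otimes>\<^bsub>A\<^esub> b \<otimes>\<^bsub>A\<^esub> w ! k"] vwk[OF add(3)] add
      by (simp add: A.l_distr A.r_distr)
    then show ?thesis
      using s[OF add(4)] s[OF add(5)] s[OF A.a_closed[OF add(4,5)]] t[OF add(4)] t[OF add(5)]
        t[OF A.a_closed[OF add(4,5)]] c
      unfolding add(6)
      by (simp add: T.monoid_alg_minus lin_map_minus[OF TA.calg_axioms W T] W.smult_add_right)
        (rule cancel; blast intro: W.smult_closed)
  next
    case (smult u k e a)
    note s = sgl[OF smult(1,2), of _ k] and t = Ts[OF smult(1-3)]
    note P = multilinD[OF F len[OF smult(1-4)] st[OF smult(1-4)]]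
    have c: "F (?p u k a) \<in> carrier W"
      using cl[OF smult(1-3)] smult by blast
    have "F (?p u k (e \<odot>\<^bsub>A\<^esub> a)) = e \<odot>\<^bsub>W\<^esub> F (?p u k a)"
      using P(3)[OF smult(3), of "v ! k \<otimes>\<^bsub>A\<^esub> a \<otimes>\<^bsub>A\<^esub> w ! k" e] vwk[OF smult(3)] smult
      by (simp add: A.smult_mult_left A.smult_mult_right)
    then show ?thesis
      using s[OF smult(4)] s[OF A.smult_closed[OF smult(4)]] t[OF smult(4)] t[OF A.smult_closed[OF smult(4)]] c
      unfolding smult(5)
      by (simp add: T.monoid_alg_minus lin_map_minus[OF TA.calg_axioms W T] W.smult_smult)
        (simp add: a_minus_def W.r_neg mult.assoc mult.commute[of e])
  qed
  then show ?thesis unfolding T_def .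
qed

text \<open>\<open>F\<close> is not assumed multiplicative, so the criterion with two-sided
  multiples applies; by linearity the multipliers may be taken to be single tuples.\<close>

lemma lin_ext_vanishes_on_tensor_ideal:
  assumes "f \<in> tensor_ideal A m"
  shows "lin_ext W F f = \<zero>\<^bsub>W\<^esub>"
proof -
  interpret A: calg A by (rule A)
  interpret W: calg W by (rule W)
  interpret T: basis_monoid "tuple_monoid A m" by (rule A.basis_monoid_tuple_monoid)
  interpret TA: calg "monoid_alg (tuple_monoid A m)" by (rule T.calg_monoid_alg)
  have Fc: "F \<in> carrier (tuple_monoid A m) \<rightarrow> carrier W"
    using multilinD(1)[OF F] by auto
  note lm = T.lin_map_lin_ext[OF W Fc]
  note L = lin_mapD[OF lm]
  show ?thesis
  proof (rule lin_map_vanishes_on_ideal[OF TA.calg_axioms W lm A.multilinear_relators_carrier _ assms[unfolded tensor_ideal_def]])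
    fix g r h
    assume r: "r \<in> multilinear_relators A m" and g: "g \<in> carrier (monoid_alg (tuple_monoid A m))"
      and h: "h \<in> carrier (monoid_alg (tuple_monoid A m))"
    have rc: "r \<in> carrier (monoid_alg (tuple_monoid A m))"
      using r A.multilinear_relators_carrier by blast
    show "lin_ext W F (g \<otimes>\<^bsub>monoid_alg (tuple_monoid A m)\<^esub> r \<otimes>\<^bsub>monoid_alg (tuple_monoid A m)\<^esub> h) = \<zero>\<^bsub>W\<^esub>"
      using g
    proof (induction g rule: T.monoid_alg_induct)
      case (single v c)
      note v = this
      show ?case using h
      proof (induction h rule: T.monoid_alg_induct)
        case (single w d)
        show ?case by (rule lin_ext_multilinear_relator[OF r v single])
      next
        case (add f g)
        then show ?case using rc T.single_in_monoid_alg[OF v] by (simp add: TA.r_distr L)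
      qed
    next
      case (add f g)
      then show ?case using rc h by (simp add: TA.l_distr L)
    qed
  qed
qed

text \<open>The existence half of the universal property of the tensor power; the values on pure
  tensors follow below.\<close>

lemma lin_map_tensor_lift: "lin_map (tensor_power A m) W (induced_lin W F)"
proof -
  interpret A: calg A by (rule A)
  interpret T: basis_monoid "tuple_monoid A m" by (rule A.basis_monoid_tuple_monoid)
  interpret I: calg_ideal "monoid_alg (tuple_monoid A m)" "tensor_ideal A m" by (rule A.calg_ideal_tensor_ideal)
  have Fc: "F \<in> carrier (tuple_monoid A m) \<rightarrow> carrier W"
    using multilinD(1)[OF F] by auto
  show ?thesis unfolding tensor_power_def
    by (rule T.lin_map_induced_lin[OF W Fc I.ideal_axioms lin_ext_vanishes_on_tensor_ideal])
qed

lemma tensor_lift_pure: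
  assumes "length u = m" "set u \<subseteq> carrier A"
  shows "induced_lin W F (pure_tensor A u) = F u"
proof -
  interpret A: calg A by (rule A)
  interpret W: calg W by (rule W)
  interpret T: basis_monoid "tuple_monoid A m" by (rule A.basis_monoid_tuple_monoid)
  interpret I: calg_ideal "monoid_alg (tuple_monoid A m)" "tensor_ideal A m" by (rule A.calg_ideal_tensor_ideal)
  have Fc: "F \<in> carrier (tuple_monoid A m) \<rightarrow> carrier W"
    using multilinD(1)[OF F] by auto
  have u: "u \<in> carrier (tuple_monoid A m)" using assms by simp
  show ?thesis
    unfolding pure_tensor_def assms(1)
    using T.induced_lin_coset[OF W Fc I.ideal_axioms lin_ext_vanishes_on_tensor_ideal T.single_in_monoid_alg[OF u], of 1]
      T.lin_ext_single[OF W Fc u, of 1] multilinD(1)[OF F assms] by simp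
qed

end

section \<open>Length of permutations\<close>

text \<open>Defined for arbitrary functions and not only for permutations: the same count later
  drives the sorting of a row choice that has repetitions.\<close>

definition inversions :: "nat \<Rightarrow> (nat \<Rightarrow> nat) \<Rightarrow> (nat \<times> nat) set" where
  "inversions k w = {(i, j). 1 \<le> i \<and> i < j \<and> j \<le> k \<and> w j < w i}"

lemma finite_inversions [simp]: "finite (inversions k w)"
  by (rule finite_subset[of _ "{1..k} \<times> {1..k}"]) (auto simp: inversions_def)

text \<open>Relabelling both positions by the transposition carries the old inversions to new ones
  injectively, and the pair \<open>(i, Suc i)\<close> is the only inversion added.\<close>

lemma card_inversions_ascent:
  assumes "1 \<le> i" "Suc i \<le> k" "w i < w (Suc i)"
  shows "card (inversions k (w \<circ> transpose i (Suc i))) = Suc (card (inversions k w))"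
proof -
  let ?t = "transpose i (Suc i)"
  let ?f = "map_prod ?t ?t"
  have inj: "inj_on ?f (inversions k w)"
    by (rule inj_on_subset[OF prod.inj_map]) (simp_all add: inj_on_transpose)
  have "inversions k (w \<circ> ?t) = insert (i, Suc i) (?f ` inversions k w)"
  proof (intro equalityI subsetI)
    fix p assume "p \<in> inversions k (w \<circ> ?t)"
    then obtain a b where p: "p = (a, b)" "1 \<le> a" "a < b" "b \<le> k" "w (?t b) < w (?t a)"
      by (auto simp: inversions_def)
    show "p \<in> insert (i, Suc i) (?f ` inversions k w)"
    proof (cases "p = (i, Suc i)")
      case False
      then have "(?t a, ?t b) \<in> inversions k w"
        using p assms unfolding inversions_def transpose_def by (auto split: if_splits)
      moreover have "p = ?f (?t a, ?t b)" using p by simp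
      ultimately show ?thesis by blast
    qed simp
  next
    fix p assume p: "p \<in> insert (i, Suc i) (?f ` inversions k w)"
    show "p \<in> inversions k (w \<circ> ?t)"
    proof (cases "p = (i, Suc i)")
      case True
      then show ?thesis using assms by (simp add: inversions_def)
    next
      case False
      with p obtain a b where ab: "(a, b) \<in> inversions k w" "p = (?t a, ?t b)" by auto
      then show ?thesis
        using assms unfolding inversions_def transpose_def by (auto split: if_splits)
    qed
  qed
  \<comment> \<open>The preimage of this pair would be \<open>(Suc i, i)\<close>, which is not in
    increasing order.\<close>
  moreover have "(i, Suc i) \<notin> ?f ` inversions k w"
  proof
    assume "(i, Suc i) \<in> ?f ` inversions k w"
    then obtain a b where ab: "(a, b) \<in> inversions k w" "i = ?t a" "Suc i = ?t b" by auto
    then show False unfolding inversions_def transpose_def by (auto split: if_splits)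
  qed
  ultimately show ?thesis by (simp add: card_image[OF inj])
qed

lemma comp_transpose_transpose [simp]: "w \<circ> transpose i j \<circ> transpose i j = w"
  by (simp add: fun_eq_iff)

lemma permutes_comp_transpose:
  assumes "w permutes {1..k::nat}" "1 \<le> i" "i < k"
  shows "w \<circ> transpose i (Suc i) permutes {1..k}"
  using assms by (intro permutes_compose[OF permutes_swap_id assms(1)]) auto

lemma permutes_adjacent_neq: "w permutes S \<Longrightarrow> w i \<noteq> w (Suc i)"
  by (simp add: inj_eq[OF permutes_inj])

lemma card_inversions_descent:
  assumes "1 \<le> i" "Suc i \<le> k" "w (Suc i) < w i"
  shows "card (inversions k w) = Suc (card (inversions k (w \<circ> transpose i (Suc i))))"
  using card_inversions_ascent[of i k "w \<circ> transpose i (Suc i)"] assms by simp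

text \<open>Climbing from 1 gives \<open>j \<le> w j\<close>, descending from \<open>k\<close> gives
  \<open>w j \<le> j\<close>.\<close>

lemma permutes_no_descent:
  assumes w: "w permutes {1..k::nat}" and asc: "\<And>i. 1 \<le> i \<Longrightarrow> i < k \<Longrightarrow> w i < w (Suc i)"
  shows "w = id"
proof
  fix i
  show "w i = id i"
  proof (cases "i \<in> {1..k}")
    case True
    have "j \<le> k \<Longrightarrow> j \<le> w j" if "1 \<le> j" for j
      using that
    proof (induction j rule: dec_induct)
      case base
      then show ?case using permutes_in_interval[OF w, of 1] by simp
    next
      case (step n)
      then show ?case using asc[of n] by simp
    qed
    moreover have "1 \<le> j \<Longrightarrow> w j \<le> j" if "j \<le> k" for j
      using that
    proof (induction j rule: inc_induct)
      case base
      then show ?case using permutes_in_interval[OF w, of k] by simp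
    next
      case (step n)
      then show ?case using asc[of n] by simp
    qed
    ultimately show ?thesis using True by (simp add: antisym)
  next
    case False
    then show ?thesis using w by (simp add: permutes_not_in)
  qed
qed

text \<open>Removing a descent lowers the number of inversions. Read backwards, this is induction
  along a reduced word, where each step lengthens the permutation by exactly one and so contributes
  exactly one factor \<open>- q\<close>.\<close>

lemma permutes_ascent_induct [consumes 1, case_names id ascent]:
  assumes w: "w permutes {1..k::nat}" and id: "P id"
    and asc: "\<And>w i. w permutes {1..k} \<Longrightarrow> 1 \<le> i \<Longrightarrow> i < k \<Longrightarrow> w i < w (Suc i) \<Longrightarrow> P w \<Longrightarrow>
      P (w \<circ> transpose i (Suc i))"
  shows "P w"
  using w
proof (induction "card (inversions k w)" arbitrary: w rule: less_induct)
  case less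
  show ?case
  proof (cases "\<exists>i. 1 \<le> i \<and> i < k \<and> w (Suc i) < w i")
    case True
    then obtain i where i: "1 \<le> i" "i < k" "w (Suc i) < w i" by blast
    let ?v = "w \<circ> transpose i (Suc i)"
    have v: "?v permutes {1..k}" using less.prems i by (intro permutes_comp_transpose)
    have "P ?v"
      using less.hyps[OF _ v] card_inversions_descent[of i k w] i by simp
    then have "P (?v \<circ> transpose i (Suc i))"
      using i by (intro asc[OF v]) auto
    then show ?thesis by simp
  next
    case False
    then have "w i < w (Suc i)" if "1 \<le> i" "i < k" for i
      using that permutes_adjacent_neq[OF less.prems, of i] by (meson linorder_neqE_nat)
    then show ?thesis using permutes_no_descent[OF less.prems] id by simp
  qed
qed

lemma simple_prod_append: "simple_prod (js @ [j]) = simple_prod js \<circ> transpose j (Suc j)"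
proof -
  have "foldr (\<lambda>j. (\<circ>) (transpose j (Suc j))) js f = foldr (\<lambda>j. (\<circ>) (transpose j (Suc j))) js id \<circ> f" for f
    by (induction js) (auto simp: comp_assoc)
  from this[of "transpose j (Suc j)"] show ?thesis by (simp add: simple_prod_def)
qed

lemma simple_prod_permutes: "set js \<subseteq> {1..<k} \<Longrightarrow> simple_prod js permutes {1..k}"
proof (induction js rule: rev_induct)
  case Nil
  then show ?case by (simp add: simple_prod_def permutes_id[unfolded id_def] id_def del: One_nat_def)
next
  case (snoc j js)
  then show ?case unfolding simple_prod_append by (intro permutes_comp_transpose) auto
qed

text \<open>One more simple transposition changes the number of inversions by exactly one, up or
  down, so a word is at least as long as the inversion count.\<close>

lemma card_inversions_simple_prod: "set js \<subseteq> {1..<k} \<Longrightarrow> card (inversions k (simple_prod js)) \<le> length js"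
proof (induction js rule: rev_induct)
  case Nil
  have "inversions k (\<lambda>a. a) = {}" by (auto simp: inversions_def)
  then show ?case by (simp add: simple_prod_def id_def)
next
  case (snoc j js)
  let ?w = "simple_prod js"
  have "?w permutes {1..k}" using snoc.prems by (intro simple_prod_permutes) auto
  then have "?w j < ?w (Suc j) \<or> ?w (Suc j) < ?w j"
    using permutes_adjacent_neq[of ?w _ j] by (meson linorder_neqE_nat)
  moreover have j: "1 \<le> j" "Suc j \<le> k" and IH: "card (inversions k ?w) \<le> length js"
    using snoc by auto
  ultimately show ?case
    unfolding simple_prod_append length_append_singleton
  proof (elim disjE)
    assume "?w j < ?w (Suc j)"
    from card_inversions_ascent[OF j this] IH
    show "card (inversions k (?w \<circ> transpose j (Suc j))) \<le> Suc (length js)" by linarith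
  next
    assume "?w (Suc j) < ?w j"
    from card_inversions_descent[OF j this] IH
    show "card (inversions k (?w \<circ> transpose j (Suc j))) \<le> Suc (length js)" by linarith
  qed
qed

lemma simple_prod_exists:
  assumes "w permutes {1..k}"
  shows "\<exists>js. length js = card (inversions k w) \<and> set js \<subseteq> {1..<k} \<and> simple_prod js = w"
  using assms
proof (induction rule: permutes_ascent_induct)
  case id
  have "inversions k (\<lambda>a. a) = {}" by (auto simp: inversions_def)
  then show ?case by (intro exI[of _ "[]"]) (simp add: simple_prod_def id_def)
next
  case (ascent w i)
  then obtain js where "length js = card (inversions k w)" "set js \<subseteq> {1..<k}" "simple_prod js = w"
    by blast
  then have "length (js @ [i]) = card (inversions k (w \<circ> transpose i (Suc i)))"
    "set (js @ [i]) \<subseteq> {1..<k}" "simple_prod (js @ [i]) = w \<circ> transpose i (Suc i)"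
    using ascent card_inversions_ascent[of i k w] unfolding simple_prod_append by auto
  then show ?case by blast
qed

text \<open>Sorting yields a word with as many letters as inversions, and no word is shorter. This
  replaces the \<open>LEAST\<close> over words by a count.\<close>

lemma perm_length_eq_card_inversions:
  assumes "w permutes {1..k}"
  shows "perm_length k w = card (inversions k w)"
  unfolding perm_length_def
proof (rule Least_equality)
  show "\<exists>js. length js = card (inversions k w) \<and> set js \<subseteq> {1..<k} \<and> simple_prod js = w"
    by (rule simple_prod_exists[OF assms])
qed (use card_inversions_simple_prod in blast)

lemma perm_length_id [simp]: "perm_length k id = 0"
proof -
  have "inversions k id = {}" by (auto simp: inversions_def)
  then show ?thesis by (simp add: perm_length_eq_card_inversions permutes_id)
qed

lemma perm_length_ascent:
  assumes "w permutes {1..k}" "1 \<le> i" "i < k" "w i < w (Suc i)"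
  shows "perm_length k (w \<circ> transpose i (Suc i)) = Suc (perm_length k w)"
  using assms permutes_comp_transpose[OF assms(1-3)]
  by (simp add: perm_length_eq_card_inversions card_inversions_ascent del: One_nat_def)

section \<open>Quantum matrices\<close>

text \<open>The determinant relation is left out because it is reached by other means: by
  Cauchy-Binet for the comultiplication, by bandedness for the counit and for the matrices of
  \<open>psi\<close>.\<close>

definition qmat :: "(complex, 'a) module \<Rightarrow> complex \<Rightarrow> nat set \<Rightarrow> (nat \<Rightarrow> nat \<Rightarrow> 'a) \<Rightarrow> bool" where
  "qmat V q N x \<longleftrightarrow> x \<in> N \<rightarrow> N \<rightarrow> carrier V \<and>
    (\<forall>i\<in>N. \<forall>j\<in>N. \<forall>l\<in>N. j < l \<longrightarrow> x i j \<otimes>\<^bsub>V\<^esub> x i l = q \<odot>\<^bsub>V\<^esub> (x i l \<otimes>\<^bsub>V\<^esub> x i j)) \<and>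
    (\<forall>i\<in>N. \<forall>j\<in>N. \<forall>k\<in>N. i < k \<longrightarrow> x i j \<otimes>\<^bsub>V\<^esub> x k j = q \<odot>\<^bsub>V\<^esub> (x k j \<otimes>\<^bsub>V\<^esub> x i j)) \<and>
    (\<forall>i\<in>N. \<forall>j\<in>N. \<forall>k\<in>N. \<forall>l\<in>N. i < k \<longrightarrow> j < l \<longrightarrow>
      x i l \<otimes>\<^bsub>V\<^esub> x k j = x k j \<otimes>\<^bsub>V\<^esub> x i l \<and>
      x i j \<otimes>\<^bsub>V\<^esub> x k l \<ominus>\<^bsub>V\<^esub> x k l \<otimes>\<^bsub>V\<^esub> x i j = (q - inverse q) \<odot>\<^bsub>V\<^esub> (x i l \<otimes>\<^bsub>V\<^esub> x k j))"

text \<open>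
  The quadratic relations say that \<open>x\<close> intertwines the R-matrix with coefficients
  \<open>rcoeff q\<close> and \<open>rflip\<close>, a form which is visibly stable under matrix multiplication.
\<close>

definition rcoeff :: "complex \<Rightarrow> nat \<Rightarrow> nat \<Rightarrow> complex" where
  "rcoeff q i k = (if i = k then q else if i < k then q - inverse q else 0)"

definition rflip :: "nat \<Rightarrow> nat \<Rightarrow> complex" where
  "rflip i k = (if i = k then 0 else 1)"

text \<open>One entry of the equation saying that the braid form of the R-matrix commutes with the
  Kronecker square of \<open>x\<close>: on the left it acts on the row indices \<open>i\<close>,
  \<open>k\<close>, on the right on the column indices \<open>j\<close>, \<open>l\<close>.\<close>

definition rtt :: "(complex, 'a) module \<Rightarrow> complex \<Rightarrow> nat set \<Rightarrow> (nat \<Rightarrow> nat \<Rightarrow> 'a) \<Rightarrow> bool" where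
  "rtt V q N x \<longleftrightarrow> (\<forall>i\<in>N. \<forall>j\<in>N. \<forall>k\<in>N. \<forall>l\<in>N.
    rcoeff q i k \<odot>\<^bsub>V\<^esub> (x i j \<otimes>\<^bsub>V\<^esub> x k l) \<oplus>\<^bsub>V\<^esub> rflip i k \<odot>\<^bsub>V\<^esub> (x k j \<otimes>\<^bsub>V\<^esub> x i l) =
    rcoeff q j l \<odot>\<^bsub>V\<^esub> (x i j \<otimes>\<^bsub>V\<^esub> x k l) \<oplus>\<^bsub>V\<^esub> rflip j l \<odot>\<^bsub>V\<^esub> (x i l \<otimes>\<^bsub>V\<^esub> x k j))"

context calg
begin

lemma minus_eq_iff:
  "a \<in> carrier V \<Longrightarrow> b \<in> carrier V \<Longrightarrow> c \<in> carrier V \<Longrightarrow> a \<ominus> b = c \<longleftrightarrow> a = c \<oplus> b"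
  by (auto simp: a_minus_def a_assoc l_neg r_neg)

text \<open>Comparing \<open>i\<close> with \<open>k\<close> and \<open>j\<close> with
  \<open>l\<close> gives nine cases, each of which combines at most two of the relations; a
  decreasing pair of rows is treated by exchanging the roles of the rows.\<close>

lemma qmat_imp_rtt:
  assumes q: "q \<noteq> 0" and x: "qmat V q N x"
  shows "rtt V q N x"
  unfolding rtt_def
proof (intro ballI)
  fix i j k l assume ijkl: "i \<in> N" "j \<in> N" "k \<in> N" "l \<in> N"
  note x1 = x[unfolded qmat_def, THEN conjunct1]
  note x2 = x[unfolded qmat_def, THEN conjunct2, THEN conjunct1]
  note x3 = x[unfolded qmat_def, THEN conjunct2, THEN conjunct2, THEN conjunct1]
  note x4 = x[unfolded qmat_def, THEN conjunct2, THEN conjunct2, THEN conjunct2]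
  have cl [simp]: "x a b \<in> carrier V" if "a \<in> N" "b \<in> N" for a b
    using that x1 by blast
  have row: "x a b \<otimes> x a d = q \<odot> (x a d \<otimes> x a b)" if "a \<in> N" "b \<in> N" "d \<in> N" "b < d" for a b d
    using that x2 by blast
  have col: "x a b \<otimes> x c b = q \<odot> (x c b \<otimes> x a b)" if "a \<in> N" "b \<in> N" "c \<in> N" "a < c" for a b c
    using that x3 by blast
  have anti: "x a d \<otimes> x c b = x c b \<otimes> x a d"
    and "x a b \<otimes> x c d \<ominus> x c d \<otimes> x a b = (q - inverse q) \<odot> (x a d \<otimes> x c b)"
    if "a \<in> N" "b \<in> N" "c \<in> N" "d \<in> N" "a < c" "b < d" for a b c d
    using x4[rule_format, OF that(1-4), OF that(5,6)] by blast+
  then have diag: "x a b \<otimes> x c d = (q - inverse q) \<odot> (x a d \<otimes> x c b) \<oplus> x c d \<otimes> x a b"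
    if "a \<in> N" "b \<in> N" "c \<in> N" "d \<in> N" "a < c" "b < d" for a b c d
    using that minus_eq_iff[of "x a b \<otimes> x c d" "x c d \<otimes> x a b" "(q - inverse q) \<odot> (x a d \<otimes> x c b)"]
    by simp
  \<comment> \<open>The Hecke identity \<open>(q - 1/q) q + 1 = q^2\<close>. It settles the cases in
    which one pair of indices is equal and the other increasing.\<close>
  have two: "(q - inverse q) \<odot> (q \<odot> v) \<oplus> v = q \<odot> (q \<odot> v)" if "v \<in> carrier V" for v
  proof -
    have "(q - inverse q) \<odot> (q \<odot> v) \<oplus> v = ((q - inverse q) * q + 1) \<odot> v"
      using that by (simp add: smult_smult smult_add_left)
    then show ?thesis using that q by (simp add: smult_smult algebra_simps)
  qed
  consider "i = k" "j = l" | "i = k" "j < l" | "i = k" "l < j" | "i < k" "j = l" | "i < k" "j < l"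
    | "i < k" "l < j" | "k < i" "j = l" | "k < i" "j < l" | "k < i" "l < j"
    using linorder_less_linear[of i k] linorder_less_linear[of j l] by blast
  then show "rcoeff q i k \<odot> (x i j \<otimes> x k l) \<oplus> rflip i k \<odot> (x k j \<otimes> x i l) =
    rcoeff q j l \<odot> (x i j \<otimes> x k l) \<oplus> rflip j l \<odot> (x i l \<otimes> x k j)"
  proof cases
    case 2
    then show ?thesis using ijkl row[of i j l] two[of "x i l \<otimes> x i j"]
      by (simp add: rcoeff_def rflip_def)
  next
    case 3
    then show ?thesis using ijkl row[of i l j] by (simp add: rcoeff_def rflip_def)
  next
    case 4
    then show ?thesis using ijkl col[of i j k] two[of "x k j \<otimes> x i j"]
      by (simp add: rcoeff_def rflip_def)
  next
    case 5
    then show ?thesis using ijkl anti[of i j k l]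
      by (simp add: rcoeff_def rflip_def)
  next
    case 6
    then show ?thesis using ijkl diag[of i l k j] by (simp add: rcoeff_def rflip_def)
  next
    case 7
    then show ?thesis using ijkl col[of k j i] by (simp add: rcoeff_def rflip_def)
  next
    case 8
    then show ?thesis using ijkl diag[of k j i l] anti[of k j i l]
      by (simp add: rcoeff_def rflip_def)
  next
    case 9
    then show ?thesis using ijkl anti[of k l i j] by (simp add: rcoeff_def rflip_def)
  qed (simp add: rcoeff_def rflip_def ijkl)
qed

text \<open>Each relation is a single instance of the R-matrix equation, with rows or columns taken
  in decreasing order so that a coefficient \<open>rcoeff\<close> is zero.\<close>

lemma rtt_imp_qmat:
  assumes x: "x \<in> N \<rightarrow> N \<rightarrow> carrier V" and rtt: "rtt V q N x"
  shows "qmat V q N x"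
proof -
  have cl [simp]: "x a b \<in> carrier V" if "a \<in> N" "b \<in> N" for a b
    using that x by blast
  have R: "rcoeff q i k \<odot> (x i j \<otimes> x k l) \<oplus> rflip i k \<odot> (x k j \<otimes> x i l) =
    rcoeff q j l \<odot> (x i j \<otimes> x k l) \<oplus> rflip j l \<odot> (x i l \<otimes> x k j)"
    if "i \<in> N" "j \<in> N" "k \<in> N" "l \<in> N" for i j k l
    using rtt that unfolding rtt_def by blast
  show ?thesis unfolding qmat_def
  proof (intro conjI ballI impI x)
    fix i j l assume "i \<in> N" "j \<in> N" "l \<in> N" "j < l"
    then show "x i j \<otimes> x i l = q \<odot> (x i l \<otimes> x i j)"
      using R[of i l i j] by (simp add: rcoeff_def rflip_def)
  next
    fix i j k assume "i \<in> N" "j \<in> N" "k \<in> N" "i < k"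
    then show "x i j \<otimes> x k j = q \<odot> (x k j \<otimes> x i j)"
      using R[of k j i j] by (simp add: rcoeff_def rflip_def)
  next
    fix i j k l assume *: "i \<in> N" "j \<in> N" "k \<in> N" "l \<in> N" "i < k" "j < l"
    then show "x i l \<otimes> x k j = x k j \<otimes> x i l"
      using R[of k l i j] by (simp add: rcoeff_def rflip_def)
    from * show "x i j \<otimes> x k l \<ominus> x k l \<otimes> x i j = (q - inverse q) \<odot> (x i l \<otimes> x k j)"
      using R[of i l k j] by (simp add: rcoeff_def rflip_def minus_eq_iff)
  qed
qed

section \<open>Two adjacent rows of a quantum determinant\<close>

lemma list_prod_split_adjacent:
  assumes f: "f \<in> {1..k} \<rightarrow> carrier V" and i: "1 \<le> i" "i < k"
  shows "list_prod V (map f [1..<Suc k]) =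
    list_prod V (map f [1..<i]) \<otimes> (f i \<otimes> f (Suc i)) \<otimes> list_prod V (map f [Suc (Suc i)..<Suc k])"
proof -
  have "[1..<Suc k] = [1..<i] @ [i..<Suc k]"
    using i upt_add_eq_append[of 1 i "Suc k - i"] by simp
  also have "[i..<Suc k] = i # Suc i # [Suc (Suc i)..<Suc k]"
    using i by (simp add: upt_conv_Cons del: upt_Suc)
  finally have "list_prod V (map f [1..<Suc k]) =
      list_prod V (map f [1..<i] @ f i # f (Suc i) # map f [Suc (Suc i)..<Suc k])"
    by (simp del: upt_Suc)
  moreover have "f i \<in> carrier V" "f (Suc i) \<in> carrier V"
    "set (map f [1..<i]) \<subseteq> carrier V" "set (map f [Suc (Suc i)..<Suc k]) \<subseteq> carrier V"
    using f i by (auto simp del: upt_Suc)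
  ultimately show ?thesis
    by (subst (asm) list_prod_append) (auto simp: list_prod_Cons m_assoc simp del: upt_Suc)
qed

text \<open>The terms of \<open>\<tau>\<close> and of \<open>\<tau>\<close> composed with the
  transposition differ only in the factors of rows \<open>i\<close> and \<open>Suc i\<close>, and
  the longer permutation carries one more factor \<open>- q\<close>. Operations on two adjacent rows
  thus reduce to statements on quantum 2 by 2 minors.\<close>

lemma qdet_pair:
  assumes y: "y \<in> {1..k} \<rightarrow> {1..k} \<rightarrow> carrier V" and i: "1 \<le> i" "i < k"
  shows "qdet V q k y = (\<Oplus>\<tau>\<in>{\<tau>. \<tau> permutes {1..k} \<and> \<tau> i < \<tau> (Suc i)}.
    (- q) ^ perm_length k \<tau> \<odot> (list_prod V (map (\<lambda>j. y j (\<tau> j)) [1..<i]) \<otimes>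
      (y i (\<tau> i) \<otimes> y (Suc i) (\<tau> (Suc i)) \<oplus> (- q) \<odot> (y i (\<tau> (Suc i)) \<otimes> y (Suc i) (\<tau> i))) \<otimes>
      list_prod V (map (\<lambda>j. y j (\<tau> j)) [Suc (Suc i)..<Suc k])))"
proof -
  let ?t = "transpose i (Suc i)"
  let ?P = "{\<tau>. \<tau> permutes {1..k}}"
  let ?A = "{\<tau>. \<tau> permutes {1..k} \<and> \<tau> i < \<tau> (Suc i)}"
  let ?s = "\<lambda>\<tau>. (- q) ^ perm_length k \<tau> \<odot> list_prod V (map (\<lambda>i. y i (\<tau> i)) [1..<Suc k])"
  let ?L = "\<lambda>\<tau>. list_prod V (map (\<lambda>j. y j (\<tau> j)) [1..<i])"
  let ?R = "\<lambda>\<tau>. list_prod V (map (\<lambda>j. y j (\<tau> j)) [Suc (Suc i)..<Suc k])"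
  have fin: "finite ?P" by (rule finite_permutations) simp
  have s: "?s \<tau> \<in> carrier V" if "\<tau> permutes {1..k}" for \<tau>
    by (rule qdet_term_closed[OF y that])
  have inj: "inj_on (\<lambda>\<tau>. \<tau> \<circ> ?t) ?A"
    by (rule inj_on_inverseI[of _ "\<lambda>\<tau>. \<tau> \<circ> ?t"]) simp
  \<comment> \<open>Exactly one of \<open>\<tau>\<close> and \<open>\<tau> \<circ> ?t\<close>
    ascends at \<open>i\<close>, so the ascending permutations represent the pairs.\<close>
  have P: "?P = ?A \<union> (\<lambda>\<tau>. \<tau> \<circ> ?t) ` ?A"
  proof (intro equalityI subsetI)
    fix \<tau> assume "\<tau> \<in> ?P"
    then have \<tau>: "\<tau> permutes {1..k}" by simp
    show "\<tau> \<in> ?A \<union> (\<lambda>\<tau>. \<tau> \<circ> ?t) ` ?A"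
    proof (cases "\<tau> i < \<tau> (Suc i)")
      case False
      then have "\<tau> \<circ> ?t \<in> ?A"
        using permutes_comp_transpose[OF \<tau> i] permutes_adjacent_neq[OF \<tau>, of i] by simp
      moreover have "\<tau> = (\<tau> \<circ> ?t) \<circ> ?t" by simp
      ultimately show ?thesis by blast
    qed (use \<tau> in simp)
  qed (use permutes_comp_transpose i in auto)
  have disj: "?A \<inter> (\<lambda>\<tau>. \<tau> \<circ> ?t) ` ?A = {}" by auto
  have finA: "finite ?A" using fin by (rule finite_subset[rotated]) auto
  have "qdet V q k y = (\<Oplus>\<tau>\<in>?A \<union> (\<lambda>\<tau>. \<tau> \<circ> ?t) ` ?A. ?s \<tau>)"
    unfolding qdet_def by (subst P[symmetric]) (rule refl)
  also have "\<dots> = (\<Oplus>\<tau>\<in>?A. ?s \<tau>) \<oplus> (\<Oplus>\<tau>\<in>(\<lambda>\<tau>. \<tau> \<circ> ?t) ` ?A. ?s \<tau>)"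
    using s permutes_comp_transpose[OF _ i]
    by (intro finsum_Un_disjoint finA finite_imageI disj) blast+
  also have "(\<Oplus>\<tau>\<in>(\<lambda>\<tau>. \<tau> \<circ> ?t) ` ?A. ?s \<tau>) = (\<Oplus>\<tau>\<in>?A. ?s (\<tau> \<circ> ?t))"
    using s permutes_comp_transpose[OF _ i] by (intro finsum_reindex inj) blast
  also have "(\<Oplus>\<tau>\<in>?A. ?s \<tau>) \<oplus> \<dots> = (\<Oplus>\<tau>\<in>?A. ?s \<tau> \<oplus> ?s (\<tau> \<circ> ?t))"
    using s permutes_comp_transpose[OF _ i] by (intro finsum_addf[symmetric]) blast+
  also have "\<dots> = (\<Oplus>\<tau>\<in>?A. (- q) ^ perm_length k \<tau> \<odot> (?L \<tau> \<otimes>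
      (y i (\<tau> i) \<otimes> y (Suc i) (\<tau> (Suc i)) \<oplus> (- q) \<odot> (y i (\<tau> (Suc i)) \<otimes> y (Suc i) (\<tau> i))) \<otimes> ?R \<tau>))"
    (is "_ = (\<Oplus>\<tau>\<in>?A. ?r \<tau>)")
  proof (rule finsum_cong'[OF refl])
    have yc: "(\<lambda>j. y j (\<tau> j)) \<in> {1..k} \<rightarrow> carrier V" if "\<tau> permutes {1..k}" for \<tau>
      using y permutes_in_interval[OF that] by blast
    have LR: "?L \<tau> \<in> carrier V" "?R \<tau> \<in> carrier V" if "\<tau> permutes {1..k}" for \<tau>
      using yc[OF that] i by (auto intro!: list_prod_closed simp: Pi_iff simp del: upt_Suc)
    have yy: "y i (\<tau> i) \<in> carrier V" "y i (\<tau> (Suc i)) \<in> carrier V"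
      "y (Suc i) (\<tau> i) \<in> carrier V" "y (Suc i) (\<tau> (Suc i)) \<in> carrier V"
      if "\<tau> permutes {1..k}" for \<tau>
      using y permutes_in_interval[OF that, of i] permutes_in_interval[OF that, of "Suc i"] i
      by (auto simp: Pi_iff)
    show "?r \<in> ?A \<rightarrow> carrier V" using LR yy by blast
    fix \<tau> assume "\<tau> \<in> ?A"
    then have \<tau>: "\<tau> permutes {1..k}" "\<tau> i < \<tau> (Suc i)" by auto
    note \<tau>' = permutes_comp_transpose[OF \<tau>(1) i]
    \<comment> \<open>The transposition fixes all other indices, so the outer products are
      unchanged.\<close>
    have "?L (\<tau> \<circ> ?t) = ?L \<tau>" "?R (\<tau> \<circ> ?t) = ?R \<tau>"
      by (auto intro!: arg_cong[where f = "list_prod V"] simp: transpose_def simp del: upt_Suc)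
    then have "?s (\<tau> \<circ> ?t) = (- q) ^ Suc (perm_length k \<tau>) \<odot>
        (?L \<tau> \<otimes> (y i (\<tau> (Suc i)) \<otimes> y (Suc i) (\<tau> i)) \<otimes> ?R \<tau>)"
      unfolding list_prod_split_adjacent[OF yc[OF \<tau>'] i] perm_length_ascent[OF \<tau>(1) i \<tau>(2)]
      by simp
    then show "?s \<tau> \<oplus> ?s (\<tau> \<circ> ?t) = ?r \<tau>"
      unfolding list_prod_split_adjacent[OF yc[OF \<tau>(1)] i]
      using LR[OF \<tau>(1)] yy[OF \<tau>(1)]
      by (simp add: l_distr r_distr smult_add_right smult_mult_left smult_mult_right smult_smult
          mult.commute[of q] del: upt_Suc)
  qed
  finally show ?thesis .
qed

end

section \<open>Row operations on quantum determinants\<close>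

lemma strict_mono_on_permutes_less:
  assumes "strict_mono_on {1..k::nat} b" "\<tau> permutes {1..k}" "i \<in> {1..k}" "j \<in> {1..k}" "\<tau> i < \<tau> j"
  shows "b (\<tau> i) < (b (\<tau> j) :: nat)"
  using assms permutes_in_interval[of \<tau> k] by (intro strict_mono_onD[OF assms(1)]) blast+

context calg
begin

lemma qmatD:
  assumes x: "qmat V q N x"
  shows "a \<in> N \<Longrightarrow> b \<in> N \<Longrightarrow> x a b \<in> carrier V"
    and "a \<in> N \<Longrightarrow> b \<in> N \<Longrightarrow> d \<in> N \<Longrightarrow> b < d \<Longrightarrow> x a b \<otimes> x a d = q \<odot> (x a d \<otimes> x a b)"
    and "a \<in> N \<Longrightarrow> b \<in> N \<Longrightarrow> c \<in> N \<Longrightarrow> d \<in> N \<Longrightarrow> a < c \<Longrightarrow> b < d \<Longrightarrow>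
      x a d \<otimes> x c b = x c b \<otimes> x a d"
    and "a \<in> N \<Longrightarrow> b \<in> N \<Longrightarrow> c \<in> N \<Longrightarrow> d \<in> N \<Longrightarrow> a < c \<Longrightarrow> b < d \<Longrightarrow>
      x a b \<otimes> x c d = (q - inverse q) \<odot> (x a d \<otimes> x c b) \<oplus> x c d \<otimes> x a b"
proof -
  note x1 = x[unfolded qmat_def, THEN conjunct1]
  note x2 = x[unfolded qmat_def, THEN conjunct2, THEN conjunct1]
  note x4 = x[unfolded qmat_def, THEN conjunct2, THEN conjunct2, THEN conjunct2]
  show cl: "x a b \<in> carrier V" if "a \<in> N" "b \<in> N" for a b
    using that x1 by blast
  show "a \<in> N \<Longrightarrow> b \<in> N \<Longrightarrow> d \<in> N \<Longrightarrow> b < d \<Longrightarrow> x a b \<otimes> x a d = q \<odot> (x a d \<otimes> x a b)"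
    using x2 by blast
  assume *: "a \<in> N" "b \<in> N" "c \<in> N" "d \<in> N" "a < c" "b < d"
  show "x a d \<otimes> x c b = x c b \<otimes> x a d"
    using x4[rule_format, OF *] by blast
  have "x a b \<otimes> x c d \<ominus> x c d \<otimes> x a b = (q - inverse q) \<odot> (x a d \<otimes> x c b)"
    using x4[rule_format, OF *] by blast
  then show "x a b \<otimes> x c d = (q - inverse q) \<odot> (x a d \<otimes> x c b) \<oplus> x c d \<otimes> x a b"
    using * minus_eq_iff[of "x a b \<otimes> x c d" "x c d \<otimes> x a b" "(q - inverse q) \<odot> (x a d \<otimes> x c b)"]
    by (simp add: cl)
qed

context
  fixes q N x b k
  assumes q: "q \<noteq> 0" and x: "qmat V q N x" and b: "b \<in> {1..k} \<rightarrow> N" "strict_mono_on {1..k::nat} b"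
begin

lemma qmat_minor_closed: "c \<in> {1..k} \<rightarrow> N \<Longrightarrow> (\<lambda>i j. x (c i) (b j)) \<in> {1..k} \<rightarrow> {1..k} \<rightarrow> carrier V"
  using b(1) qmatD(1)[OF x] by (auto simp: Pi_iff)

lemma qmat_columns:
  assumes "\<tau> permutes {1..k}" "1 \<le> i" "i < k" "\<tau> i < \<tau> (Suc i)"
  shows "b (\<tau> i) \<in> N" "b (\<tau> (Suc i)) \<in> N" "b (\<tau> i) < b (\<tau> (Suc i))"
proof -
  have *: "\<tau> i \<in> {1..k}" "\<tau> (Suc i) \<in> {1..k}"
    using permutes_in_interval[OF assms(1), of i] permutes_in_interval[OF assms(1), of "Suc i"] assms
    by auto
  then show "b (\<tau> i) \<in> N" "b (\<tau> (Suc i)) \<in> N" using b(1) by blast+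
  show "b (\<tau> i) < b (\<tau> (Suc i))" using strict_mono_onD[OF b(2) * assms(4)] .
qed

text \<open>For rows \<open>s < t\<close> and columns \<open>u < v\<close> put
  \<open>e = x s v * x t u\<close> and \<open>d = x t v * x s u\<close>. The relations turn the
  minor into \<open>(q - 1/q) e + d - q e = d - e/q\<close>, while the minor with swapped rows is
  \<open>e - q d\<close>, which is \<open>- q\<close> times it.\<close>

lemma qdet_row_swap:
  assumes c: "c \<in> {1..k} \<rightarrow> N" and i: "1 \<le> i" "i < k" and less: "c i < c (Suc i)"
  shows "qdet V q k (\<lambda>i' j. x ((c \<circ> transpose i (Suc i)) i') (b j)) =
    (- q) \<odot> qdet V q k (\<lambda>i j. x (c i) (b j))"
proof -
  let ?c = "c \<circ> transpose i (Suc i)"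
  have ci: "c i \<in> N" "c (Suc i) \<in> N" using c i by auto
  have "?c i' \<in> N" if "i' \<in> {1..k}" for i'
    using that c i by (cases "i' = i \<or> i' = Suc i") (auto simp: transpose_def)
  then have c': "?c \<in> {1..k} \<rightarrow> N" by blast
  let ?A = "{\<tau>. \<tau> permutes {1..k} \<and> \<tau> i < \<tau> (Suc i)}"
  let ?L = "\<lambda>c \<tau>. list_prod V (map (\<lambda>j. x (c j) (b (\<tau> j))) [1..<i])"
  let ?R = "\<lambda>c \<tau>. list_prod V (map (\<lambda>j. x (c j) (b (\<tau> j))) [Suc (Suc i)..<Suc k])"
  let ?M = "\<lambda>c \<tau>. x (c i) (b (\<tau> i)) \<otimes> x (c (Suc i)) (b (\<tau> (Suc i))) \<oplus>
    (- q) \<odot> (x (c i) (b (\<tau> (Suc i))) \<otimes> x (c (Suc i)) (b (\<tau> i)))"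
  have LR: "?L c \<tau> \<in> carrier V" "?R c \<tau> \<in> carrier V" "?L ?c \<tau> = ?L c \<tau>" "?R ?c \<tau> = ?R c \<tau>"
    if "\<tau> permutes {1..k}" for \<tau>
  proof -
    have "x (c j) (b (\<tau> j)) \<in> carrier V" if "j \<in> {1..k}" for j
      using qmatD(1)[OF x] c b(1) permutes_in_interval[OF \<open>\<tau> permutes {1..k}\<close> that] that by blast
    then show "?L c \<tau> \<in> carrier V" "?R c \<tau> \<in> carrier V"
      using i by (auto intro!: list_prod_closed simp del: upt_Suc)
    show "?L ?c \<tau> = ?L c \<tau>" "?R ?c \<tau> = ?R c \<tau>"
      by (auto intro!: arg_cong[where f = "list_prod V"] simp: transpose_def simp del: upt_Suc)
  qed
  have M: "?M c \<tau> \<in> carrier V" "?M ?c \<tau> = (- q) \<odot> ?M c \<tau>" if "\<tau> \<in> ?A" for \<tau>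
  proof -
    from that have \<tau>: "\<tau> permutes {1..k}" "\<tau> i < \<tau> (Suc i)" by auto
    note bb = qmat_columns[OF \<tau>(1) i \<tau>(2)]
    define s t where "s = c i" and "t = c (Suc i)"
    define u v where "u = b (\<tau> i)" and "v = b (\<tau> (Suc i))"
    have st: "s \<in> N" "t \<in> N" "u \<in> N" "v \<in> N" "s < t" "u < v"
      using bb ci less by (auto simp: s_def t_def u_def v_def)
    have cl: "x s u \<in> carrier V" "x s v \<in> carrier V" "x t u \<in> carrier V" "x t v \<in> carrier V"
      using st qmatD(1)[OF x] by auto
    then show "?M c \<tau> \<in> carrier V" by (simp add: s_def t_def u_def v_def)
    define d where "d = x t v \<otimes> x s u"
    have d: "d \<in> carrier V" using cl by (simp add: d_def)
    have "x s v \<otimes> x t u = x t u \<otimes> x s v" "x s u \<otimes> x t v = (q - inverse q) \<odot> (x s v \<otimes> x t u) \<oplus> d"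
      unfolding d_def using qmatD(3,4)[OF x st(1,3,2,4,5,6)] by auto
    then have "x t u \<otimes> x s v = x s v \<otimes> x t u" "x s u \<otimes> x t v = (q - inverse q) \<odot> (x s v \<otimes> x t u) \<oplus> d"
      by simp_all
    moreover define e where "e = x s v \<otimes> x t u"
    ultimately have r: "x t u \<otimes> x s v = e" "x s u \<otimes> x t v = (q - inverse q) \<odot> e \<oplus> d" by simp_all
    have e: "e \<in> carrier V" using cl by (simp add: e_def)
    \<comment> \<open>The coefficient of \<open>e\<close> in \<open>- q\<close> times the unswapped
      minor.\<close>
    have "- q * (q - inverse q) + q * q = 1" using q by (simp add: algebra_simps)
    then have e2: "e = (- q * (q - inverse q)) \<odot> e \<oplus> (q * q) \<odot> e"
      using smult_add_left[OF e, of "- q * (q - inverse q)" "q * q"] e by simp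
    have "?M ?c \<tau> = e \<oplus> (- q) \<odot> d"
      by (simp add: s_def[symmetric] t_def[symmetric] u_def[symmetric] v_def[symmetric] r d_def)
    also have "\<dots> = (- q * (q - inverse q)) \<odot> e \<oplus> (q * q) \<odot> e \<oplus> (- q) \<odot> d"
      using e2 by simp
    also have "\<dots> = (- q) \<odot> ((q - inverse q) \<odot> e \<oplus> d \<oplus> (- q) \<odot> e)"
      using d e by (simp add: smult_add_right smult_smult a_ac)
    also have "\<dots> = (- q) \<odot> ?M c \<tau>"
      by (simp add: s_def[symmetric] t_def[symmetric] u_def[symmetric] v_def[symmetric] r e_def[symmetric])
    finally show "?M ?c \<tau> = (- q) \<odot> ?M c \<tau>" .
  qed
  have "qdet V q k (\<lambda>i j. x (?c i) (b j)) =
      (\<Oplus>\<tau>\<in>?A. (- q) ^ perm_length k \<tau> \<odot> (?L ?c \<tau> \<otimes> ?M ?c \<tau> \<otimes> ?R ?c \<tau>))"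
    by (rule qdet_pair[OF qmat_minor_closed[OF c'] i])
  also have "\<dots> = (\<Oplus>\<tau>\<in>?A. (- q) \<odot> ((- q) ^ perm_length k \<tau> \<odot> (?L c \<tau> \<otimes> ?M c \<tau> \<otimes> ?R c \<tau>)))"
  proof (rule finsum_cong'[OF refl])
    show "(\<lambda>\<tau>. (- q) \<odot> ((- q) ^ perm_length k \<tau> \<odot> (?L c \<tau> \<otimes> ?M c \<tau> \<otimes> ?R c \<tau>))) \<in> ?A \<rightarrow> carrier V"
      using LR(1,2) M(1) by blast
    fix \<tau> assume \<tau>: "\<tau> \<in> ?A"
    then have \<tau>': "\<tau> permutes {1..k}" by simp
    show "(- q) ^ perm_length k \<tau> \<odot> (?L ?c \<tau> \<otimes> ?M ?c \<tau> \<otimes> ?R ?c \<tau>) =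
      (- q) \<odot> ((- q) ^ perm_length k \<tau> \<odot> (?L c \<tau> \<otimes> ?M c \<tau> \<otimes> ?R c \<tau>))"
      unfolding LR(3,4)[OF \<tau>'] M(2)[OF \<tau>]
      by (simp only: smult_mult_left smult_mult_right smult_smult mult.commute
          LR(1,2)[OF \<tau>'] M(1)[OF \<tau>] m_closed smult_closed)
  qed
  also have "\<dots> = (- q) \<odot> (\<Oplus>\<tau>\<in>?A. (- q) ^ perm_length k \<tau> \<odot> (?L c \<tau> \<otimes> ?M c \<tau> \<otimes> ?R c \<tau>))"
    using LR(1,2) M(1) by (intro finsum_smult[symmetric]) blast
  also have "(\<Oplus>\<tau>\<in>?A. (- q) ^ perm_length k \<tau> \<odot> (?L c \<tau> \<otimes> ?M c \<tau> \<otimes> ?R c \<tau>)) =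
      qdet V q k (\<lambda>i j. x (c i) (b j))"
    by (rule qdet_pair[OF qmat_minor_closed[OF c] i, symmetric])
  finally show ?thesis .
qed

text \<open>Two entries of one row commute up to \<open>q\<close>, so each 2 by 2 minor in
  \<open>qdet_pair\<close> is zero.\<close>

lemma qdet_equal_rows:
  assumes c: "c \<in> {1..k} \<rightarrow> N" and i: "1 \<le> i" "i < k" and eq: "c i = c (Suc i)"
  shows "qdet V q k (\<lambda>i j. x (c i) (b j)) = \<zero>"
proof -
  let ?L = "\<lambda>\<tau>. list_prod V (map (\<lambda>j. x (c j) (b (\<tau> j))) [1..<i])"
  let ?R = "\<lambda>\<tau>. list_prod V (map (\<lambda>j. x (c j) (b (\<tau> j))) [Suc (Suc i)..<Suc k])"
  have "(- q) ^ perm_length k \<tau> \<odot> (?L \<tau> \<otimes> (x (c i) (b (\<tau> i)) \<otimes> x (c (Suc i)) (b (\<tau> (Suc i))) \<oplus>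
      (- q) \<odot> (x (c i) (b (\<tau> (Suc i))) \<otimes> x (c (Suc i)) (b (\<tau> i)))) \<otimes> ?R \<tau>) = \<zero>"
    if \<tau>: "\<tau> permutes {1..k}" "\<tau> i < \<tau> (Suc i)" for \<tau>
  proof -
    have "x (c j) (b (\<tau> j)) \<in> carrier V" if "j \<in> {1..k}" for j
      using qmatD(1)[OF x] c b(1) permutes_in_interval[OF \<tau>(1) that] that by blast
    then have LR: "?L \<tau> \<in> carrier V" "?R \<tau> \<in> carrier V"
      using i by (auto intro!: list_prod_closed simp del: upt_Suc)
    have "c i \<in> N" using c i by auto
    note bb = qmat_columns[OF \<tau>(1) i \<tau>(2)]
    have "x (c i) (b (\<tau> i)) \<otimes> x (c (Suc i)) (b (\<tau> (Suc i))) \<oplus>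
      (- q) \<odot> (x (c i) (b (\<tau> (Suc i))) \<otimes> x (c (Suc i)) (b (\<tau> i))) = \<zero>"
      using qmatD(2)[OF x \<open>c i \<in> N\<close> bb] qmatD(1)[OF x \<open>c i \<in> N\<close>] bb eq
      by (simp add: smult_minus_left r_neg)
    then show ?thesis using LR by simp
  qed
  then show ?thesis
    unfolding qdet_pair[OF qmat_minor_closed[OF c] i]
    by (subst finsum_cong'[where g = "\<lambda>_. \<zero>", OF refl]) auto
qed

text \<open>Since \<open>c\<close> increases, an ascent of \<open>w\<close> is an ascent of
  \<open>c \<circ> w\<close>, so every step of the induction is one row swap and one factor
  \<open>- q\<close>.\<close>

lemma qdet_permuted_rows:
  assumes c: "c \<in> {1..k} \<rightarrow> N" "strict_mono_on {1..k} c" and "\<sigma> permutes {1..k}"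
  shows "qdet V q k (\<lambda>i j. x (c (\<sigma> i)) (b j)) =
    (- q) ^ perm_length k \<sigma> \<odot> qdet V q k (\<lambda>i j. x (c i) (b j))"
  using assms(3)
proof (induction rule: permutes_ascent_induct)
  case id
  then show ?case
    using qdet_closed[OF qmat_minor_closed[OF c(1)]] by (simp add: perm_length_id[unfolded id_def])
next
  case (ascent w i)
  have cw: "c \<circ> w \<in> {1..k} \<rightarrow> N" using c(1) permutes_in_interval[OF ascent(1)] by auto
  have "(c \<circ> w) i < (c \<circ> w) (Suc i)"
    using strict_mono_on_permutes_less[OF c(2) ascent(1), of i "Suc i"] ascent by simp
  from qdet_row_swap[OF cw ascent(2,3) this]
  have "qdet V q k (\<lambda>i' j. x (c ((w \<circ> transpose i (Suc i)) i')) (b j)) =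
      - q \<odot> qdet V q k (\<lambda>i j. x (c (w i)) (b j))"
    by simp
  then show ?case
    unfolding ascent.IH perm_length_ascent[OF ascent(1-4)]
    using qdet_closed[OF qmat_minor_closed[OF c(1)]] by (simp add: smult_smult)
qed

text \<open>Sort \<open>c\<close> by adjacent swaps, with decreasing inversion count. The sorting
  must meet two equal neighbours, because a strictly increasing \<open>c\<close> would be
  injective.\<close>

lemma qdet_repeated_rows:
  assumes c: "c \<in> {1..k} \<rightarrow> N" and "\<not> inj_on c {1..k}"
  shows "qdet V q k (\<lambda>i j. x (c i) (b j)) = \<zero>"
  using assms
proof (induction "card (inversions k c)" arbitrary: c rule: less_induct)
  case less
  show ?case
  proof (cases "\<exists>i. 1 \<le> i \<and> i < k \<and> c (Suc i) \<le> c i")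
    case True
    then obtain i where i: "1 \<le> i" "i < k" "c (Suc i) \<le> c i" by blast
    show ?thesis
    proof (cases "c (Suc i) = c i")
      case True
      then show ?thesis using qdet_equal_rows[OF less.prems(1) i(1,2)] by simp
    next
      case False
      let ?t = "transpose i (Suc i)"
      have t: "?t permutes {1..k}" using i by (intro permutes_swap_id) auto
      have c': "c \<circ> ?t \<in> {1..k} \<rightarrow> N"
        using less.prems(1) permutes_in_interval[OF t] by auto
      have "\<not> inj_on (c \<circ> ?t) {1..k}"
      proof
        assume "inj_on (c \<circ> ?t) {1..k}"
        then have "inj_on c (?t ` {1..k})" by (rule inj_on_imageI)
        then show False using less.prems(2) by (simp only: permutes_image[OF t])
      qed
      moreover have "card (inversions k (c \<circ> ?t)) < card (inversions k c)"
        using card_inversions_descent[of i k c] i False by linarith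
      ultimately have "qdet V q k (\<lambda>i j. x ((c \<circ> ?t) i) (b j)) = \<zero>"
        by (intro less.hyps c')
      \<comment> \<open>The swap rule is applied to \<open>c \<circ> ?t\<close>, which ascends at
        \<open>i\<close>; swapping back gives \<open>c\<close>.\<close>
      moreover have "qdet V q k (\<lambda>i j. x (c i) (b j)) = (- q) \<odot> qdet V q k (\<lambda>i j. x ((c \<circ> ?t) i) (b j))"
        using qdet_row_swap[OF c' i(1,2)] i False by simp
      ultimately show ?thesis by simp
    qed
  next
    case False
    have "c i < c j" if "1 \<le> i" "i < j" "j \<le> k" for i j
      using that(2,3)
    proof (induction j)
      case (Suc j)
      then have "c j < c (Suc j)" using False that(1) by (meson Suc_le_lessD less_Suc_eq_le not_le order_trans)
      then show ?case using Suc by (cases "i = j") auto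
    qed simp
    then have "inj_on c {1..k}" by (intro linorder_inj_onI) force+
    then show ?thesis using less.prems by blast
  qed
qed

end

end

section \<open>The quantum Cauchy-Binet formula\<close>

text \<open>The i-th smallest element, counted from 1 so that it composes with permutations of
  \<open>{1..k}\<close>.\<close>

definition enum :: "nat set \<Rightarrow> nat \<Rightarrow> nat" where
  "enum C i = sorted_list_of_set C ! (i - 1)"

lemma bij_betw_enum:
  assumes "finite C"
  shows "bij_betw (enum C) {1..card C} C"
proof -
  have "bij_betw (\<lambda>i. i - 1) {1..card C} {..<length (sorted_list_of_set C)}"
    by (rule bij_betwI[of _ _ _ Suc]) auto
  moreover have "bij_betw ((!) (sorted_list_of_set C)) {..<length (sorted_list_of_set C)} C"
    using assms by (intro bij_betw_nth) auto
  ultimately have "bij_betw ((!) (sorted_list_of_set C) \<circ> (\<lambda>i. i - 1)) {1..card C} C"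
    by (rule bij_betw_trans)
  then show ?thesis by (simp add: comp_def enum_def[abs_def])
qed

lemma strict_mono_on_enum: "finite C \<Longrightarrow> strict_mono_on {1..card C} (enum C)"
  unfolding enum_def by (intro strict_mono_onI sorted_wrt_nth_less[OF strict_sorted_list_of_set]) auto

lemma enum_in: "finite C \<Longrightarrow> i \<in> {1..card C} \<Longrightarrow> enum C i \<in> C"
  using bij_betw_enum[of C] by (auto simp: bij_betw_def)

lemma enum_funcset: "finite C \<Longrightarrow> C \<subseteq> N \<Longrightarrow> card C = r \<Longrightarrow> enum C \<in> {1..r} \<rightarrow> N"
  using enum_in[of C] by auto

lemma enum_interval: "i \<in> {1..k} \<Longrightarrow> enum {1..k} i = i"
proof -
  assume i: "i \<in> {1..k}"
  have "sorted_list_of_set {1..k} = [1..<Suc k]"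
    by (simp add: atLeastLessThanSuc_atLeastAtMost[symmetric] del: upt_Suc)
  then show ?thesis using i by (simp add: enum_def del: upt_Suc)
qed

text \<open>An injective map on \<open>{1..r}\<close> is determined by its image \<open>C\<close>
  and by the ranks of its values in \<open>C\<close>. The restriction is there because choices of
  rows are extensional functions.\<close>

lemma bij_betw_subset_permutation:
  assumes "finite N"
  shows "bij_betw (\<lambda>(C, \<sigma>). restrict (enum C \<circ> \<sigma>) {1..r})
    ({C. C \<subseteq> N \<and> card C = r} \<times> {\<sigma>. \<sigma> permutes {1..r}})
    {c \<in> {1..r} \<rightarrow>\<^sub>E N. inj_on c {1..r}}"
  (is "bij_betw ?h (?S \<times> ?P) ?I")
proof -
  have fin: "finite C" if "C \<in> ?S" for C using that assms finite_subset by blast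
  have bij: "bij_betw (enum C \<circ> \<sigma>) {1..r} C" if "C \<in> ?S" "\<sigma> \<in> ?P" for C \<sigma>
  proof -
    have "bij_betw (enum C) {1..r} C" using bij_betw_enum[OF fin[OF that(1)]] that(1) by simp
    moreover have "bij_betw \<sigma> {1..r} {1..r}" using that(2) permutes_imp_bij by simp
    ultimately show ?thesis by (intro bij_betw_trans)
  qed
  have bij': "bij_betw (?h (C, \<sigma>)) {1..r} C" if "C \<in> ?S" "\<sigma> \<in> ?P" for C \<sigma>
    unfolding prod.case by (rule bij_betw_cong[THEN iffD1, OF _ bij[OF that]]) simp
  show ?thesis unfolding bij_betw_def
  proof (intro conjI equalityI subsetI)
    show "inj_on ?h (?S \<times> ?P)"
    proof (rule inj_onI, clarify)
      fix C \<sigma> D \<tau>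
      assume *: "C \<subseteq> N" "r = card C" "D \<subseteq> N" "card D = card C"
        "\<sigma> permutes {1..card C}" "\<tau> permutes {1..card C}"
        "restrict (enum C \<circ> \<sigma>) {1..card C} = restrict (enum D \<circ> \<tau>) {1..card C}"
      have CD: "C = D"
      proof -
        have m: "C \<in> ?S" "\<sigma> \<in> ?P" "D \<in> ?S" "\<tau> \<in> ?P"
          using *(1-6) by simp_all
        have "?h (C, \<sigma>) = ?h (D, \<tau>)" using *(2,7) by simp
        then have "?h (C, \<sigma>) ` {1..r} = ?h (D, \<tau>) ` {1..r}" by (rule arg_cong)
        then show ?thesis
          unfolding bij_betw_imp_surj_on[OF bij'[OF m(1,2)]] bij_betw_imp_surj_on[OF bij'[OF m(3,4)]] .
      qed
      have "\<sigma> i = \<tau> i" for i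
      proof (cases "i \<in> {1..card C}")
        case True
        have "enum C (\<sigma> i) = enum C (\<tau> i)"
          using fun_cong[OF *(7), of i] True CD by simp
        moreover have "inj_on (enum C) {1..card C}"
          using *(1,2) by (intro bij_betw_imp_inj_on[OF bij_betw_enum[OF fin]]) simp
        ultimately show ?thesis
          using permutes_in_interval[OF *(5) True] permutes_in_interval[OF *(6) True]
          unfolding inj_on_def by blast
      next
        case False
        then show ?thesis by (simp add: permutes_not_in[OF *(5)] permutes_not_in[OF *(6)])
      qed
      then have "\<sigma> = \<tau>" ..
      with CD show "C = D \<and> \<sigma> = \<tau>" by simp
    qed
  next
    fix c assume "c \<in> ?h ` (?S \<times> ?P)"
    then obtain C \<sigma> where c: "C \<in> ?S" "\<sigma> \<in> ?P" "c = ?h (C, \<sigma>)" by blast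
    from bij'[OF c(1,2)] c show "c \<in> ?I"
      by (auto simp: bij_betw_def PiE_def)
  next
    fix c assume c: "c \<in> ?I"
    define C where "C = c ` {1..r}"
    have bc: "bij_betw c {1..r} C" using c by (simp add: C_def bij_betw_def)
    have C: "C \<in> ?S" using c bij_betw_same_card[OF bc] by (auto simp: C_def)
    have be: "bij_betw (enum C) {1..r} C" using bij_betw_enum[OF fin[OF C]] C by simp
    \<comment> \<open>The rank of \<open>c i\<close> in the image; being the identity outside
      \<open>{1..r}\<close> is what \<open>permutes\<close> demands.\<close>
    define \<sigma> where "\<sigma> i = (if i \<in> {1..r} then inv_into {1..r} (enum C) (c i) else i)" for i
    have "bij_betw (inv_into {1..r} (enum C) \<circ> c) {1..r} {1..r}"
      by (rule bij_betw_trans[OF bc bij_betw_inv_into[OF be]])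
    then have "bij_betw \<sigma> {1..r} {1..r}"
      using bij_betw_cong[of "{1..r}" \<sigma> "inv_into {1..r} (enum C) \<circ> c"] by (simp add: \<sigma>_def)
    then have \<sigma>: "\<sigma> \<in> ?P" by (auto intro!: bij_imp_permutes simp: \<sigma>_def)
    have "c i = ?h (C, \<sigma>) i" for i
    proof (cases "i \<in> {1..r}")
      case True
      then have "c i \<in> enum C ` {1..r}" using bc be by (auto simp: bij_betw_def)
      then show ?thesis using True by (simp add: \<sigma>_def f_inv_into_f)
    next
      case False
      then show ?thesis using c by (auto simp: PiE_def extensional_def)
    qed
    then have "c = ?h (C, \<sigma>)" ..
    with C \<sigma> show "c \<in> ?h ` (?S \<times> ?P)" by blast
  qed
qed

text \<open>A choice of one summand per factor is recorded as a function of the index. Distinct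
  indices let different factors choose independently, and extensionality counts each choice
  once.\<close>

lemma (in calg) list_prod_finsum:
  assumes N: "finite N" and "distinct is" and "\<And>i j. i \<in> set is \<Longrightarrow> j \<in> N \<Longrightarrow> f i j \<in> carrier V"
  shows "list_prod V (map (\<lambda>i. \<Oplus>j\<in>N. f i j) is) =
    (\<Oplus>c\<in>set is \<rightarrow>\<^sub>E N. list_prod V (map (\<lambda>i. f i (c i)) is))"
  using assms(2,3)
proof (induction "is")
  case Nil
  then show ?case by (simp add: finsum_insert)
next
  case (Cons a as)
  \<comment> \<open>Extends a choice \<open>g\<close> on the remaining indices by the value
    \<open>y\<close> at the new index.\<close>
  let ?h = "\<lambda>(y, g). g(a := y)"
  have cl: "list_prod V (map (\<lambda>i. f i (c i)) as) \<in> carrier V" if "c \<in> set as \<rightarrow>\<^sub>E N" for c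
    using that Cons.prems(2) by (intro list_prod_closed) (auto simp: PiE_iff)
  have fa: "f a j \<in> carrier V" if "j \<in> N" for j using that Cons.prems by simp
  have fin: "finite (set as \<rightarrow>\<^sub>E N)" using N by (intro finite_PiE) auto
  have "list_prod V (map (\<lambda>i. \<Oplus>j\<in>N. f i j) (a # as)) =
      (\<Oplus>j\<in>N. f a j) \<otimes> (\<Oplus>c\<in>set as \<rightarrow>\<^sub>E N. list_prod V (map (\<lambda>i. f i (c i)) as))"
    using Cons by (simp add: list_prod_Cons)
  also have "\<dots> = (\<Oplus>j\<in>N. \<Oplus>c\<in>set as \<rightarrow>\<^sub>E N. f a j \<otimes> list_prod V (map (\<lambda>i. f i (c i)) as))"
    using N fin cl fa
    by (subst finsum_ldistr; (intro finsum_cong' refl finsum_rdistr)?) (auto intro!: finsum_closed)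
  also have "\<dots> = (\<Oplus>p\<in>N \<times> (set as \<rightarrow>\<^sub>E N). f a (fst p) \<otimes> list_prod V (map (\<lambda>i. f i (snd p i)) as))"
    using N fin cl fa by (intro finsum_Times) auto
  also have "\<dots> = (\<Oplus>p\<in>N \<times> (set as \<rightarrow>\<^sub>E N). list_prod V (map (\<lambda>i. f i (?h p i)) (a # as)))"
  proof (rule finsum_cong'[OF refl])
    have eq: "list_prod V (map (\<lambda>i. f i (?h p i)) (a # as)) =
      f a (fst p) \<otimes> list_prod V (map (\<lambda>i. f i (snd p i)) as)" if "p \<in> N \<times> (set as \<rightarrow>\<^sub>E N)" for p
    proof -
      obtain y g where p: "p = (y, g)" by (cases p)
      have "map (\<lambda>i. f i ((g(a := y)) i)) as = map (\<lambda>i. f i (g i)) as"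
        using Cons.prems(1) by (intro map_cong) auto
      then show ?thesis
        by (simp only: p list_prod_Cons list.map prod.case fun_upd_same fst_conv snd_conv)
    qed
    show "(\<lambda>p. list_prod V (map (\<lambda>i. f i (?h p i)) (a # as))) \<in> N \<times> (set as \<rightarrow>\<^sub>E N) \<rightarrow> carrier V"
      using eq cl fa by (auto simp del: list.map)
    show "f a (fst p) \<otimes> list_prod V (map (\<lambda>i. f i (snd p i)) as) =
      list_prod V (map (\<lambda>i. f i (?h p i)) (a # as))" if "p \<in> N \<times> (set as \<rightarrow>\<^sub>E N)" for p
      using eq[OF that] by simp
  qed
  also have "\<dots> = (\<Oplus>c\<in>?h ` (N \<times> (set as \<rightarrow>\<^sub>E N)). list_prod V (map (\<lambda>i. f i (c i)) (a # as)))"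
  proof (rule finsum_reindex[symmetric])
    show "inj_on ?h (N \<times> (set as \<rightarrow>\<^sub>E N))"
      using Cons.prems(1) by (intro inj_combinator) auto
    have "list_prod V (map (\<lambda>i. f i (c i)) (a # as)) \<in> carrier V"
      if "c \<in> set (a # as) \<rightarrow>\<^sub>E N" for c
      using that Cons.prems(2) by (intro list_prod_closed) (auto simp: PiE_iff)
    then show "(\<lambda>c. list_prod V (map (\<lambda>i. f i (c i)) (a # as))) \<in> ?h ` (N \<times> (set as \<rightarrow>\<^sub>E N)) \<rightarrow> carrier V"
      by (auto simp: PiE_insert_eq)
  qed
  also have "?h ` (N \<times> (set as \<rightarrow>\<^sub>E N)) = set (a # as) \<rightarrow>\<^sub>E N"
    by (simp add: PiE_insert_eq)
  finally show ?case .
qed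

text \<open>The product \<open>P a b\<close> plays the role of \<open>a \<otimes> b\<close>, in any algebra that contains such products.\<close>

locale tensor_pairing = W: calg W + T: calg T
  for W :: "(complex, 'a) module" and T :: "(complex, 'b) module" +
  fixes P :: "'a \<Rightarrow> 'a \<Rightarrow> 'b"
  assumes lin_left: "b \<in> carrier W \<Longrightarrow> lin_map W T (\<lambda>a. P a b)"
    and lin_right: "a \<in> carrier W \<Longrightarrow> lin_map W T (\<lambda>b. P a b)"
    and P_one: "P \<one>\<^bsub>W\<^esub> \<one>\<^bsub>W\<^esub> = \<one>\<^bsub>T\<^esub>"
    and P_mult: "a \<in> carrier W \<Longrightarrow> b \<in> carrier W \<Longrightarrow> a' \<in> carrier W \<Longrightarrow> b' \<in> carrier W \<Longrightarrow>
      P a b \<otimes>\<^bsub>T\<^esub> P a' b' = P (a \<otimes>\<^bsub>W\<^esub> a') (b \<otimes>\<^bsub>W\<^esub> b')"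
begin

lemma P_closed [simp, intro]: "a \<in> carrier W \<Longrightarrow> b \<in> carrier W \<Longrightarrow> P a b \<in> carrier T"
  by (rule lin_mapD(1)[OF lin_left])

lemmas P_add_left = lin_mapD(2)[OF lin_left]
lemmas P_add_right = lin_mapD(2)[OF lin_right]
lemmas P_smult_left = lin_mapD(3)[OF lin_left]
lemmas P_smult_right = lin_mapD(3)[OF lin_right]
lemmas P_finsum_left = lin_map_finsum[OF W.calg_axioms T.calg_axioms lin_left]
lemmas P_finsum_right = lin_map_finsum[OF W.calg_axioms T.calg_axioms lin_right]

lemma P_zero_right [simp]: "a \<in> carrier W \<Longrightarrow> P a \<zero>\<^bsub>W\<^esub> = \<zero>\<^bsub>T\<^esub>"
  by (rule lin_map_zero[OF W.calg_axioms T.calg_axioms lin_right])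

lemma list_prod_P:
  "f \<in> set is \<rightarrow> carrier W \<Longrightarrow> g \<in> set is \<rightarrow> carrier W \<Longrightarrow>
    list_prod T (map (\<lambda>i. P (f i) (g i)) is) = P (list_prod W (map f is)) (list_prod W (map g is))"
proof (induction "is")
  case (Cons a as)
  then have "list_prod W (map f as) \<in> carrier W" "list_prod W (map g as) \<in> carrier W"
    by (auto intro!: W.list_prod_closed)
  then show ?case using Cons by (simp add: T.list_prod_Cons W.list_prod_Cons P_mult)
qed (simp add: P_one)

section \<open>Products of quantum matrices\<close>

definition coprod :: "nat set \<Rightarrow> (nat \<Rightarrow> nat \<Rightarrow> 'a) \<Rightarrow> nat \<Rightarrow> nat \<Rightarrow> 'b" where
  "coprod N x i j = (\<Oplus>\<^bsub>T\<^esub>k\<in>N. P (x i k) (x k j))"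

context
  fixes q N x
  assumes q: "q \<noteq> 0" and N: "finite N" and x: "qmat W q N x"
begin

lemma x_closed [simp, intro]: "i \<in> N \<Longrightarrow> j \<in> N \<Longrightarrow> x i j \<in> carrier W"
  by (rule W.qmatD(1)[OF x])

lemma coprod_closed: "i \<in> N \<Longrightarrow> j \<in> N \<Longrightarrow> coprod N x i j \<in> carrier T"
  unfolding coprod_def by (rule T.finsum_closed) auto

lemma coprod_mult:
  assumes "i \<in> N" "j \<in> N" "k \<in> N" "l \<in> N"
  shows "coprod N x i j \<otimes>\<^bsub>T\<^esub> coprod N x k l =
    (\<Oplus>\<^bsub>T\<^esub>a\<in>N. \<Oplus>\<^bsub>T\<^esub>b\<in>N. P (x i a \<otimes>\<^bsub>W\<^esub> x k b) (x a j \<otimes>\<^bsub>W\<^esub> x b l))"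
proof -
  have cl: "P (x i a) (x a j) \<in> carrier T" "P (x k a) (x a l) \<in> carrier T" if "a \<in> N" for a
    using that assms by auto
  have "coprod N x i j \<otimes>\<^bsub>T\<^esub> coprod N x k l = (\<Oplus>\<^bsub>T\<^esub>a\<in>N. P (x i a) (x a j) \<otimes>\<^bsub>T\<^esub> coprod N x k l)"
    using coprod_closed[OF assms(3,4)] cl unfolding coprod_def[of N x i j]
    by (intro T.finsum_ldistr N) auto
  also have "\<dots> = (\<Oplus>\<^bsub>T\<^esub>a\<in>N. \<Oplus>\<^bsub>T\<^esub>b\<in>N. P (x i a \<otimes>\<^bsub>W\<^esub> x k b) (x a j \<otimes>\<^bsub>W\<^esub> x b l))"
  proof (rule T.finsum_cong'[OF refl])
    fix a assume a: "a \<in> N"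
    have "P (x i a) (x a j) \<otimes>\<^bsub>T\<^esub> coprod N x k l =
        (\<Oplus>\<^bsub>T\<^esub>b\<in>N. P (x i a) (x a j) \<otimes>\<^bsub>T\<^esub> P (x k b) (x b l))"
      using cl a unfolding coprod_def by (intro T.finsum_rdistr N) auto
    also have "\<dots> = (\<Oplus>\<^bsub>T\<^esub>b\<in>N. P (x i a \<otimes>\<^bsub>W\<^esub> x k b) (x a j \<otimes>\<^bsub>W\<^esub> x b l))"
      using assms a by (intro T.finsum_cong') (auto simp: P_mult)
    finally show "P (x i a) (x a j) \<otimes>\<^bsub>T\<^esub> coprod N x k l =
        (\<Oplus>\<^bsub>T\<^esub>b\<in>N. P (x i a \<otimes>\<^bsub>W\<^esub> x k b) (x a j \<otimes>\<^bsub>W\<^esub> x b l))" .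
  qed (use assms in \<open>auto intro!: T.finsum_closed\<close>)
  finally show ?thesis .
qed

text \<open>An R-matrix that commutes with the Kronecker square of each factor commutes with that of
  the product. It is moved from the outer rows to the middle indices through the left factor of
  \<open>P\<close>, and on to the outer columns through the right factor.\<close>

lemma qmat_coprod: "qmat T q N (coprod N x)"
proof (rule T.rtt_imp_qmat)
  show "coprod N x \<in> N \<rightarrow> N \<rightarrow> carrier T" using coprod_closed by blast
  \<comment> \<open>The sum over both middle indices of a product of two entries of
    \<open>coprod N x\<close>.\<close>
  define S where "S F = (\<Oplus>\<^bsub>T\<^esub>a\<in>N. \<Oplus>\<^bsub>T\<^esub>b\<in>N. F a b)" for F
  have inner: "(\<lambda>a. \<Oplus>\<^bsub>T\<^esub>b\<in>N. F a b) \<in> N \<rightarrow> carrier T" if "F \<in> N \<rightarrow> N \<rightarrow> carrier T" for F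
    using that by (intro Pi_I T.finsum_closed) blast
  have Sc: "S F = S G"
    if "\<And>a b. a \<in> N \<Longrightarrow> b \<in> N \<Longrightarrow> F a b = G a b" "G \<in> N \<rightarrow> N \<rightarrow> carrier T" for F G
    unfolding S_def
  proof (rule T.finsum_cong'[OF refl inner[OF that(2)]])
    show "(\<Oplus>\<^bsub>T\<^esub>b\<in>N. F a b) = (\<Oplus>\<^bsub>T\<^esub>b\<in>N. G a b)" if "a \<in> N" for a
      using \<open>G \<in> N \<rightarrow> N \<rightarrow> carrier T\<close> \<open>\<And>a b. a \<in> N \<Longrightarrow> b \<in> N \<Longrightarrow> F a b = G a b\<close> that
      by (intro T.finsum_cong') blast+
  qed
  have Sadd: "S F \<oplus>\<^bsub>T\<^esub> S G = S (\<lambda>a b. F a b \<oplus>\<^bsub>T\<^esub> G a b)"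
    if F: "F \<in> N \<rightarrow> N \<rightarrow> carrier T" and G: "G \<in> N \<rightarrow> N \<rightarrow> carrier T" for F G
  proof -
    have "S F \<oplus>\<^bsub>T\<^esub> S G = (\<Oplus>\<^bsub>T\<^esub>a\<in>N. (\<Oplus>\<^bsub>T\<^esub>b\<in>N. F a b) \<oplus>\<^bsub>T\<^esub> (\<Oplus>\<^bsub>T\<^esub>b\<in>N. G a b))"
      unfolding S_def by (rule T.finsum_addf[OF inner[OF F] inner[OF G], symmetric])
    also have "\<dots> = S (\<lambda>a b. F a b \<oplus>\<^bsub>T\<^esub> G a b)"
      unfolding S_def
    proof (rule T.finsum_cong'[OF refl])
      show "(\<lambda>a. \<Oplus>\<^bsub>T\<^esub>b\<in>N. F a b \<oplus>\<^bsub>T\<^esub> G a b) \<in> N \<rightarrow> carrier T"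
        using F G by (intro inner) blast
      show "(\<Oplus>\<^bsub>T\<^esub>b\<in>N. F a b) \<oplus>\<^bsub>T\<^esub> (\<Oplus>\<^bsub>T\<^esub>b\<in>N. G a b) = (\<Oplus>\<^bsub>T\<^esub>b\<in>N. F a b \<oplus>\<^bsub>T\<^esub> G a b)"
        if "a \<in> N" for a
        using F G that by (intro T.finsum_addf[symmetric]) blast+
    qed
    finally show ?thesis .
  qed
  have Ssmult: "c \<odot>\<^bsub>T\<^esub> S F = S (\<lambda>a b. c \<odot>\<^bsub>T\<^esub> F a b)" if F: "F \<in> N \<rightarrow> N \<rightarrow> carrier T" for F c
  proof -
    have "c \<odot>\<^bsub>T\<^esub> S F = (\<Oplus>\<^bsub>T\<^esub>a\<in>N. c \<odot>\<^bsub>T\<^esub> (\<Oplus>\<^bsub>T\<^esub>b\<in>N. F a b))"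
      unfolding S_def by (rule T.finsum_smult[OF inner[OF F]])
    also have "\<dots> = S (\<lambda>a b. c \<odot>\<^bsub>T\<^esub> F a b)"
      unfolding S_def
    proof (rule T.finsum_cong'[OF refl])
      show "(\<lambda>a. \<Oplus>\<^bsub>T\<^esub>b\<in>N. c \<odot>\<^bsub>T\<^esub> F a b) \<in> N \<rightarrow> carrier T"
        using F by (intro inner) blast
      show "c \<odot>\<^bsub>T\<^esub> (\<Oplus>\<^bsub>T\<^esub>b\<in>N. F a b) = (\<Oplus>\<^bsub>T\<^esub>b\<in>N. c \<odot>\<^bsub>T\<^esub> F a b)" if "a \<in> N" for a
        using F that by (intro T.finsum_smult) blast
    qed
    finally show ?thesis .
  qed
  have Sswap: "S F = S (\<lambda>a b. F b a)" if F: "F \<in> N \<rightarrow> N \<rightarrow> carrier T" for F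
    unfolding S_def using F by (intro T.finsum_swap N) blast
  have R: "rcoeff q i k \<odot>\<^bsub>W\<^esub> (x i j \<otimes>\<^bsub>W\<^esub> x k l) \<oplus>\<^bsub>W\<^esub> rflip i k \<odot>\<^bsub>W\<^esub> (x k j \<otimes>\<^bsub>W\<^esub> x i l) =
    rcoeff q j l \<odot>\<^bsub>W\<^esub> (x i j \<otimes>\<^bsub>W\<^esub> x k l) \<oplus>\<^bsub>W\<^esub> rflip j l \<odot>\<^bsub>W\<^esub> (x i l \<otimes>\<^bsub>W\<^esub> x k j)"
    if "i \<in> N" "j \<in> N" "k \<in> N" "l \<in> N" for i j k l
    using W.qmat_imp_rtt[OF q x] that unfolding rtt_def by blast
  have cl: "(\<lambda>a b. P (x i a \<otimes>\<^bsub>W\<^esub> x k b) (x a j \<otimes>\<^bsub>W\<^esub> x b l)) \<in> N \<rightarrow> N \<rightarrow> carrier T"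
      "(\<lambda>a b. P (x i b \<otimes>\<^bsub>W\<^esub> x k a) (x a j \<otimes>\<^bsub>W\<^esub> x b l)) \<in> N \<rightarrow> N \<rightarrow> carrier T"
      "(\<lambda>a b. P (x i a \<otimes>\<^bsub>W\<^esub> x k b) (x b j \<otimes>\<^bsub>W\<^esub> x a l)) \<in> N \<rightarrow> N \<rightarrow> carrier T"
    if "i \<in> N" "j \<in> N" "k \<in> N" "l \<in> N" for i j k l
    using that by auto
  have scl: "(\<lambda>a b. c a b \<odot>\<^bsub>T\<^esub> F a b) \<in> N \<rightarrow> N \<rightarrow> carrier T" if "F \<in> N \<rightarrow> N \<rightarrow> carrier T" for F c
    using that by blast
  have acl: "(\<lambda>a b. F a b \<oplus>\<^bsub>T\<^esub> G a b) \<in> N \<rightarrow> N \<rightarrow> carrier T"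
    if "F \<in> N \<rightarrow> N \<rightarrow> carrier T" "G \<in> N \<rightarrow> N \<rightarrow> carrier T" for F G
    using that by blast
  show "rtt T q N (coprod N x)"
    unfolding rtt_def
  proof (intro ballI)
    fix i j k l assume n: "i \<in> N" "j \<in> N" "k \<in> N" "l \<in> N"
    note c = cl[OF n] and c' = cl[OF n(3,2,1,4)] and c'' = cl[OF n(1,4,3,2)]
    note M = coprod_mult[folded S_def]
    let ?F = "\<lambda>a b. P (x i a \<otimes>\<^bsub>W\<^esub> x k b) (x a j \<otimes>\<^bsub>W\<^esub> x b l)"
    let ?G = "\<lambda>a b. P (x i b \<otimes>\<^bsub>W\<^esub> x k a) (x a j \<otimes>\<^bsub>W\<^esub> x b l)"
    let ?G' = "\<lambda>a b. P (x i a \<otimes>\<^bsub>W\<^esub> x k b) (x b j \<otimes>\<^bsub>W\<^esub> x a l)"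
    let ?H = "\<lambda>a b. P (x k a \<otimes>\<^bsub>W\<^esub> x i b) (x a j \<otimes>\<^bsub>W\<^esub> x b l)"
    let ?K = "\<lambda>a b. P (x i a \<otimes>\<^bsub>W\<^esub> x k b) (x a l \<otimes>\<^bsub>W\<^esub> x b j)"
    have "rcoeff q i k \<odot>\<^bsub>T\<^esub> (coprod N x i j \<otimes>\<^bsub>T\<^esub> coprod N x k l) \<oplus>\<^bsub>T\<^esub>
        rflip i k \<odot>\<^bsub>T\<^esub> (coprod N x k j \<otimes>\<^bsub>T\<^esub> coprod N x i l) =
        S (\<lambda>a b. rcoeff q i k \<odot>\<^bsub>T\<^esub> ?F a b \<oplus>\<^bsub>T\<^esub> rflip i k \<odot>\<^bsub>T\<^esub> ?H a b)"
      unfolding M[OF n] M[OF n(3,2,1,4)] Ssmult[OF c(1)] Ssmult[OF c'(1)]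
      by (rule Sadd[OF scl[OF c(1)] scl[OF c'(1)]])
    \<comment> \<open>The R-matrix equation in the left factor: the coefficients now depend on the
      middle indices \<open>a\<close>, \<open>b\<close>.\<close>
    also have "\<dots> = S (\<lambda>a b. rcoeff q a b \<odot>\<^bsub>T\<^esub> ?F a b \<oplus>\<^bsub>T\<^esub> rflip a b \<odot>\<^bsub>T\<^esub> ?G a b)"
    proof (rule Sc)
      fix a b assume ab: "a \<in> N" "b \<in> N"
      have "P (rcoeff q i k \<odot>\<^bsub>W\<^esub> (x i a \<otimes>\<^bsub>W\<^esub> x k b) \<oplus>\<^bsub>W\<^esub> rflip i k \<odot>\<^bsub>W\<^esub> (x k a \<otimes>\<^bsub>W\<^esub> x i b)) (x a j \<otimes>\<^bsub>W\<^esub> x b l) =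
        P (rcoeff q a b \<odot>\<^bsub>W\<^esub> (x i a \<otimes>\<^bsub>W\<^esub> x k b) \<oplus>\<^bsub>W\<^esub> rflip a b \<odot>\<^bsub>W\<^esub> (x i b \<otimes>\<^bsub>W\<^esub> x k a)) (x a j \<otimes>\<^bsub>W\<^esub> x b l)"
        by (simp only: R[OF n(1) ab(1) n(3) ab(2)])
      then show "rcoeff q i k \<odot>\<^bsub>T\<^esub> ?F a b \<oplus>\<^bsub>T\<^esub> rflip i k \<odot>\<^bsub>T\<^esub> ?H a b =
        rcoeff q a b \<odot>\<^bsub>T\<^esub> ?F a b \<oplus>\<^bsub>T\<^esub> rflip a b \<odot>\<^bsub>T\<^esub> ?G a b"
        using n ab by (simp add: P_add_left P_smult_left)
    qed (intro acl scl c)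
    also have "\<dots> = S (\<lambda>a b. rcoeff q a b \<odot>\<^bsub>T\<^esub> ?F a b) \<oplus>\<^bsub>T\<^esub> S (\<lambda>a b. rflip a b \<odot>\<^bsub>T\<^esub> ?G a b)"
      by (rule Sadd[OF scl[OF c(1)] scl[OF c(2)], symmetric])
    \<comment> \<open>Exchanging the names \<open>a\<close> and \<open>b\<close> moves the flip from
      the columns of the left factor to the rows of the right factor.\<close>
    also have "S (\<lambda>a b. rflip a b \<odot>\<^bsub>T\<^esub> ?G a b) = S (\<lambda>a b. rflip b a \<odot>\<^bsub>T\<^esub> ?G' a b)"
      by (rule Sswap[OF scl[OF c(2)]])
    also have "S (\<lambda>a b. rcoeff q a b \<odot>\<^bsub>T\<^esub> ?F a b) \<oplus>\<^bsub>T\<^esub> \<dots> =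
        S (\<lambda>a b. rcoeff q a b \<odot>\<^bsub>T\<^esub> ?F a b \<oplus>\<^bsub>T\<^esub> rflip b a \<odot>\<^bsub>T\<^esub> ?G' a b)"
      by (rule Sadd[OF scl[OF c(1)] scl[OF c(3)]])
    \<comment> \<open>The R-matrix equation in the right factor, read from rows to columns.\<close>
    also have "\<dots> = S (\<lambda>a b. rcoeff q j l \<odot>\<^bsub>T\<^esub> ?F a b \<oplus>\<^bsub>T\<^esub> rflip j l \<odot>\<^bsub>T\<^esub> ?K a b)"
    proof (rule Sc)
      fix a b assume ab: "a \<in> N" "b \<in> N"
      have "P (x i a \<otimes>\<^bsub>W\<^esub> x k b) (rcoeff q a b \<odot>\<^bsub>W\<^esub> (x a j \<otimes>\<^bsub>W\<^esub> x b l) \<oplus>\<^bsub>W\<^esub> rflip a b \<odot>\<^bsub>W\<^esub> (x b j \<otimes>\<^bsub>W\<^esub> x a l)) =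
        P (x i a \<otimes>\<^bsub>W\<^esub> x k b) (rcoeff q j l \<odot>\<^bsub>W\<^esub> (x a j \<otimes>\<^bsub>W\<^esub> x b l) \<oplus>\<^bsub>W\<^esub> rflip j l \<odot>\<^bsub>W\<^esub> (x a l \<otimes>\<^bsub>W\<^esub> x b j))"
        by (simp only: R[OF ab(1) n(2) ab(2) n(4)])
      then show "rcoeff q a b \<odot>\<^bsub>T\<^esub> ?F a b \<oplus>\<^bsub>T\<^esub> rflip b a \<odot>\<^bsub>T\<^esub> ?G' a b =
        rcoeff q j l \<odot>\<^bsub>T\<^esub> ?F a b \<oplus>\<^bsub>T\<^esub> rflip j l \<odot>\<^bsub>T\<^esub> ?K a b"
        using n ab by (simp add: P_add_right P_smult_right rflip_def eq_commute[of b a])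
    qed (intro acl scl c c'')
    also have "\<dots> = rcoeff q j l \<odot>\<^bsub>T\<^esub> (coprod N x i j \<otimes>\<^bsub>T\<^esub> coprod N x k l) \<oplus>\<^bsub>T\<^esub>
        rflip j l \<odot>\<^bsub>T\<^esub> (coprod N x i l \<otimes>\<^bsub>T\<^esub> coprod N x k j)"
      unfolding M[OF n] M[OF n(1,4,3,2)] Ssmult[OF c(1)] Ssmult[OF c''(1)]
      by (rule Sadd[OF scl[OF c(1)] scl[OF c''(1)], symmetric])
    finally show "rcoeff q i k \<odot>\<^bsub>T\<^esub> (coprod N x i j \<otimes>\<^bsub>T\<^esub> coprod N x k l) \<oplus>\<^bsub>T\<^esub>
        rflip i k \<odot>\<^bsub>T\<^esub> (coprod N x k j \<otimes>\<^bsub>T\<^esub> coprod N x i l) =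
      rcoeff q j l \<odot>\<^bsub>T\<^esub> (coprod N x i j \<otimes>\<^bsub>T\<^esub> coprod N x k l) \<oplus>\<^bsub>T\<^esub>
        rflip j l \<odot>\<^bsub>T\<^esub> (coprod N x i l \<otimes>\<^bsub>T\<^esub> coprod N x k j)" .
  qed
qed

text \<open>The quantum Cauchy-Binet formula. Expanding each row gives a sum over choices
  \<open>c\<close> of middle indices; the right factors over all \<open>\<tau>\<close> add up to a
  determinant with rows \<open>c\<close>, to which the row rules apply.\<close>

lemma qdet_coprod:
  assumes a: "a \<in> {1..r} \<rightarrow> N" and b: "b \<in> {1..r} \<rightarrow> N" "strict_mono_on {1..r} b"
  shows "qdet T q r (\<lambda>i j. coprod N x (a i) (b j)) =
    (\<Oplus>\<^bsub>T\<^esub>C\<in>{C. C \<subseteq> N \<and> card C = r}.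
      P (qdet W q r (\<lambda>i j. x (a i) (enum C j))) (qdet W q r (\<lambda>i j. x (enum C i) (b j))))"
proof -
  let ?S = "{C. C \<subseteq> N \<and> card C = r}" and ?P = "{\<tau>. \<tau> permutes {1..r}}"
  let ?f = "\<lambda>c. list_prod W (map (\<lambda>i. x (a i) (c i)) [1..<Suc r])"
  let ?g = "\<lambda>c \<tau>. list_prod W (map (\<lambda>i. x (c i) (b (\<tau> i))) [1..<Suc r])"
  let ?D = "\<lambda>c. qdet W q r (\<lambda>i j. x (c i) (b j))"
  have set_upt: "set [1..<Suc r] = {1..r}" by auto
  have finP: "finite ?P" by (rule finite_permutations) simp
  have finS: "finite ?S" using N by simp
  have finE: "finite ({1..r} \<rightarrow>\<^sub>E N)" using N by (intro finite_PiE) auto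
  have f: "?f c \<in> carrier W" if "c \<in> {1..r} \<rightarrow> N" for c
  proof (rule W.list_prod_closed)
    have "x (a i) (c i) \<in> carrier W" if "i \<in> {1..r}" for i
      using a \<open>c \<in> {1..r} \<rightarrow> N\<close> that by blast
    then show "set (map (\<lambda>i. x (a i) (c i)) [1..<Suc r]) \<subseteq> carrier W" by (auto simp del: upt_Suc)
  qed
  have bt: "b (\<tau> i) \<in> N" if "\<tau> permutes {1..r}" "i \<in> {1..r}" for \<tau> i
    using b(1) permutes_in_interval[OF that] by blast
  have g: "?g c \<tau> \<in> carrier W" if "c \<in> {1..r} \<rightarrow> N" "\<tau> permutes {1..r}" for c \<tau>
  proof (rule W.list_prod_closed)
    have "x (c i) (b (\<tau> i)) \<in> carrier W" if "i \<in> {1..r}" for i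
      using bt[OF \<open>\<tau> permutes {1..r}\<close> that] \<open>c \<in> {1..r} \<rightarrow> N\<close> that by blast
    then show "set (map (\<lambda>i. x (c i) (b (\<tau> i))) [1..<Suc r]) \<subseteq> carrier W" by (auto simp del: upt_Suc)
  qed
  have D: "?D c \<in> carrier W" if "c \<in> {1..r} \<rightarrow> N" for c
    by (rule W.qdet_closed[OF W.qmat_minor_closed[OF q x b that]])
  have E: "c \<in> {1..r} \<rightarrow> N" if "c \<in> {1..r} \<rightarrow>\<^sub>E N" for c using that by auto
  have "qdet T q r (\<lambda>i j. coprod N x (a i) (b j)) =
      (\<Oplus>\<^bsub>T\<^esub>\<tau>\<in>?P. \<Oplus>\<^bsub>T\<^esub>c\<in>{1..r} \<rightarrow>\<^sub>E N. P (?f c) ((- q) ^ perm_length r \<tau> \<odot>\<^bsub>W\<^esub> ?g c \<tau>))"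
    unfolding qdet_def
  proof (rule T.finsum_cong'[OF refl])
    show "(\<lambda>\<tau>. \<Oplus>\<^bsub>T\<^esub>c\<in>{1..r} \<rightarrow>\<^sub>E N. P (?f c) ((- q) ^ perm_length r \<tau> \<odot>\<^bsub>W\<^esub> ?g c \<tau>)) \<in> ?P \<rightarrow> carrier T"
      using f g E by (intro Pi_I T.finsum_closed) blast
    fix \<tau> assume "\<tau> \<in> ?P"
    then have \<tau>: "\<tau> permutes {1..r}" by simp
    have cl: "P (x (a i) j) (x j (b (\<tau> i))) \<in> carrier T" if "i \<in> {1..r}" "j \<in> N" for i j
      using bt[OF \<tau> that(1)] a that by blast
    have "list_prod T (map (\<lambda>i. coprod N x (a i) (b (\<tau> i))) [1..<Suc r]) =
        (\<Oplus>\<^bsub>T\<^esub>c\<in>set [1..<Suc r] \<rightarrow>\<^sub>E N.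
          list_prod T (map (\<lambda>i. P (x (a i) (c i)) (x (c i) (b (\<tau> i)))) [1..<Suc r]))"
      unfolding coprod_def using cl unfolding set_upt[symmetric]
      by (intro T.list_prod_finsum N distinct_upt) blast
    also have "\<dots> = (\<Oplus>\<^bsub>T\<^esub>c\<in>{1..r} \<rightarrow>\<^sub>E N. P (?f c) (?g c \<tau>))"
      unfolding set_upt
    proof (rule T.finsum_cong'[OF refl])
      show "(\<lambda>c. P (?f c) (?g c \<tau>)) \<in> ({1..r} \<rightarrow>\<^sub>E N) \<rightarrow> carrier T"
        using f g[OF _ \<tau>] E by blast
      fix c assume "c \<in> {1..r} \<rightarrow>\<^sub>E N"
      then have c: "c \<in> {1..r} \<rightarrow> N" by (rule E)
      show "list_prod T (map (\<lambda>i. P (x (a i) (c i)) (x (c i) (b (\<tau> i)))) [1..<Suc r]) = P (?f c) (?g c \<tau>)"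
        using a bt[OF \<tau>] c by (intro list_prod_P; unfold set_upt) blast+
    qed
    finally have "(- q) ^ perm_length r \<tau> \<odot>\<^bsub>T\<^esub> list_prod T (map (\<lambda>i. coprod N x (a i) (b (\<tau> i))) [1..<Suc r]) =
        (- q) ^ perm_length r \<tau> \<odot>\<^bsub>T\<^esub> (\<Oplus>\<^bsub>T\<^esub>c\<in>{1..r} \<rightarrow>\<^sub>E N. P (?f c) (?g c \<tau>))"
      by (rule arg_cong)
    also have "\<dots> = (\<Oplus>\<^bsub>T\<^esub>c\<in>{1..r} \<rightarrow>\<^sub>E N. (- q) ^ perm_length r \<tau> \<odot>\<^bsub>T\<^esub> P (?f c) (?g c \<tau>))"
      using f g[OF _ \<tau>] E by (intro T.finsum_smult) blast
    also have "\<dots> = (\<Oplus>\<^bsub>T\<^esub>c\<in>{1..r} \<rightarrow>\<^sub>E N. P (?f c) ((- q) ^ perm_length r \<tau> \<odot>\<^bsub>W\<^esub> ?g c \<tau>))"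
    proof (rule T.finsum_cong'[OF refl])
      show "(\<lambda>c. P (?f c) ((- q) ^ perm_length r \<tau> \<odot>\<^bsub>W\<^esub> ?g c \<tau>)) \<in> ({1..r} \<rightarrow>\<^sub>E N) \<rightarrow> carrier T"
        using f g[OF _ \<tau>] E by blast
      fix c assume "c \<in> {1..r} \<rightarrow>\<^sub>E N"
      then have c: "c \<in> {1..r} \<rightarrow> N" by (rule E)
      show "(- q) ^ perm_length r \<tau> \<odot>\<^bsub>T\<^esub> P (?f c) (?g c \<tau>) = P (?f c) ((- q) ^ perm_length r \<tau> \<odot>\<^bsub>W\<^esub> ?g c \<tau>)"
        by (rule P_smult_right[OF f[OF c] g[OF c \<tau>], symmetric])
    qed
    finally show "(- q) ^ perm_length r \<tau> \<odot>\<^bsub>T\<^esub> list_prod T (map (\<lambda>i. coprod N x (a i) (b (\<tau> i))) [1..<Suc r]) =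
      (\<Oplus>\<^bsub>T\<^esub>c\<in>{1..r} \<rightarrow>\<^sub>E N. P (?f c) ((- q) ^ perm_length r \<tau> \<odot>\<^bsub>W\<^esub> ?g c \<tau>))" .
  qed
  \<comment> \<open>With the choice \<open>c\<close> outermost, the inner sum over
    \<open>\<tau>\<close> touches the right factor only.\<close>
  also have "\<dots> = (\<Oplus>\<^bsub>T\<^esub>c\<in>{1..r} \<rightarrow>\<^sub>E N. \<Oplus>\<^bsub>T\<^esub>\<tau>\<in>?P. P (?f c) ((- q) ^ perm_length r \<tau> \<odot>\<^bsub>W\<^esub> ?g c \<tau>))"
    using f g E by (intro T.finsum_swap finE) blast
  also have "\<dots> = (\<Oplus>\<^bsub>T\<^esub>c\<in>{1..r} \<rightarrow>\<^sub>E N. P (?f c) (?D c))"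
  proof (rule T.finsum_cong'[OF refl])
    show "(\<lambda>c. P (?f c) (?D c)) \<in> ({1..r} \<rightarrow>\<^sub>E N) \<rightarrow> carrier T" using f D E by blast
    fix c assume "c \<in> {1..r} \<rightarrow>\<^sub>E N"
    then have c: "c \<in> {1..r} \<rightarrow> N" by (rule E)
    show "(\<Oplus>\<^bsub>T\<^esub>\<tau>\<in>?P. P (?f c) ((- q) ^ perm_length r \<tau> \<odot>\<^bsub>W\<^esub> ?g c \<tau>)) = P (?f c) (?D c)"
      unfolding qdet_def using g[OF c] by (intro P_finsum_right[OF f[OF c], symmetric]) blast
  qed
  \<comment> \<open>Choices with repeated values drop out by
    \<open>qdet_repeated_rows\<close>.\<close>
  also have "\<dots> = (\<Oplus>\<^bsub>T\<^esub>c\<in>{c \<in> {1..r} \<rightarrow>\<^sub>E N. inj_on c {1..r}}. P (?f c) (?D c))"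
  proof (rule T.finsum_neutral_subset[OF finE])
    fix c assume c: "c \<in> ({1..r} \<rightarrow>\<^sub>E N) - {c \<in> {1..r} \<rightarrow>\<^sub>E N. inj_on c {1..r}}"
    then have c': "c \<in> {1..r} \<rightarrow> N" and "\<not> inj_on c {1..r}" by auto
    from W.qdet_repeated_rows[OF q x b this] show "P (?f c) (?D c) = \<zero>\<^bsub>T\<^esub>"
      using P_zero_right[OF f[OF c']] by simp
  qed (use f D E in blast)+
  also have "\<dots> = (\<Oplus>\<^bsub>T\<^esub>p\<in>?S \<times> ?P. P (?f ((\<lambda>(C, \<sigma>). restrict (enum C \<circ> \<sigma>) {1..r}) p))
      (?D ((\<lambda>(C, \<sigma>). restrict (enum C \<circ> \<sigma>) {1..r}) p)))"
    using f D E by (intro T.finsum_bij_betw[OF bij_betw_subset_permutation[OF N]]) blast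
  \<comment> \<open>Sorting the rows of the right factor yields the power of \<open>- q\<close>
    belonging to \<open>\<sigma>\<close>.\<close>
  also have "\<dots> = (\<Oplus>\<^bsub>T\<^esub>p\<in>?S \<times> ?P. (- q) ^ perm_length r (snd p) \<odot>\<^bsub>T\<^esub>
      P (?f (enum (fst p) \<circ> snd p)) (?D (enum (fst p))))"
  proof (rule T.finsum_cong'[OF refl])
    have *: "enum C \<in> {1..r} \<rightarrow> N" "enum C \<circ> \<sigma> \<in> {1..r} \<rightarrow> N" if "C \<in> ?S" "\<sigma> permutes {1..r}" for C \<sigma>
    proof -
      show "enum C \<in> {1..r} \<rightarrow> N"
        using that(1) finite_subset[OF _ N] by (intro enum_funcset) auto
      then show "enum C \<circ> \<sigma> \<in> {1..r} \<rightarrow> N"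
        using permutes_in_interval[OF that(2)] by auto
    qed
    show "(\<lambda>p. (- q) ^ perm_length r (snd p) \<odot>\<^bsub>T\<^esub> P (?f (enum (fst p) \<circ> snd p)) (?D (enum (fst p))))
        \<in> ?S \<times> ?P \<rightarrow> carrier T"
      using f[OF *(2)] D[OF *(1)] by auto
    fix p assume "p \<in> ?S \<times> ?P"
    then obtain C \<sigma> where p: "p = (C, \<sigma>)" "C \<in> ?S" and \<sigma>: "\<sigma> permutes {1..r}" by auto
    have fC: "finite C" using p(2) finite_subset[OF _ N] by auto
    let ?c = "restrict (enum C \<circ> \<sigma>) {1..r}"
    have "?f ?c = ?f (enum C \<circ> \<sigma>)"
      by (intro arg_cong[where f = "list_prod W"] map_cong refl) auto
    moreover have "?D ?c = ?D (enum C \<circ> \<sigma>)"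
      by (rule W.qdet_cong[OF _ W.qmat_minor_closed[OF q x b *(2)[OF p(2) \<sigma>]]]) simp
    moreover have "?D (enum C \<circ> \<sigma>) = (- q) ^ perm_length r \<sigma> \<odot>\<^bsub>W\<^esub> ?D (enum C)"
      using W.qdet_permuted_rows[OF q x b *(1)[OF p(2) \<sigma>] _ \<sigma>] strict_mono_on_enum[OF fC] p(2)
      by simp
    ultimately show "P (?f ((\<lambda>(C, \<sigma>). restrict (enum C \<circ> \<sigma>) {1..r}) p))
      (?D ((\<lambda>(C, \<sigma>). restrict (enum C \<circ> \<sigma>) {1..r}) p)) =
      (- q) ^ perm_length r (snd p) \<odot>\<^bsub>T\<^esub> P (?f (enum (fst p) \<circ> snd p)) (?D (enum (fst p)))"
      using P_smult_right[OF f[OF *(2)[OF p(2) \<sigma>]] D[OF *(1)[OF p(2) \<sigma>]]]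
      by (simp only: p(1) prod.case fst_conv snd_conv)
  qed
  also have "\<dots> = (\<Oplus>\<^bsub>T\<^esub>C\<in>?S. \<Oplus>\<^bsub>T\<^esub>\<sigma>\<in>?P. (- q) ^ perm_length r \<sigma> \<odot>\<^bsub>T\<^esub> P (?f (enum C \<circ> \<sigma>)) (?D (enum C)))"
  proof (rule T.finsum_Times[OF finS finP, symmetric])
    fix C \<sigma> assume C: "C \<in> ?S" and "\<sigma> \<in> ?P"
    then have \<sigma>: "\<sigma> permutes {1..r}" by simp
    have e: "enum C \<in> {1..r} \<rightarrow> N"
      using C finite_subset[OF _ N] by (intro enum_funcset) auto
    then have "enum C \<circ> \<sigma> \<in> {1..r} \<rightarrow> N"
      using permutes_in_interval[OF \<sigma>] by auto
    with e show "(- q) ^ perm_length r \<sigma> \<odot>\<^bsub>T\<^esub> P (?f (enum C \<circ> \<sigma>)) (?D (enum C)) \<in> carrier T"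
      using f D by blast
  qed
  \<comment> \<open>This power is the coefficient of \<open>\<sigma>\<close> in the minor with rows
    \<open>a\<close> and columns \<open>C\<close>, so the left factors assemble to that
    minor.\<close>
  also have "\<dots> = (\<Oplus>\<^bsub>T\<^esub>C\<in>?S. P (qdet W q r (\<lambda>i j. x (a i) (enum C j))) (?D (enum C)))"
  proof (rule T.finsum_cong'[OF refl])
    have e: "enum C \<in> {1..r} \<rightarrow> N" if "C \<in> ?S" for C
      using that finite_subset[OF _ N] by (intro enum_funcset) auto
    have y: "(\<lambda>i j. x (a i) (enum C j)) \<in> {1..r} \<rightarrow> {1..r} \<rightarrow> carrier W" if "C \<in> ?S" for C
      using a e[OF that] by blast
    show "(\<lambda>C. P (qdet W q r (\<lambda>i j. x (a i) (enum C j))) (?D (enum C))) \<in> ?S \<rightarrow> carrier T"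
      using W.qdet_closed[OF y] D[OF e] by blast
    fix C assume C: "C \<in> ?S"
    show "(\<Oplus>\<^bsub>T\<^esub>\<sigma>\<in>?P. (- q) ^ perm_length r \<sigma> \<odot>\<^bsub>T\<^esub> P (?f (enum C \<circ> \<sigma>)) (?D (enum C))) =
        P (qdet W q r (\<lambda>i j. x (a i) (enum C j))) (?D (enum C))"
    proof -
      have "P (qdet W q r (\<lambda>i j. x (a i) (enum C j))) (?D (enum C)) =
          (\<Oplus>\<^bsub>T\<^esub>\<sigma>\<in>?P. P ((- q) ^ perm_length r \<sigma> \<odot>\<^bsub>W\<^esub> ?f (enum C \<circ> \<sigma>)) (?D (enum C)))"
        unfolding qdet_def[of W q r "\<lambda>i j. x (a i) (enum C j)"] comp_apply
        using W.qdet_term_closed[OF y[OF C]] by (intro P_finsum_left[OF D[OF e[OF C]]]) blast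
      also have "\<dots> = (\<Oplus>\<^bsub>T\<^esub>\<sigma>\<in>?P. (- q) ^ perm_length r \<sigma> \<odot>\<^bsub>T\<^esub> P (?f (enum C \<circ> \<sigma>)) (?D (enum C)))"
      proof (rule T.finsum_cong'[OF refl])
        have ff: "?f (enum C \<circ> \<sigma>) \<in> carrier W" if "\<sigma> permutes {1..r}" for \<sigma>
          using e[OF C] permutes_in_interval[OF that] by (intro f) auto
        show "(\<lambda>\<sigma>. (- q) ^ perm_length r \<sigma> \<odot>\<^bsub>T\<^esub> P (?f (enum C \<circ> \<sigma>)) (?D (enum C))) \<in> ?P \<rightarrow> carrier T"
          using ff D[OF e[OF C]] by blast
        show "P ((- q) ^ perm_length r \<sigma> \<odot>\<^bsub>W\<^esub> ?f (enum C \<circ> \<sigma>)) (?D (enum C)) =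
            (- q) ^ perm_length r \<sigma> \<odot>\<^bsub>T\<^esub> P (?f (enum C \<circ> \<sigma>)) (?D (enum C))" if "\<sigma> \<in> ?P" for \<sigma>
          using that by (intro P_smult_left[OF D[OF e[OF C]]] ff) simp
      qed
      finally show ?thesis ..
    qed
  qed
  finally show ?thesis .
qed

end

end

section \<open>The quantized coordinate ring\<close>

abbreviation free_qsl :: "nat \<Rightarrow> (complex, (nat \<times> nat) list \<Rightarrow>\<^sub>0 complex) module" where
  "free_qsl n \<equiv> free_alg (qsl_gens n)"

lemma var_in_free_qsl: "i \<in> {1..n+1} \<Longrightarrow> j \<in> {1..n+1} \<Longrightarrow> var (i, j) \<in> carrier (free_qsl n)"
  by (rule var_closed) (simp add: qsl_gens_def)

lemma qdet_free_qsl_closed: "qdet (free_qsl n) q (n+1) (\<lambda>i j. var (i, j)) \<in> carrier (free_qsl n)"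
  using var_in_free_qsl[of _ n] by (intro calg.qdet_closed[OF calg_free_alg]) blast

lemma presentation_qsl: "presentation (qsl_gens n) (qsl_rels q n)"
proof
  interpret F: calg "free_qsl n" by (rule calg_free_alg)
  note v = var_in_free_qsl[of _ n]
  note c = F.m_closed[OF v v]
  have d: "var (i, j) \<otimes>\<^bsub>free_qsl n\<^esub> var (k, l) - var (k, l) \<otimes>\<^bsub>free_qsl n\<^esub> var (i, j) \<in> carrier (free_qsl n)"
    if "i \<in> {1..n+1}" "j \<in> {1..n+1}" "k \<in> {1..n+1}" "l \<in> {1..n+1}" for i j k l
    unfolding free_alg_minus[OF c[OF that] c[OF that(3,4,1,2)]]
    by (intro F.minus_closed c that)
  show "qsl_rels q n \<subseteq> carrier (free_qsl n) \<times> carrier (free_qsl n)"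
    unfolding qsl_rels_def Let_def
    apply (intro Un_least subsetI)
    apply (elim CollectE exE conjE; hypsubst; intro SigmaI F.smult_closed c d F.one_closed; assumption)+
    using qdet_free_qsl_closed[of n q] by simp
qed

text \<open>An equivalence because both directions serve: the coset map respects the relations, so
  the generators form a quantum matrix; and a quantum matrix of determinant 1 respects them, so it
  defines a homomorphism.\<close>

lemma respects_qsl_rels_iff:
  assumes B: "calg B" and T: "alg_map (free_qsl n) B T"
  shows "(\<forall>(l, r)\<in>qsl_rels q n. T l = T r) \<longleftrightarrow>
    qmat B q {1..n+1} (\<lambda>i j. T (var (i, j))) \<and> qdet B q (n+1) (\<lambda>i j. T (var (i, j))) = \<one>\<^bsub>B\<^esub>"
proof -
  interpret F: calg "free_qsl n" by (rule calg_free_alg)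
  interpret B: calg B by (rule B)
  let ?N = "{1..n+1}"
  note v = var_in_free_qsl[of _ n]
  note c = F.m_closed[OF v v]
  note L = alg_mapD(1)[OF T]
  let ?y = "\<lambda>i j. T (var (i, j))"
  have m: "T (var (i, j) \<otimes>\<^bsub>free_qsl n\<^esub> var (k, l)) = ?y i j \<otimes>\<^bsub>B\<^esub> ?y k l"
    if "i \<in> ?N" "j \<in> ?N" "k \<in> ?N" "l \<in> ?N" for i j k l
    by (intro alg_mapD(3)[OF T] v that)
  have s: "T (a \<odot>\<^bsub>free_qsl n\<^esub> (var (i, j) \<otimes>\<^bsub>free_qsl n\<^esub> var (k, l))) = a \<odot>\<^bsub>B\<^esub> (?y i j \<otimes>\<^bsub>B\<^esub> ?y k l)"
    if "i \<in> ?N" "j \<in> ?N" "k \<in> ?N" "l \<in> ?N" for a i j k l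
    unfolding m[OF that, symmetric] by (intro lin_mapD(3)[OF L] c that)
  have d: "T (var (i, j) \<otimes>\<^bsub>free_qsl n\<^esub> var (k, l) - var (k, l) \<otimes>\<^bsub>free_qsl n\<^esub> var (i, j)) =
      ?y i j \<otimes>\<^bsub>B\<^esub> ?y k l \<ominus>\<^bsub>B\<^esub> ?y k l \<otimes>\<^bsub>B\<^esub> ?y i j"
    if "i \<in> ?N" "j \<in> ?N" "k \<in> ?N" "l \<in> ?N" for i j k l
    unfolding free_alg_minus[OF c[OF that] c[OF that(3,4,1,2)]] m[OF that, symmetric]
      m[OF that(3,4,1,2), symmetric]
    by (intro lin_map_minus[OF F.calg_axioms B L] c that)
  have y: "?y \<in> ?N \<rightarrow> ?N \<rightarrow> carrier B" using lin_mapD(1)[OF L v] by blast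
  have det: "T (qdet (free_qsl n) q (n+1) (\<lambda>i j. var (i, j))) = qdet B q (n+1) ?y"
    using v by (intro alg_map_qdet[OF F.calg_axioms B T]) blast
  let ?R1 = "{(var (i, j) \<otimes>\<^bsub>free_qsl n\<^esub> var (i, l), q \<odot>\<^bsub>free_qsl n\<^esub> (var (i, l) \<otimes>\<^bsub>free_qsl n\<^esub> var (i, j))) | i j l.
        i \<in> ?N \<and> j \<in> ?N \<and> l \<in> ?N \<and> j < l}"
  let ?R2 = "{(var (i, j) \<otimes>\<^bsub>free_qsl n\<^esub> var (k, j), q \<odot>\<^bsub>free_qsl n\<^esub> (var (k, j) \<otimes>\<^bsub>free_qsl n\<^esub> var (i, j))) | i j k.
        i \<in> ?N \<and> j \<in> ?N \<and> k \<in> ?N \<and> i < k}"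
  let ?R3 = "{(var (i, l) \<otimes>\<^bsub>free_qsl n\<^esub> var (k, j), var (k, j) \<otimes>\<^bsub>free_qsl n\<^esub> var (i, l)) | i j k l.
        i \<in> ?N \<and> j \<in> ?N \<and> k \<in> ?N \<and> l \<in> ?N \<and> i < k \<and> j < l}"
  let ?R4 = "{(var (i, j) \<otimes>\<^bsub>free_qsl n\<^esub> var (k, l) - var (k, l) \<otimes>\<^bsub>free_qsl n\<^esub> var (i, j),
        (q - inverse q) \<odot>\<^bsub>free_qsl n\<^esub> (var (i, l) \<otimes>\<^bsub>free_qsl n\<^esub> var (k, j))) | i j k l.
        i \<in> ?N \<and> j \<in> ?N \<and> k \<in> ?N \<and> l \<in> ?N \<and> i < k \<and> j < l}"
  have R1: "(\<forall>(l, r)\<in>?R1. T l = T r) \<longleftrightarrow>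
      (\<forall>i\<in>?N. \<forall>j\<in>?N. \<forall>l\<in>?N. j < l \<longrightarrow> ?y i j \<otimes>\<^bsub>B\<^esub> ?y i l = q \<odot>\<^bsub>B\<^esub> (?y i l \<otimes>\<^bsub>B\<^esub> ?y i j))"
    (is "?l1 \<longleftrightarrow> ?r1")
  proof -
    have "?l1 \<longleftrightarrow> (\<forall>i\<in>?N. \<forall>j\<in>?N. \<forall>l\<in>?N. j < l \<longrightarrow> T (var (i, j) \<otimes>\<^bsub>free_qsl n\<^esub> var (i, l)) =
      T (q \<odot>\<^bsub>free_qsl n\<^esub> (var (i, l) \<otimes>\<^bsub>free_qsl n\<^esub> var (i, j))))" by blast
    then show ?thesis by (simp only: m s cong: ball_cong)
  qed
  have R2: "(\<forall>(l, r)\<in>?R2. T l = T r) \<longleftrightarrow>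
      (\<forall>i\<in>?N. \<forall>j\<in>?N. \<forall>k\<in>?N. i < k \<longrightarrow> ?y i j \<otimes>\<^bsub>B\<^esub> ?y k j = q \<odot>\<^bsub>B\<^esub> (?y k j \<otimes>\<^bsub>B\<^esub> ?y i j))"
    (is "?l2 \<longleftrightarrow> ?r2")
  proof -
    have "?l2 \<longleftrightarrow> (\<forall>i\<in>?N. \<forall>j\<in>?N. \<forall>k\<in>?N. i < k \<longrightarrow> T (var (i, j) \<otimes>\<^bsub>free_qsl n\<^esub> var (k, j)) =
      T (q \<odot>\<^bsub>free_qsl n\<^esub> (var (k, j) \<otimes>\<^bsub>free_qsl n\<^esub> var (i, j))))" by blast
    then show ?thesis by (simp only: m s cong: ball_cong)
  qed
  \<comment> \<open>\<open>qmat\<close> puts these two families under one quantifier, so they are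
    translated together.\<close>
  have R34: "(\<forall>(l, r)\<in>?R3. T l = T r) \<and> (\<forall>(l, r)\<in>?R4. T l = T r) \<longleftrightarrow>
      (\<forall>i\<in>?N. \<forall>j\<in>?N. \<forall>k\<in>?N. \<forall>l\<in>?N. i < k \<longrightarrow> j < l \<longrightarrow>
      ?y i l \<otimes>\<^bsub>B\<^esub> ?y k j = ?y k j \<otimes>\<^bsub>B\<^esub> ?y i l \<and>
      ?y i j \<otimes>\<^bsub>B\<^esub> ?y k l \<ominus>\<^bsub>B\<^esub> ?y k l \<otimes>\<^bsub>B\<^esub> ?y i j = (q - inverse q) \<odot>\<^bsub>B\<^esub> (?y i l \<otimes>\<^bsub>B\<^esub> ?y k j))"
    (is "?l3 \<longleftrightarrow> ?r3")
  proof -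
    have "?l3 \<longleftrightarrow> (\<forall>i\<in>?N. \<forall>j\<in>?N. \<forall>k\<in>?N. \<forall>l\<in>?N. i < k \<longrightarrow> j < l \<longrightarrow>
      T (var (i, l) \<otimes>\<^bsub>free_qsl n\<^esub> var (k, j)) = T (var (k, j) \<otimes>\<^bsub>free_qsl n\<^esub> var (i, l)) \<and>
      T (var (i, j) \<otimes>\<^bsub>free_qsl n\<^esub> var (k, l) - var (k, l) \<otimes>\<^bsub>free_qsl n\<^esub> var (i, j)) =
        T ((q - inverse q) \<odot>\<^bsub>free_qsl n\<^esub> (var (i, l) \<otimes>\<^bsub>free_qsl n\<^esub> var (k, j))))" by blast
    then show ?thesis by (simp only: m s d cong: ball_cong)
  qed
  have "(\<forall>(l, r)\<in>qsl_rels q n. T l = T r) \<longleftrightarrow>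
      (((\<forall>(l, r)\<in>?R1. T l = T r) \<and> (\<forall>(l, r)\<in>?R2. T l = T r)) \<and>
      (\<forall>(l, r)\<in>?R3. T l = T r) \<and> (\<forall>(l, r)\<in>?R4. T l = T r)) \<and> qdet B q (n+1) ?y = \<one>\<^bsub>B\<^esub>"
    unfolding qsl_rels_def Let_def ball_Un
    by (simp only: det alg_mapD(2)[OF T] ball_simps prod.case simp_thms conj_assoc)
  then show ?thesis
    unfolding R1 R2 R34 qmat_def by (simp only: y simp_thms conj_assoc)
qed

lemma qmat_cong:
  assumes "\<And>i j. i \<in> N \<Longrightarrow> j \<in> N \<Longrightarrow> x i j = y i j"
  shows "qmat V q N x \<longleftrightarrow> qmat V q N y"
  unfolding qmat_def Pi_iff by (simp only: assms cong: ball_cong)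

lemma calg_qsl: "calg (qsl q n)"
  unfolding qsl_def by (rule presentation.calg_presented[OF presentation_qsl])

lemma qmat_qsl_x: "qmat (qsl q n) q {1..n+1} (qsl_x q n)"
  and qdet_qsl_x: "qdet (qsl q n) q (n+1) (qsl_x q n) = \<one>\<^bsub>qsl q n\<^esub>"
proof -
  interpret presentation "qsl_gens n" "qsl_rels q n" by (rule presentation_qsl)
  let ?T = "(+>\<^bsub>free_qsl n\<^esub>) (rel_ideal (qsl_gens n) (qsl_rels q n))"
  have "\<forall>(l, r)\<in>qsl_rels q n. ?T l = ?T r" using relation_holds by blast
  from this[unfolded respects_qsl_rels_iff[OF calg_presented alg_map_presented_coset]]
  show "qmat (qsl q n) q {1..n+1} (qsl_x q n)" "qdet (qsl q n) q (n+1) (qsl_x q n) = \<one>\<^bsub>qsl q n\<^esub>"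
    by (simp_all only: qsl_def qsl_x_def[abs_def] presented_gen_def simp_thms)
qed

lemma qsl_x_closed: "i \<in> {1..n+1} \<Longrightarrow> j \<in> {1..n+1} \<Longrightarrow> qsl_x q n i j \<in> carrier (qsl q n)"
  by (rule calg.qmatD(1)[OF calg_qsl qmat_qsl_x])

context
  fixes B :: "(complex, 'b) module" and q n and y :: "nat \<Rightarrow> nat \<Rightarrow> 'b"
  assumes B: "calg B" and y: "qmat B q {1..n+1} y" "qdet B q (n+1) y = \<one>\<^bsub>B\<^esub>"
begin

lemma qsl_hom:
  shows "alg_map (qsl q n) B (presented_hom B (\<lambda>(i, j). y i j))"
    and "i \<in> {1..n+1} \<Longrightarrow> j \<in> {1..n+1} \<Longrightarrow> presented_hom B (\<lambda>(i, j). y i j) (qsl_x q n i j) = y i j"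
proof -
  interpret presentation "qsl_gens n" "qsl_rels q n" by (rule presentation_qsl)
  interpret B: calg B by (rule B)
  let ?\<phi> = "\<lambda>(i, j). y i j"
  have \<phi>: "?\<phi> \<in> qsl_gens n \<rightarrow> carrier B"
    unfolding qsl_gens_def by (intro Pi_I) (simp only: split_def mem_Times_iff B.qmatD(1)[OF y(1)])
  note T = alg_map_free_hom[OF B \<phi>]
  have yv: "free_hom B ?\<phi> (var (i, j)) = y i j" if "i \<in> {1..n+1}" "j \<in> {1..n+1}" for i j
    using free_hom_var[OF B \<phi>, of "(i, j)"] that by (simp add: qsl_gens_def)
  have yc: "y \<in> {1..n+1} \<rightarrow> {1..n+1} \<rightarrow> carrier B"
    using B.qmatD(1)[OF y(1)] by blast
  have "qmat B q {1..n+1} (\<lambda>i j. free_hom B ?\<phi> (var (i, j)))"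
    by (rule iffD2[OF qmat_cong y(1)]) (rule yv)
  moreover have "qdet B q (n+1) (\<lambda>i j. free_hom B ?\<phi> (var (i, j))) = \<one>\<^bsub>B\<^esub>"
    unfolding y(2)[symmetric] using yv by (intro B.qdet_cong yc) blast
  ultimately have rels: "free_hom B ?\<phi> l = free_hom B ?\<phi> r" if "(l, r) \<in> qsl_rels q n" for l r
    using respects_qsl_rels_iff[OF B T] that by blast
  show "alg_map (qsl q n) B (presented_hom B ?\<phi>)"
    unfolding qsl_def by (rule alg_map_presented_hom[OF B \<phi> rels])
  show "presented_hom B ?\<phi> (qsl_x q n i j) = y i j" if "i \<in> {1..n+1}" "j \<in> {1..n+1}"
    using presented_hom_gen[OF B \<phi> rels, of "(i, j)"] that by (simp add: qsl_gens_def qsl_x_def)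
qed

lemma qsl_hom_minor:
  assumes "A \<subseteq> {1..n+1}" "C \<subseteq> {1..n+1}" "card A = card C"
  shows "presented_hom B (\<lambda>(i, j). y i j) (quantum_minor q n A C) =
    qdet B q (card A) (\<lambda>i j. y (enum A i) (enum C j))"
proof -
  interpret B: calg B by (rule B)
  have f: "finite A" "finite C" using assms finite_subset by blast+
  have A: "enum A i \<in> {1..n+1}" and C: "enum C i \<in> {1..n+1}" if "i \<in> {1..card A}" for i
    using enum_in[OF f(1), of i] enum_in[OF f(2), of i] assms that by auto
  have "presented_hom B (\<lambda>(i, j). y i j) (quantum_minor q n A C) =
      qdet B q (card A) (\<lambda>i j. presented_hom B (\<lambda>(i, j). y i j) (qsl_x q n (enum A i) (enum C j)))"
    unfolding quantum_minor_def enum_def[symmetric]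
    using A C qsl_x_closed by (intro alg_map_qdet[OF calg_qsl B qsl_hom(1)]) blast
  also have "\<dots> = qdet B q (card A) (\<lambda>i j. y (enum A i) (enum C j))"
    using A C qsl_hom(2) B.qmatD(1)[OF y(1)] by (intro B.qdet_cong) blast+
  finally show ?thesis .
qed

end

lemma quantum_minor_closed:
  assumes "A \<subseteq> {1..n+1}" "C \<subseteq> {1..n+1}" "card A = card C"
  shows "quantum_minor q n A C \<in> carrier (qsl q n)"
proof -
  have f: "finite A" "finite C" using assms finite_subset by blast+
  have A: "enum A i \<in> {1..n+1}" and C: "enum C i \<in> {1..n+1}" if "i \<in> {1..card A}" for i
    using enum_in[OF f(1), of i] enum_in[OF f(2), of i] assms that by auto
  show ?thesis
    unfolding quantum_minor_def enum_def[symmetric]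
    using A C qsl_x_closed by (intro calg.qdet_closed[OF calg_qsl]) blast
qed

section \<open>Linear maps on tensor powers\<close>

context calg
begin

text \<open>Every element is the class of a finite combination of tuples, so pure tensors span.
  Needed for lifted maps, whose values are explicit on pure tensors only.\<close>

lemma tensor_power_induct [consumes 1, case_names pure smult add]:
  assumes z: "z \<in> carrier (tensor_power V m)"
    and pure: "\<And>u. length u = m \<Longrightarrow> set u \<subseteq> carrier V \<Longrightarrow> Q (pure_tensor V u)"
    and smult: "\<And>c x. x \<in> carrier (tensor_power V m) \<Longrightarrow> Q x \<Longrightarrow> Q (c \<odot>\<^bsub>tensor_power V m\<^esub> x)"
    and add: "\<And>x y. x \<in> carrier (tensor_power V m) \<Longrightarrow> y \<in> carrier (tensor_power V m) \<Longrightarrow>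
      Q x \<Longrightarrow> Q y \<Longrightarrow> Q (x \<oplus>\<^bsub>tensor_power V m\<^esub> y)"
  shows "Q z"
proof -
  interpret T: basis_monoid "tuple_monoid V m" by (rule basis_monoid_tuple_monoid)
  interpret I: calg_ideal "monoid_alg (tuple_monoid V m)" "tensor_ideal V m" by (rule calg_ideal_tensor_ideal)
  let ?\<pi> = "(+>\<^bsub>monoid_alg (tuple_monoid V m)\<^esub>) (tensor_ideal V m)"
  have \<pi>: "?\<pi> f \<in> carrier (tensor_power V m)" if "f \<in> carrier (monoid_alg (tuple_monoid V m))" for f
    unfolding tensor_power_def I.alg_quot_simps using that by blast
  obtain f where f: "f \<in> carrier (monoid_alg (tuple_monoid V m))" "z = ?\<pi> f"
    using z unfolding tensor_power_def I.alg_quot_simps by blast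
  have "Q (?\<pi> f)" using f(1)
  proof (induction f rule: T.monoid_alg_induct)
    case (single u c)
    have u: "length u = m" "set u \<subseteq> carrier V" using single by simp_all
    have "?\<pi> (Poly_Mapping.single u c) = c \<odot>\<^bsub>tensor_power V m\<^esub> pure_tensor V u"
      using I.alg_quot_smult[OF T.single_in_monoid_alg[OF single, of 1], of c] u(1)
      by (simp add: tensor_power_def pure_tensor_def)
    then show ?case using smult[OF pure_tensor_closed[OF u(2,1)] pure[OF u]] by simp
  next
    case (add f g)
    have "?\<pi> (f \<oplus>\<^bsub>monoid_alg (tuple_monoid V m)\<^esub> g) = ?\<pi> f \<oplus>\<^bsub>tensor_power V m\<^esub> ?\<pi> g"
      unfolding tensor_power_def by (rule I.alg_quot_simps(4)[OF add(1,2), symmetric])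
    then show ?case using assms(4)[OF \<pi>[OF add(1)] \<pi>[OF add(2)] add(3,4)] by simp
  qed
  then show ?thesis using f(2) by simp
qed

lemma pure_tensor_zero:
  assumes "set u \<subseteq> carrier V" "length u = m" "\<zero> \<in> set u"
  shows "pure_tensor V u = \<zero>\<^bsub>tensor_power V m\<^esub>"
proof -
  interpret T: calg "tensor_power V m" by (rule calg_tensor_power)
  obtain k where k: "k < m" "u ! k = \<zero>" using assms by (auto simp: in_set_conv_nth)
  \<comment> \<open>The tuple is written with the same entry in two ways, so that homogeneity in
    slot \<open>k\<close> extracts the scalar 0.\<close>
  have u: "u[k := 0 \<odot> \<zero>] = u" "u[k := \<zero>] = u" using k(2) list_update_id[of u k] by simp_all
  show ?thesis
    using multilinD(3)[OF multilin_pure_tensor assms(2,1) k(1) zero_closed, of 0] pure_tensor_closed[OF assms(1,2)]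
    unfolding u by simp
qed

lemma tensor_pairing_pure_tensor: "tensor_pairing V (tensor_power V 2) (\<lambda>a b. pure_tensor V [a, b])"
proof -
  interpret T: calg "tensor_power V 2" by (rule calg_tensor_power)
  note M = multilin_pure_tensor[of 2]
  have cl: "pure_tensor V [a, b] \<in> carrier (tensor_power V 2)" if "a \<in> carrier V" "b \<in> carrier V" for a b
    using that by (intro pure_tensor_closed) auto
  have "lin_map V (tensor_power V 2) (\<lambda>a. pure_tensor V [a, b])" if b: "b \<in> carrier V" for b
  proof (rule lin_mapI)
    show "pure_tensor V [a, b] \<in> carrier (tensor_power V 2)" if "a \<in> carrier V" for a
      using that b by (rule cl)
    show "pure_tensor V [a \<oplus> a', b] = pure_tensor V [a, b] \<oplus>\<^bsub>tensor_power V 2\<^esub> pure_tensor V [a', b]"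
      if "a \<in> carrier V" "a' \<in> carrier V" for a a'
      using multilinD(2)[OF M, of "[a, b]" 0 a a'] that b by simp
    show "pure_tensor V [c \<odot> a, b] = c \<odot>\<^bsub>tensor_power V 2\<^esub> pure_tensor V [a, b]" if "a \<in> carrier V" for a c
      using multilinD(3)[OF M, of "[a, b]" 0 a c] that b by simp
  qed
  moreover have "lin_map V (tensor_power V 2) (\<lambda>b. pure_tensor V [a, b])" if a: "a \<in> carrier V" for a
  proof (rule lin_mapI)
    show "pure_tensor V [a, b] \<in> carrier (tensor_power V 2)" if "b \<in> carrier V" for b
      using a that by (rule cl)
    show "pure_tensor V [a, b \<oplus> b'] = pure_tensor V [a, b] \<oplus>\<^bsub>tensor_power V 2\<^esub> pure_tensor V [a, b']"
      if "b \<in> carrier V" "b' \<in> carrier V" for b b'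
      using multilinD(2)[OF M, of "[a, b]" 1 b b'] that a by simp
    show "pure_tensor V [a, c \<odot> b] = c \<odot>\<^bsub>tensor_power V 2\<^esub> pure_tensor V [a, b]" if "b \<in> carrier V" for b c
      using multilinD(3)[OF M, of "[a, b]" 1 b c] that a by simp
  qed
  moreover have "pure_tensor V [\<one>, \<one>] = \<one>\<^bsub>tensor_power V 2\<^esub>"
    by (simp add: pure_tensor_one numeral_2_eq_2)
  moreover have "pure_tensor V [a, b] \<otimes>\<^bsub>tensor_power V 2\<^esub> pure_tensor V [a', b'] = pure_tensor V [a \<otimes> a', b \<otimes> b']"
    if "a \<in> carrier V" "b \<in> carrier V" "a' \<in> carrier V" "b' \<in> carrier V" for a b a' b'
    using that by (subst pure_tensor_mult) auto
  ultimately show ?thesis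
    by (intro tensor_pairing.intro tensor_pairing_axioms.intro calg_axioms T.calg_axioms)
qed

end

lemma
  assumes A: "calg A" and B: "calg B" and fs: "\<And>f. f \<in> set fs \<Longrightarrow> lin_map A B f" and m: "length fs = m"
  shows lin_map_tensor_map: "lin_map (tensor_power A m) (tensor_power B m) (tensor_map B fs)"
    and tensor_map_pure: "length u = m \<Longrightarrow> set u \<subseteq> carrier A \<Longrightarrow>
      tensor_map B fs (pure_tensor A u) = pure_tensor B (map2 (\<lambda>f a. f a) fs u)"
proof -
  interpret A: calg A by (rule A)
  interpret B: calg B by (rule B)
  have len: "length (map2 (\<lambda>f a. f a) fs u) = m" and st: "set (map2 (\<lambda>f a. f a) fs u) \<subseteq> carrier B"
    if "length u = m" "set u \<subseteq> carrier A" for u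
  proof -
    show "length (map2 (\<lambda>f a. f a) fs u) = m" using that m by simp
    have "(fs ! i) (u ! i) \<in> carrier B" if "i < m" for i
    proof -
      have "u ! i \<in> carrier A" using that \<open>length u = m\<close> \<open>set u \<subseteq> carrier A\<close> nth_mem by blast
      then show ?thesis using lin_mapD(1)[OF fs[OF nth_mem]] that m by blast
    qed
    then show "set (map2 (\<lambda>f a. f a) fs u) \<subseteq> carrier B" using m that by (auto simp: set_zip)
  qed
  have F: "multilin A m (tensor_power B m) (\<lambda>u. pure_tensor B (map2 (\<lambda>f a. f a) fs u))"
  proof (rule multilinI)
    fix u assume u: "length u = m" "set u \<subseteq> carrier A"
    show "pure_tensor B (map2 (\<lambda>f a. f a) fs u) \<in> carrier (tensor_power B m)"
      by (rule B.pure_tensor_closed[OF st[OF u] len[OF u]])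
    fix k assume k: "k < m"
    note L = lin_mapD[OF fs[OF nth_mem[of k fs]], unfolded m, OF k]
    have upd: "map2 (\<lambda>f a. f a) fs (u[k := a]) = (map2 (\<lambda>f a. f a) fs u)[k := (fs ! k) a]" for a
      using map2_list_update(2)[of fs u k "\<lambda>f a. f a" a] u k m by simp
    note M = multilinD[OF B.multilin_pure_tensor len[OF u] st[OF u]]
    show "pure_tensor B (map2 (\<lambda>f a. f a) fs (u[k := a \<oplus>\<^bsub>A\<^esub> b])) =
      pure_tensor B (map2 (\<lambda>f a. f a) fs (u[k := a])) \<oplus>\<^bsub>tensor_power B m\<^esub>
      pure_tensor B (map2 (\<lambda>f a. f a) fs (u[k := b]))" if "a \<in> carrier A" "b \<in> carrier A" for a b
      unfolding upd L(2)[OF that] by (rule M(2)[OF k L(1)[OF that(1)] L(1)[OF that(2)]])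
    show "pure_tensor B (map2 (\<lambda>f a. f a) fs (u[k := c \<odot>\<^bsub>A\<^esub> a])) =
      c \<odot>\<^bsub>tensor_power B m\<^esub> pure_tensor B (map2 (\<lambda>f a. f a) fs (u[k := a]))" if "a \<in> carrier A" for a c
      unfolding upd L(3)[OF that] by (rule M(3)[OF k L(1)[OF that]])
  qed
  show "lin_map (tensor_power A m) (tensor_power B m) (tensor_map B fs)"
    unfolding tensor_map_def m by (rule lin_map_tensor_lift[OF A B.calg_tensor_power F])
  show "tensor_map B fs (pure_tensor A u) = pure_tensor B (map2 (\<lambda>f a. f a) fs u)"
    if "length u = m" "set u \<subseteq> carrier A"
    unfolding tensor_map_def m by (rule tensor_lift_pure[OF A B.calg_tensor_power F that])
qed

section \<open>The iterated comultiplication of a quantum minor\<close>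

lemma strict_mono_on_id: "strict_mono_on S (\<lambda>i. i)"
  by (simp add: strict_mono_on_def)

context
  fixes q :: complex and n :: nat
  assumes q: "q \<noteq> 0"
begin

text \<open>In this context \<open>W\<close> stands for the coordinate ring and \<open>T\<close> for
  its tensor square.\<close>

interpretation tensor_pairing "qsl q n" "tensor_power (qsl q n) 2" "\<lambda>a b. pure_tensor (qsl q n) [a, b]"
  by (rule calg.tensor_pairing_pure_tensor[OF calg_qsl])

text \<open>Cauchy-Binet for the full matrix gives the tensor product of two determinants equal to
  1. This is the remaining relation that the comultiplication has to respect.\<close>

lemma qdet_coprod_qsl: "qdet (tensor_power (qsl q n) 2) q (n+1) (coprod {1..n+1} (qsl_x q n)) =
  \<one>\<^bsub>tensor_power (qsl q n) 2\<^esub>"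
proof -
  let ?N = "{1..n+1}"
  \<comment> \<open>Only one index set has the full size, so the Cauchy-Binet sum has a single
    term.\<close>
  have "C = ?N" if "C \<subseteq> ?N" "card C = n + 1" for C
    using that by (intro card_subset_eq) auto
  then have S: "{C. C \<subseteq> ?N \<and> card C = n + 1} = {?N}" by auto
  have e: "qdet (qsl q n) q (n+1) (\<lambda>i j. qsl_x q n i (enum ?N j)) = \<one>\<^bsub>qsl q n\<^esub>"
    "qdet (qsl q n) q (n+1) (\<lambda>i j. qsl_x q n (enum ?N i) j) = \<one>\<^bsub>qsl q n\<^esub>"
    using qsl_x_closed unfolding qdet_qsl_x[symmetric]
    by (intro W.qdet_cong; simp only: enum_interval; blast)+
  let ?p = "\<lambda>C. pure_tensor (qsl q n) [qdet (qsl q n) q (n+1) (\<lambda>i j. qsl_x q n i (enum C j)),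
    qdet (qsl q n) q (n+1) (\<lambda>i j. qsl_x q n (enum C i) j)]"
  have p: "?p ?N = \<one>\<^bsub>tensor_power (qsl q n) 2\<^esub>" unfolding e by (rule P_one)
  have "qdet (tensor_power (qsl q n) 2) q (n+1) (coprod ?N (qsl_x q n)) =
      (\<Oplus>\<^bsub>tensor_power (qsl q n) 2\<^esub>C\<in>{?N}. ?p C)"
    unfolding S[symmetric]
    by (rule qdet_coprod[OF q _ qmat_qsl_x _ _ strict_mono_on_id]) auto
  also have "\<dots> = ?p ?N"
    using T.finsum_insert[of "{}" ?N ?p] p T.one_closed by simp
  finally show ?thesis unfolding p .
qed

lemma comult_eq: "comult q n = presented_hom (tensor_power (qsl q n) 2)
    (\<lambda>(i, j). coprod {1..n+1} (qsl_x q n) i j)"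
  unfolding comult_def coprod_def by (rule refl)

lemma lin_map_comult: "lin_map (qsl q n) (tensor_power (qsl q n) 2) (comult q n)"
  unfolding comult_eq
  by (rule alg_mapD(1)[OF qsl_hom(1)[OF T.calg_axioms qmat_coprod[OF q _ qmat_qsl_x] qdet_coprod_qsl]]) simp

lemma comult_minor:
  assumes "A \<subseteq> {1..n+1}" "B \<subseteq> {1..n+1}" "card A = card B"
  shows "comult q n (quantum_minor q n A B) =
    (\<Oplus>\<^bsub>tensor_power (qsl q n) 2\<^esub>C\<in>{C. C \<subseteq> {1..n+1} \<and> card C = card A}.
      pure_tensor (qsl q n) [quantum_minor q n A C, quantum_minor q n C B])"
proof -
  have f: "finite A" "finite B" using assms finite_subset by blast+
  have "comult q n (quantum_minor q n A B) =
      qdet (tensor_power (qsl q n) 2) q (card A) (\<lambda>i j. coprod {1..n+1} (qsl_x q n) (enum A i) (enum B j))"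
    unfolding comult_eq
    by (rule qsl_hom_minor[OF T.calg_axioms qmat_coprod[OF q _ qmat_qsl_x] qdet_coprod_qsl assms]) simp
  also have "\<dots> = (\<Oplus>\<^bsub>tensor_power (qsl q n) 2\<^esub>C\<in>{C. C \<subseteq> {1..n+1} \<and> card C = card A}.
      pure_tensor (qsl q n) [qdet (qsl q n) q (card A) (\<lambda>i j. qsl_x q n (enum A i) (enum C j)),
        qdet (qsl q n) q (card A) (\<lambda>i j. qsl_x q n (enum C i) (enum B j))])"
    using enum_funcset[OF f(1) assms(1)] enum_funcset[OF f(2) assms(2)] strict_mono_on_enum[OF f(2)] assms(3)
    by (intro qdet_coprod[OF q _ qmat_qsl_x]) simp_all
  also have "\<dots> = (\<Oplus>\<^bsub>tensor_power (qsl q n) 2\<^esub>C\<in>{C. C \<subseteq> {1..n+1} \<and> card C = card A}.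
      pure_tensor (qsl q n) [quantum_minor q n A C, quantum_minor q n C B])"
  proof (rule T.finsum_cong'[OF refl])
    show "(\<lambda>C. pure_tensor (qsl q n) [quantum_minor q n A C, quantum_minor q n C B])
        \<in> {C. C \<subseteq> {1..n+1} \<and> card C = card A} \<rightarrow> carrier (tensor_power (qsl q n) 2)"
      using assms by (intro Pi_I P_closed quantum_minor_closed) simp_all
    fix C assume "C \<in> {C. C \<subseteq> {1..n+1} \<and> card C = card A}"
    then have "card C = card A" by simp
    then show "pure_tensor (qsl q n) [qdet (qsl q n) q (card A) (\<lambda>i j. qsl_x q n (enum A i) (enum C j)),
        qdet (qsl q n) q (card A) (\<lambda>i j. qsl_x q n (enum C i) (enum B j))] =
      pure_tensor (qsl q n) [quantum_minor q n A C, quantum_minor q n C B]"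
      by (simp only: quantum_minor_def enum_def)
  qed
  finally show ?thesis .
qed

text \<open>Multilinearity in the two new entries makes the inner \<open>induced_lin\<close> of
  \<open>comult_first\<close> well defined on the tensor square.\<close>

lemma multilin_append:
  assumes w: "set w \<subseteq> carrier (qsl q n)" "length w = m"
  shows "multilin (qsl q n) 2 (tensor_power (qsl q n) (Suc (Suc m))) (\<lambda>v. pure_tensor (qsl q n) (v @ w))"
proof (rule multilinI)
  fix u assume u: "length u = 2" "set u \<subseteq> carrier (qsl q n)"
  have uw: "length (u @ w) = Suc (Suc m)" "set (u @ w) \<subseteq> carrier (qsl q n)" using u w by auto
  show "pure_tensor (qsl q n) (u @ w) \<in> carrier (tensor_power (qsl q n) (Suc (Suc m)))"
    by (rule W.pure_tensor_closed[OF uw(2,1)])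
  fix k :: nat assume k: "k < 2"
  then have upd: "u[k := a] @ w = (u @ w)[k := a]" for a using u by (simp add: list_update_append)
  note M = multilinD[OF W.multilin_pure_tensor uw]
  show "pure_tensor (qsl q n) (u[k := a \<oplus>\<^bsub>qsl q n\<^esub> b] @ w) =
    pure_tensor (qsl q n) (u[k := a] @ w) \<oplus>\<^bsub>tensor_power (qsl q n) (Suc (Suc m))\<^esub>
    pure_tensor (qsl q n) (u[k := b] @ w)" if "a \<in> carrier (qsl q n)" "b \<in> carrier (qsl q n)" for a b
    unfolding upd using k by (intro M(2) that) simp
  show "pure_tensor (qsl q n) (u[k := c \<odot>\<^bsub>qsl q n\<^esub> a] @ w) =
    c \<odot>\<^bsub>tensor_power (qsl q n) (Suc (Suc m))\<^esub> pure_tensor (qsl q n) (u[k := a] @ w)"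
    if "a \<in> carrier (qsl q n)" for a c
    unfolding upd using k by (intro M(3) that) simp
qed

abbreviation append_tensor :: "nat \<Rightarrow> qsl_elem list \<Rightarrow> (qsl_elem list \<Rightarrow>\<^sub>0 complex) set \<Rightarrow> (qsl_elem list \<Rightarrow>\<^sub>0 complex) set"
  where "append_tensor m w \<equiv>
    induced_lin (tensor_power (qsl q n) (Suc (Suc m))) (\<lambda>v. pure_tensor (qsl q n) (v @ w))"

lemma
  assumes w: "set w \<subseteq> carrier (qsl q n)" "length w = m"
  shows lin_map_append_tensor:
      "lin_map (tensor_power (qsl q n) 2) (tensor_power (qsl q n) (Suc (Suc m))) (append_tensor m w)"
    and append_tensor_pure: "length u = 2 \<Longrightarrow> set u \<subseteq> carrier (qsl q n) \<Longrightarrow>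
      append_tensor m w (pure_tensor (qsl q n) u) = pure_tensor (qsl q n) (u @ w)"
  by (rule lin_map_tensor_lift tensor_lift_pure, rule calg_qsl, rule W.calg_tensor_power,
      rule multilin_append[OF w]; assumption)+

text \<open>\<open>append_tensor\<close> is explicit on pure tensors only, so the slot conditions
  are carried to a general \<open>z\<close> by linearity. On a pure tensor, slot \<open>k\<close> of
  \<open>w\<close> is slot \<open>k + 2\<close> of the result.\<close>

lemma append_tensor_multilin:
  assumes z: "z \<in> carrier (tensor_power (qsl q n) 2)"
  shows "multilin (qsl q n) m (tensor_power (qsl q n) (Suc (Suc m))) (\<lambda>w. append_tensor m w z)"
proof (rule multilinI)
  interpret T': calg "tensor_power (qsl q n) (Suc (Suc m))" by (rule W.calg_tensor_power)
  fix w assume w: "length w = m" "set w \<subseteq> carrier (qsl q n)"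
  note L = lin_mapD[OF lin_map_append_tensor]
  show "append_tensor m w z \<in> carrier (tensor_power (qsl q n) (Suc (Suc m)))"
    by (rule L(1)[OF w(2,1) z])
  fix k assume k: "k < m"
  have wk: "set (w[k := a]) \<subseteq> carrier (qsl q n)" "length (w[k := a]) = m" if "a \<in> carrier (qsl q n)" for a
    using W.set_list_update[OF w(2) that] w(1) by simp_all
  have upd: "u @ w[k := a] = (u @ w)[Suc (Suc k) := a]" if "length u = 2" for u and a :: qsl_elem
    using that by (simp add: list_update_append)
  show "append_tensor m (w[k := a \<oplus>\<^bsub>qsl q n\<^esub> b]) z =
    append_tensor m (w[k := a]) z \<oplus>\<^bsub>tensor_power (qsl q n) (Suc (Suc m))\<^esub> append_tensor m (w[k := b]) z"
    if ab: "a \<in> carrier (qsl q n)" "b \<in> carrier (qsl q n)" for a b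
    using z
  proof (induction z rule: W.tensor_power_induct)
    case (pure u)
    have uw: "length (u @ w) = Suc (Suc m)" "set (u @ w) \<subseteq> carrier (qsl q n)" using pure w by auto
    show ?case
      unfolding append_tensor_pure[OF wk[OF W.a_closed[OF ab]] pure] append_tensor_pure[OF wk[OF ab(1)] pure]
        append_tensor_pure[OF wk[OF ab(2)] pure] upd[OF pure(1)]
      using k by (intro multilinD(2)[OF W.multilin_pure_tensor uw] ab) simp
  next
    case (smult c x)
    note cl = L(1)[OF wk[OF ab(1)] smult(1)] L(1)[OF wk[OF ab(2)] smult(1)]
    show ?case
      unfolding L(3)[OF wk[OF W.a_closed[OF ab]] smult(1)] L(3)[OF wk[OF ab(1)] smult(1)]
        L(3)[OF wk[OF ab(2)] smult(1)] smult(2)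
      by (rule T'.smult_add_right[OF cl])
  next
    case (add x y)
    note cl = L(1)[OF wk[OF ab(1)] add(1)] L(1)[OF wk[OF ab(2)] add(1)]
      L(1)[OF wk[OF ab(1)] add(2)] L(1)[OF wk[OF ab(2)] add(2)]
    show ?case
      unfolding L(2)[OF wk[OF W.a_closed[OF ab]] add(1,2)] L(2)[OF wk[OF ab(1)] add(1,2)]
        L(2)[OF wk[OF ab(2)] add(1,2)] add(3,4)
      using cl by (simp add: T'.a_ac)
  qed
  show "append_tensor m (w[k := c \<odot>\<^bsub>qsl q n\<^esub> a]) z =
    c \<odot>\<^bsub>tensor_power (qsl q n) (Suc (Suc m))\<^esub> append_tensor m (w[k := a]) z"
    if a: "a \<in> carrier (qsl q n)" for a c
    using z
  proof (induction z rule: W.tensor_power_induct)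
    case (pure u)
    have uw: "length (u @ w) = Suc (Suc m)" "set (u @ w) \<subseteq> carrier (qsl q n)" using pure w by auto
    show ?case
      unfolding append_tensor_pure[OF wk[OF W.smult_closed[OF a]] pure] append_tensor_pure[OF wk[OF a] pure]
        upd[OF pure(1)]
      using k by (intro multilinD(3)[OF W.multilin_pure_tensor uw] a) simp
  next
    case (smult d x)
    show ?case
      unfolding L(3)[OF wk[OF W.smult_closed[OF a]] smult(1)] L(3)[OF wk[OF a] smult(1)] smult(2)
      by (simp add: T'.smult_smult L(1)[OF wk[OF a] smult(1)] mult.commute)
  next
    case (add x y)
    show ?case
      unfolding L(2)[OF wk[OF W.smult_closed[OF a]] add(1,2)] L(2)[OF wk[OF a] add(1,2)] add(3,4)
      by (rule T'.smult_add_right[OF L(1)[OF wk[OF a] add(1)] L(1)[OF wk[OF a] add(2)], symmetric])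
  qed
qed

text \<open>In slot 0 linearity is that of the comultiplication followed by appending the tail; in
  the other slots it is linearity in the tail. So the outer lift of \<open>comult_first\<close> is
  well defined as well.\<close>

lemma multilin_comult_first:
  "multilin (qsl q n) (Suc m) (tensor_power (qsl q n) (Suc (Suc m)))
    (\<lambda>u. append_tensor m (tl u) (comult q n (hd u)))"
proof (rule multilinI)
  note L = lin_mapD[OF lin_map_append_tensor]
  note C = lin_mapD[OF lin_map_comult]
  fix u assume "length u = Suc m" and su: "set u \<subseteq> carrier (qsl q n)"
  then obtain a w where u: "u = a # w" and lw: "length w = m" by (cases u) auto
  have a: "a \<in> carrier (qsl q n)" and w: "set w \<subseteq> carrier (qsl q n)" using su u by auto
  show "append_tensor m (tl u) (comult q n (hd u)) \<in> carrier (tensor_power (qsl q n) (Suc (Suc m)))"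
    unfolding u list.sel by (rule L(1)[OF w lw C(1)[OF a]])
  fix k assume k: "k < Suc m"
  show "append_tensor m (tl (u[k := b \<oplus>\<^bsub>qsl q n\<^esub> c])) (comult q n (hd (u[k := b \<oplus>\<^bsub>qsl q n\<^esub> c]))) =
    append_tensor m (tl (u[k := b])) (comult q n (hd (u[k := b])))
    \<oplus>\<^bsub>tensor_power (qsl q n) (Suc (Suc m))\<^esub> append_tensor m (tl (u[k := c])) (comult q n (hd (u[k := c])))"
    if bc: "b \<in> carrier (qsl q n)" "c \<in> carrier (qsl q n)" for b c
  proof (cases k)
    case 0
    then show ?thesis using L(2)[OF w lw C(1)[OF bc(1)] C(1)[OF bc(2)]] by (simp add: u C(2)[OF bc])
  next
    case (Suc k')
    then show ?thesis
      using multilinD(2)[OF append_tensor_multilin[OF C(1)[OF a]] lw w _ bc] k by (simp add: u)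
  qed
  show "append_tensor m (tl (u[k := c \<odot>\<^bsub>qsl q n\<^esub> b])) (comult q n (hd (u[k := c \<odot>\<^bsub>qsl q n\<^esub> b]))) =
    c \<odot>\<^bsub>tensor_power (qsl q n) (Suc (Suc m))\<^esub> append_tensor m (tl (u[k := b])) (comult q n (hd (u[k := b])))"
    if b: "b \<in> carrier (qsl q n)" for b c
  proof (cases k)
    case 0
    then show ?thesis using L(3)[OF w lw C(1)[OF b]] by (simp add: u C(3)[OF b])
  next
    case (Suc k')
    then show ?thesis
      using multilinD(3)[OF append_tensor_multilin[OF C(1)[OF a]] lw w _ b] k by (simp add: u)
  qed
qed

lemma lin_map_comult_first:
  "lin_map (tensor_power (qsl q n) (Suc m)) (tensor_power (qsl q n) (Suc (Suc m))) (comult_first q n (Suc m))"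
  unfolding comult_first_def
  by (rule lin_map_tensor_lift[OF calg_qsl W.calg_tensor_power multilin_comult_first])

lemma comult_first_pure:
  assumes "set (a # w) \<subseteq> carrier (qsl q n)" "length w = m"
  shows "comult_first q n (Suc m) (pure_tensor (qsl q n) (a # w)) = append_tensor m w (comult q n a)"
  unfolding comult_first_def
  using tensor_lift_pure[OF calg_qsl W.calg_tensor_power multilin_comult_first, of "a # w" m] assms
  by simp

end

text \<open>There are \<open>m + 1\<close> index sets around \<open>m\<close> tensor factors. Entry
  \<open>k\<close> is a summation index of the iterated Cauchy-Binet formula and later the set of
  levels met in column \<open>k\<close>.\<close>

definition chains :: "nat \<Rightarrow> nat \<Rightarrow> nat set \<Rightarrow> nat set \<Rightarrow> nat set list set" where
  "chains n m A B = {Cs. length Cs = Suc m \<and> hd Cs = A \<and> last Cs = B \<and>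
    (\<forall>C\<in>set Cs. C \<subseteq> {1..n+1} \<and> card C = card A)}"

lemma finite_chains: "finite (chains n m A B)"
proof (rule finite_subset)
  show "chains n m A B \<subseteq> {Cs. set Cs \<subseteq> Pow {1..n+1} \<and> length Cs = Suc m}"
    by (auto simp: chains_def)
  show "finite {Cs. set Cs \<subseteq> Pow {1..n+1} \<and> length Cs = Suc m}"
    by (intro finite_lists_length_eq) simp
qed

lemma chains_Suc_iff:
  "Cs \<in> chains n (Suc m) A B \<longleftrightarrow> (\<exists>D Ds. Cs = A # D # Ds \<and> D # Ds \<in> chains n m D B \<and>
    A \<subseteq> {1..n+1} \<and> card D = card A)"
proof
  assume c: "Cs \<in> chains n (Suc m) A B"
  then obtain D Ds where Cs: "Cs = A # D # Ds"
    unfolding chains_def by (cases Cs; cases "tl Cs") auto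
  with c show "\<exists>D Ds. Cs = A # D # Ds \<and> D # Ds \<in> chains n m D B \<and> A \<subseteq> {1..n+1} \<and> card D = card A"
    by (auto simp: chains_def)
next
  assume "\<exists>D Ds. Cs = A # D # Ds \<and> D # Ds \<in> chains n m D B \<and> A \<subseteq> {1..n+1} \<and> card D = card A"
  then obtain D Ds where "Cs = A # D # Ds" "D # Ds \<in> chains n m D B" "A \<subseteq> {1..n+1}" "card D = card A"
    by blast
  then show "Cs \<in> chains n (Suc m) A B" by (simp add: chains_def)
qed

lemma chains_1: "A \<subseteq> {1..n+1} \<Longrightarrow> B \<subseteq> {1..n+1} \<Longrightarrow> card A = card B \<Longrightarrow>
    chains n (Suc 0) A B = {[A, B]}"
proof (intro equalityI subsetI)
  fix Cs assume "Cs \<in> chains n (Suc 0) A B"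
  then obtain D Ds where D: "Cs = A # D # Ds" "D # Ds \<in> chains n 0 D B"
    unfolding chains_Suc_iff by blast
  from D(2) have "Ds = []" by (simp add: chains_def)
  with D show "Cs \<in> {[A, B]}" by (simp add: chains_def)
qed (simp add: chains_def)

text \<open>Mirrors \<open>comult_first\<close>: splitting the first minor inserts a new index set
  right after \<open>A\<close>.\<close>

lemma chains_refine:
  assumes A: "A \<subseteq> {1..n+1}"
  shows "bij_betw (\<lambda>(Cs, C). A # C # tl Cs)
    (chains n (Suc m) A B \<times> {C. C \<subseteq> {1..n+1} \<and> card C = card A}) (chains n (Suc (Suc m)) A B)"
proof (rule bij_betwI[where g = "\<lambda>Cs. (A # tl (tl Cs), hd (tl Cs))"])
  let ?S = "{C. C \<subseteq> {1..n+1} \<and> card C = card A}"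
  show "(\<lambda>(Cs, C). A # C # tl Cs) \<in> chains n (Suc m) A B \<times> ?S \<rightarrow> chains n (Suc (Suc m)) A B"
  proof (clarify)
    fix Cs C assume "Cs \<in> chains n (Suc m) A B" "C \<subseteq> {1..n+1}" "card C = card A"
    moreover from this obtain D Ds where "Cs = A # D # Ds" "D # Ds \<in> chains n m D B" "card D = card A"
      unfolding chains_Suc_iff by blast
    ultimately show "A # C # tl Cs \<in> chains n (Suc (Suc m)) A B"
      using A by (simp add: chains_def)
  qed
  show "(\<lambda>Cs. (A # tl (tl Cs), hd (tl Cs))) \<in> chains n (Suc (Suc m)) A B \<rightarrow> chains n (Suc m) A B \<times> ?S"
  proof
    fix Cs assume "Cs \<in> chains n (Suc (Suc m)) A B"
    then obtain D E Es where "Cs = A # D # E # Es" "E # Es \<in> chains n m E B" "card E = card D"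
      "D \<subseteq> {1..n+1}" "card D = card A"
      unfolding chains_Suc_iff by auto
    then show "(A # tl (tl Cs), hd (tl Cs)) \<in> chains n (Suc m) A B \<times> ?S"
      using A by (simp add: chains_def)
  qed
  fix p assume "p \<in> chains n (Suc m) A B \<times> ?S"
  then show "(A # tl (tl ((\<lambda>(Cs, C). A # C # tl Cs) p)), hd (tl ((\<lambda>(Cs, C). A # C # tl Cs) p))) = p"
    using chains_Suc_iff[of "fst p" n m A B] by (cases p) auto
next
  fix Cs assume "Cs \<in> chains n (Suc (Suc m)) A B"
  then show "(\<lambda>(Cs, C). A # C # tl Cs) (A # tl (tl Cs), hd (tl Cs)) = Cs"
    unfolding chains_Suc_iff by auto
qed

text \<open>\<open>map2\<close> stops with the shorter list, so \<open>m + 1\<close> sets give the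
  \<open>m\<close> minors of neighbouring sets.\<close>

definition minors :: "complex \<Rightarrow> nat \<Rightarrow> nat set list \<Rightarrow> qsl_elem list" where
  "minors q n Cs = map2 (quantum_minor q n) Cs (tl Cs)"

lemma minors_closed: "Cs \<in> chains n m A B \<Longrightarrow> set (minors q n Cs) \<subseteq> carrier (qsl q n)"
  and length_minors: "Cs \<in> chains n m A B \<Longrightarrow> length (minors q n Cs) = m"
proof -
  assume Cs: "Cs \<in> chains n m A B"
  have "quantum_minor q n C D \<in> carrier (qsl q n)" if "(C, D) \<in> set (zip Cs (tl Cs))" for C D
  proof (rule quantum_minor_closed)
    have C: "C \<in> set Cs" "D \<in> set Cs"
      using set_zip_leftD[OF that] set_zip_rightD[OF that] list.set_sel(2)[of Cs] by (cases Cs; auto)+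
    then show "C \<subseteq> {1..n+1}" "D \<subseteq> {1..n+1}" "card C = card D"
      using Cs unfolding chains_def by auto
  qed
  then show "set (minors q n Cs) \<subseteq> carrier (qsl q n)" unfolding minors_def by auto
  show "length (minors q n Cs) = m" using Cs by (simp add: minors_def chains_def)
qed

text \<open>Stated from one tensor factor on, since zero factors mean the counit. Each further
  comultiplication expands the first minor by Cauchy-Binet and leaves the others alone.\<close>

lemma iter_comult_minor:
  assumes q: "q \<noteq> 0" and A: "A \<subseteq> {1..n+1}" and B: "B \<subseteq> {1..n+1}" and AB: "card A = card B"
  shows "iter_comult q n (Suc m) (quantum_minor q n A B) =
    (\<Oplus>\<^bsub>tensor_power (qsl q n) (Suc m)\<^esub>Cs\<in>chains n (Suc m) A B. pure_tensor (qsl q n) (minors q n Cs))"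
proof (induction m)
  case 0
  interpret W: calg "qsl q n" by (rule calg_qsl)
  interpret T: calg "tensor_power (qsl q n) (Suc 0)" by (rule W.calg_tensor_power)
  have "pure_tensor (qsl q n) [quantum_minor q n A B] \<in> carrier (tensor_power (qsl q n) (Suc 0))"
    using quantum_minor_closed[OF A B AB] by (intro W.pure_tensor_closed) auto
  then show ?case
    using T.finsum_insert[of "{}" "[A, B]" "\<lambda>Cs. pure_tensor (qsl q n) (minors q n Cs)"]
    unfolding chains_1[OF A B AB] by (simp add: minors_def)
next
  case (Suc m)
  interpret W: calg "qsl q n" by (rule calg_qsl)
  interpret T1: calg "tensor_power (qsl q n) (Suc m)" by (rule W.calg_tensor_power)
  interpret T2: calg "tensor_power (qsl q n) (Suc (Suc m))" by (rule W.calg_tensor_power)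
  let ?S = "{C. C \<subseteq> {1..n+1} \<and> card C = card A}"
  let ?p = "\<lambda>Cs. pure_tensor (qsl q n) (minors q n Cs)"
  have finS: "finite ?S" by simp
  have cl1: "?p Cs \<in> carrier (tensor_power (qsl q n) (Suc m))" if "Cs \<in> chains n (Suc m) A B" for Cs
    using that by (intro W.pure_tensor_closed minors_closed length_minors)
  have cl2: "?p Cs \<in> carrier (tensor_power (qsl q n) (Suc (Suc m)))" if "Cs \<in> chains n (Suc (Suc m)) A B" for Cs
    using that by (intro W.pure_tensor_closed minors_closed length_minors)
  have cl3: "?p (A # C # tl Cs) \<in> carrier (tensor_power (qsl q n) (Suc (Suc m)))"
    if "Cs \<in> chains n (Suc m) A B" "C \<in> ?S" for C Cs
    using bij_betw_apply[OF chains_refine[OF A], of "(Cs, C)"] that by (intro cl2) simp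
  have step: "comult_first q n (Suc m) (?p Cs) =
      (\<Oplus>\<^bsub>tensor_power (qsl q n) (Suc (Suc m))\<^esub>C\<in>?S. ?p (A # C # tl Cs))"
    if Cs: "Cs \<in> chains n (Suc m) A B" for Cs
  proof -
    obtain D Ds where D: "Cs = A # D # Ds" "D # Ds \<in> chains n m D B" "card D = card A"
      using Cs unfolding chains_Suc_iff by blast
    have Dn: "D \<subseteq> {1..n+1}" using D(2) by (simp add: chains_def)
    let ?w = "minors q n (D # Ds)"
    have w: "set ?w \<subseteq> carrier (qsl q n)" "length ?w = m"
      by (rule minors_closed[OF D(2)], rule length_minors[OF D(2)])
    have m: "minors q n Cs = quantum_minor q n A D # ?w" by (simp add: D(1) minors_def)
    have AD: "quantum_minor q n A D \<in> carrier (qsl q n)"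
      by (rule quantum_minor_closed[OF A Dn D(3)[symmetric]])
    have mc: "quantum_minor q n A C \<in> carrier (qsl q n)" "quantum_minor q n C D \<in> carrier (qsl q n)"
      if "C \<in> ?S" for C
      using that A Dn D(3) by (intro quantum_minor_closed; simp)+
    have "comult_first q n (Suc m) (?p Cs) = append_tensor q n m ?w (comult q n (quantum_minor q n A D))"
      unfolding m using AD w by (intro comult_first_pure[OF q]) simp_all
    also have "\<dots> = (\<Oplus>\<^bsub>tensor_power (qsl q n) (Suc (Suc m))\<^esub>C\<in>?S.
        append_tensor q n m ?w (pure_tensor (qsl q n) [quantum_minor q n A C, quantum_minor q n C D]))"
      unfolding comult_minor[OF q A Dn D(3)[symmetric]]
      using mc by (intro lin_map_finsum[OF W.calg_tensor_power T2.calg_axioms lin_map_append_tensor[OF q w]]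
          Pi_I W.pure_tensor_closed) simp_all
    also have "\<dots> = (\<Oplus>\<^bsub>tensor_power (qsl q n) (Suc (Suc m))\<^esub>C\<in>?S. ?p (A # C # tl Cs))"
    proof (rule T2.finsum_cong'[OF refl])
      show "(\<lambda>C. ?p (A # C # tl Cs)) \<in> ?S \<rightarrow> carrier (tensor_power (qsl q n) (Suc (Suc m)))"
        using cl3[OF Cs] by blast
      fix C assume C: "C \<in> ?S"
      have "append_tensor q n m ?w (pure_tensor (qsl q n) [quantum_minor q n A C, quantum_minor q n C D]) =
          pure_tensor (qsl q n) ([quantum_minor q n A C, quantum_minor q n C D] @ ?w)"
        using mc[OF C] by (intro append_tensor_pure[OF q w]) simp_all
      then show "append_tensor q n m ?w (pure_tensor (qsl q n) [quantum_minor q n A C, quantum_minor q n C D]) =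
        ?p (A # C # tl Cs)"
        by (simp add: D(1) minors_def)
    qed
    finally show ?thesis .
  qed
  have "iter_comult q n (Suc (Suc m)) (quantum_minor q n A B) =
      (\<Oplus>\<^bsub>tensor_power (qsl q n) (Suc (Suc m))\<^esub>Cs\<in>chains n (Suc m) A B. comult_first q n (Suc m) (?p Cs))"
    unfolding iter_comult.simps comp_apply Suc.IH
    using cl1 by (intro lin_map_finsum[OF T1.calg_axioms T2.calg_axioms lin_map_comult_first[OF q]]) blast
  also have "\<dots> = (\<Oplus>\<^bsub>tensor_power (qsl q n) (Suc (Suc m))\<^esub>Cs\<in>chains n (Suc m) A B.
      \<Oplus>\<^bsub>tensor_power (qsl q n) (Suc (Suc m))\<^esub>C\<in>?S. ?p (A # C # tl Cs))"
    using step cl3 by (intro T2.finsum_cong' refl Pi_I T2.finsum_closed)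
  also have "\<dots> = (\<Oplus>\<^bsub>tensor_power (qsl q n) (Suc (Suc m))\<^esub>p\<in>chains n (Suc m) A B \<times> ?S.
      ?p (A # snd p # tl (fst p)))"
    by (rule T2.finsum_Times[OF finite_chains finS cl3])
  also have "\<dots> = (\<Oplus>\<^bsub>tensor_power (qsl q n) (Suc (Suc m))\<^esub>Cs\<in>chains n (Suc (Suc m)) A B. ?p Cs)"
    using T2.finsum_bij_betw[OF chains_refine[OF A], of ?p m B] cl2
    by (simp only: split_def Pi_I)
  finally show ?case .
qed

section \<open>Banded matrices\<close>

text \<open>A permutation other than the identity has a descent. There the rows increase while the
  columns decrease, so one of the two entries is zero and the whole term vanishes.\<close>

lemma (in calg) qdet_banded:
  assumes y: "y \<in> N \<rightarrow> N \<rightarrow> carrier V"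
    and band: "\<And>i j k l. i \<in> N \<Longrightarrow> j \<in> N \<Longrightarrow> k \<in> N \<Longrightarrow> l \<in> N \<Longrightarrow> i < k \<Longrightarrow> l < j \<Longrightarrow>
      y i j = \<zero> \<or> y k l = \<zero>"
    and c: "c \<in> {1..r} \<rightarrow> N" "strict_mono_on {1..r} c" and d: "d \<in> {1..r} \<rightarrow> N" "strict_mono_on {1..r} d"
  shows "qdet V q r (\<lambda>i j. y (c i) (d j)) = list_prod V (map (\<lambda>i. y (c i) (d i)) [1..<Suc r])"
proof -
  let ?t = "\<lambda>\<tau>. (- q) ^ perm_length r \<tau> \<odot> list_prod V (map (\<lambda>i. y (c i) (d (\<tau> i))) [1..<Suc r])"
  have yc: "(\<lambda>i j. y (c i) (d j)) \<in> {1..r} \<rightarrow> {1..r} \<rightarrow> carrier V" using y c(1) d(1) by blast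
  have zero: "?t \<tau> = \<zero>" if \<tau>: "\<tau> permutes {1..r}" "\<tau> \<noteq> id" for \<tau>
  proof -
    obtain i where i: "1 \<le> i" "i < r" "\<not> \<tau> i < \<tau> (Suc i)"
      using permutes_no_descent[OF \<tau>(1)] \<tau>(2) by blast
    then have less: "\<tau> (Suc i) < \<tau> i" using permutes_adjacent_neq[OF \<tau>(1), of i] by linarith
    have ii: "i \<in> {1..r}" "Suc i \<in> {1..r}" using i by auto
    note t = permutes_in_interval[OF \<tau>(1) ii(1)] permutes_in_interval[OF \<tau>(1) ii(2)]
    have "c i < c (Suc i)" "d (\<tau> (Suc i)) < d (\<tau> i)"
      using strict_mono_onD[OF c(2) ii] strict_mono_onD[OF d(2) t(2,1) less] by simp_all
    moreover have "c i \<in> N" "c (Suc i) \<in> N" "d (\<tau> i) \<in> N" "d (\<tau> (Suc i)) \<in> N"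
      using c(1) d(1) ii t by blast+
    ultimately have "y (c i) (d (\<tau> i)) = \<zero> \<or> y (c (Suc i)) (d (\<tau> (Suc i))) = \<zero>"
      using band by blast
    moreover have "i \<in> set [1..<Suc r]" "Suc i \<in> set [1..<Suc r]" using ii by auto
    ultimately obtain k where "k \<in> set [1..<Suc r]" "y (c k) (d (\<tau> k)) = \<zero>" by blast
    then have "\<zero> \<in> set (map (\<lambda>i. y (c i) (d (\<tau> i))) [1..<Suc r])"
      unfolding set_map by (intro image_eqI[OF sym])
    then show ?thesis using list_prod_zero[OF qdet_factors_closed[OF yc \<tau>(1)]] by simp
  qed
  have "qdet V q r (\<lambda>i j. y (c i) (d j)) = (\<Oplus>\<tau>\<in>{id}. ?t \<tau>)"
    unfolding qdet_def
  proof (rule finsum_neutral_subset)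
    show "finite {\<tau>. \<tau> permutes {1..r}}" by (rule finite_permutations) simp
    show "{id} \<subseteq> {\<tau>. \<tau> permutes {1..r}}" using permutes_id by blast
    show "?t \<tau> = \<zero>" if "\<tau> \<in> {\<tau>. \<tau> permutes {1..r}} - {id}" for \<tau>
      using that by (intro zero) auto
    show "?t \<in> {id} \<rightarrow> carrier V" using qdet_term_closed[OF yc permutes_id] by blast
  qed
  also have "\<dots> = ?t id"
    using finsum_insert[of "{}" id ?t] qdet_term_closed[OF yc permutes_id] by simp
  also have "\<dots> = list_prod V (map (\<lambda>i. y (c i) (d i)) [1..<Suc r])"
    unfolding perm_length_id power_0 id_apply using qdet_factors_closed[OF yc permutes_id]
    by (intro smult_one list_prod_closed) (simp only: id_apply)
  finally show ?thesis .
qed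

section \<open>Bidiagonal representations\<close>

context calg
begin

lemma list_prod_ones: "(\<And>x. x \<in> set xs \<Longrightarrow> x = \<one>) \<Longrightarrow> list_prod V xs = \<one>"
proof (induction xs)
  case (Cons x xs)
  then have "x = \<one>" "list_prod V xs = \<one>" by simp_all
  then show ?case by (simp add: list_prod_Cons)
qed simp

text \<open>The common shape of the matrices of \<open>psi\<close>, with \<open>up\<close> for the
  sign of the letter. The identity matrix, needed for the counit, also has this shape, with
  \<open>a = a' = 1\<close> and \<open>b = 0\<close>.\<close>

context
  fixes q :: complex and h :: nat and up :: bool and a a' b and y :: "nat \<Rightarrow> nat \<Rightarrow> 'a"
  assumes carr: "a \<in> carrier V" "a' \<in> carrier V" "b \<in> carrier V"
    and inv: "a \<otimes> a' = \<one>" "a' \<otimes> a = \<one>" and ab: "a \<otimes> b = q \<odot> (b \<otimes> a)"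
  defines "y \<equiv> (\<lambda>i j. if i = j then (if i = h then a else if i = Suc h then a' else \<one>)
    else if up \<and> (i, j) = (h, Suc h) \<or> \<not> up \<and> (i, j) = (Suc h, h) then b else \<zero>)"
begin

lemma bidiagonal_closed: "y i j \<in> carrier V"
  by (simp add: y_def carr)

lemma bidiagonal_band: "i < k \<Longrightarrow> l < j \<Longrightarrow> y i j = \<zero> \<or> y k l = \<zero>"
  by (auto simp: y_def)

lemma bidiagonal_nonzero:
  "y i j \<noteq> \<zero> \<Longrightarrow> i = j \<or> up \<and> i = h \<and> j = Suc h \<or> \<not> up \<and> i = Suc h \<and> j = h"
  by (auto simp: y_def split: if_splits)

text \<open>Multiply \<open>a b = q b a\<close> by \<open>a'\<close> on both sides.\<close>

lemma inverse_q_commute: "b \<otimes> a' = q \<odot> (a' \<otimes> b)"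
proof -
  have "b \<otimes> a' = a' \<otimes> a \<otimes> b \<otimes> a'" by (simp add: inv carr)
  also have "\<dots> = a' \<otimes> (a \<otimes> b) \<otimes> a'" by (simp add: m_assoc carr)
  also have "\<dots> = q \<odot> (a' \<otimes> (b \<otimes> (a \<otimes> a')))"
    by (simp only: ab smult_mult_left smult_mult_right m_assoc carr m_closed)
  finally show ?thesis by (simp add: inv carr)
qed

text \<open>So few entries are nonzero that the relations reduce to those of \<open>b\<close> with
  \<open>a\<close> and \<open>a'\<close>, and to the commutation of \<open>a\<close> with
  \<open>a'\<close>.\<close>

lemma qmat_bidiagonal: "qmat V q N y"
  unfolding qmat_def
proof (intro conjI ballI impI)
  show "y \<in> N \<rightarrow> N \<rightarrow> carrier V" using bidiagonal_closed by blast
next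
  fix i j l :: nat assume "j < l"
  \<comment> \<open>Two entries of one row are both nonzero only in the row that contains
    \<open>b\<close>; columns are treated likewise below.\<close>
  then have "up \<and> i = h \<and> j = h \<and> l = Suc h \<or> \<not> up \<and> i = Suc h \<and> j = h \<and> l = Suc h \<or>
      y i j = \<zero> \<or> y i l = \<zero>"
    using bidiagonal_nonzero[of i j] bidiagonal_nonzero[of i l] by auto
  then consider "up" "i = h" "j = h" "l = Suc h" | "\<not> up" "i = Suc h" "j = h" "l = Suc h"
    | "y i j = \<zero>" | "y i l = \<zero>"
    by blast
  then show "y i j \<otimes> y i l = q \<odot> (y i l \<otimes> y i j)"
  proof cases
    case 1
    then show ?thesis by (simp add: y_def ab)
  next
    case 2
    then show ?thesis by (simp add: y_def inverse_q_commute)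
  qed (simp_all add: bidiagonal_closed)
next
  fix i j k :: nat assume "i < k"
  then have "up \<and> i = h \<and> j = Suc h \<and> k = Suc h \<or> \<not> up \<and> i = h \<and> j = h \<and> k = Suc h \<or>
      y i j = \<zero> \<or> y k j = \<zero>"
    using bidiagonal_nonzero[of i j] bidiagonal_nonzero[of k j] by auto
  then consider "up" "i = h" "j = Suc h" "k = Suc h" | "\<not> up" "i = h" "j = h" "k = Suc h"
    | "y i j = \<zero>" | "y k j = \<zero>"
    by blast
  then show "y i j \<otimes> y k j = q \<odot> (y k j \<otimes> y i j)"
  proof cases
    case 1
    then show ?thesis by (simp add: y_def inverse_q_commute)
  next
    case 2
    then show ?thesis by (simp add: y_def ab)
  qed (simp_all add: bidiagonal_closed)
next
  fix i j k l :: nat assume *: "i < k" "j < l"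
  \<comment> \<open>The antidiagonal product is zero, so the last relation becomes commutation of
    the diagonal pair.\<close>
  have z: "y i l = \<zero> \<or> y k j = \<zero>" by (rule bidiagonal_band[OF *])
  then show "y i l \<otimes> y k j = y k j \<otimes> y i l"
    using bidiagonal_closed[of i l] bidiagonal_closed[of k j] by auto
  have one: "i = h \<or> i = Suc h \<or> y i i = \<one>" for i by (simp add: y_def)
  \<comment> \<open>Apart from the pair \<open>a\<close>, \<open>a'\<close>, one of the two entries
    is 0 or 1 and hence commutes with the other.\<close>
  have "i = h \<and> j = h \<and> k = Suc h \<and> l = Suc h \<or> y i j = \<one> \<or> y k l = \<one> \<or> y i j = \<zero> \<or> y k l = \<zero>"
    using * bidiagonal_nonzero[of i j] bidiagonal_nonzero[of k l] one[of i] one[of k] by auto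
  then consider "i = h" "j = h" "k = Suc h" "l = Suc h" | "y i j = \<one>" | "y k l = \<one>"
    | "y i j = \<zero>" | "y k l = \<zero>"
    by blast
  then have "y i j \<otimes> y k l = y k l \<otimes> y i j"
  proof cases
    case 1
    then show ?thesis by (simp add: y_def inv)
  qed (simp_all add: bidiagonal_closed)
  moreover have "y i l \<otimes> y k j = \<zero>"
    using z bidiagonal_closed[of i l] bidiagonal_closed[of k j] by auto
  ultimately show "y i j \<otimes> y k l \<ominus> y k l \<otimes> y i j = (q - inverse q) \<odot> (y i l \<otimes> y k j)"
    by (simp add: bidiagonal_closed a_minus_def r_neg)
qed

lemma qdet_bidiagonal_minor:
  assumes "c \<in> {1..r} \<rightarrow> N" "strict_mono_on {1..r} c" "d \<in> {1..r} \<rightarrow> N" "strict_mono_on {1..r} d"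
  shows "qdet V q r (\<lambda>i j. y (c i) (d j)) = list_prod V (map (\<lambda>i. y (c i) (d i)) [1..<Suc r])"
  using bidiagonal_closed bidiagonal_band by (intro qdet_banded[OF _ _ assms]) blast+

text \<open>In the diagonal product \<open>a\<close> and \<open>a'\<close> are neighbours and
  cancel.\<close>

lemma qdet_bidiagonal:
  assumes h: "1 \<le> h" "h < r"
  shows "qdet V q r y = \<one>"
proof -
  have "qdet V q r y = list_prod V (map (\<lambda>i. y i i) [1..<Suc r])"
    using qdet_bidiagonal_minor[of "\<lambda>i. i" r UNIV "\<lambda>i. i"] strict_mono_on_id by blast
  also have "\<dots> = list_prod V (map (\<lambda>i. y i i) [1..<h]) \<otimes> (y h h \<otimes> y (Suc h) (Suc h)) \<otimes>
      list_prod V (map (\<lambda>i. y i i) [Suc (Suc h)..<Suc r])"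
    using bidiagonal_closed by (intro list_prod_split_adjacent h) blast
  also have "list_prod V (map (\<lambda>i. y i i) [1..<h]) = \<one>"
    by (rule list_prod_ones) (auto simp: y_def)
  also have "list_prod V (map (\<lambda>i. y i i) [Suc (Suc h)..<Suc r]) = \<one>"
    by (rule list_prod_ones) (auto simp: y_def simp del: upt_Suc)
  finally show ?thesis by (simp add: y_def inv)
qed

end

end

section \<open>The q-torus and the images of minors under the maps psi\<close>

lemma presentation_Lq2: "presentation UNIV (Lq2_rels q)"
  by standard (simp add: monoid_alg_def free_monoid_def)

lemma calg_Lq2: "calg (Lq2 q)"
  unfolding Lq2_def by (rule presentation.calg_presented[OF presentation_Lq2])

lemma Lq2_of_closed: "Lq2_of q g \<in> carrier (Lq2 q)"
  unfolding Lq2_def Lq2_of_def by (rule presentation.presented_gen_closed[OF presentation_Lq2]) simp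

lemma Lq2_relations:
  "Lq2_of q X \<otimes>\<^bsub>Lq2 q\<^esub> Lq2_of q X' = \<one>\<^bsub>Lq2 q\<^esub>"
  "Lq2_of q X' \<otimes>\<^bsub>Lq2 q\<^esub> Lq2_of q X = \<one>\<^bsub>Lq2 q\<^esub>"
  "Lq2_of q X \<otimes>\<^bsub>Lq2 q\<^esub> Lq2_of q Y = q \<odot>\<^bsub>Lq2 q\<^esub> (Lq2_of q Y \<otimes>\<^bsub>Lq2 q\<^esub> Lq2_of q X)"
proof -
  interpret presentation UNIV "Lq2_rels q" by (rule presentation_Lq2)
  let ?F = "free_alg (UNIV :: Lq2_gen set)"
  let ?\<pi> = "(+>\<^bsub>?F\<^esub>) (rel_ideal UNIV (Lq2_rels q))"
  have v: "var g \<in> carrier ?F" for g by (rule var_closed) simp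
  have g: "?\<pi> (var g) = Lq2_of q g" for g by (simp add: Lq2_of_def presented_gen_def)
  note H = alg_map_presented_coset[folded Lq2_def]
  have m: "?\<pi> (var g \<otimes>\<^bsub>?F\<^esub> var g') = Lq2_of q g \<otimes>\<^bsub>Lq2 q\<^esub> Lq2_of q g'" for g g'
    unfolding g[symmetric] by (rule alg_mapD(3)[OF H v v])
  have s: "?\<pi> (q \<odot>\<^bsub>?F\<^esub> (var g \<otimes>\<^bsub>?F\<^esub> var g')) = q \<odot>\<^bsub>Lq2 q\<^esub> (Lq2_of q g \<otimes>\<^bsub>Lq2 q\<^esub> Lq2_of q g')" for g g'
    unfolding m[symmetric] by (rule lin_mapD(3)[OF alg_mapD(1)[OF H] m_closed[OF v v]])
  have r: "(var X \<otimes>\<^bsub>?F\<^esub> var X', \<one>\<^bsub>?F\<^esub>) \<in> Lq2_rels q" "(var X' \<otimes>\<^bsub>?F\<^esub> var X, \<one>\<^bsub>?F\<^esub>) \<in> Lq2_rels q"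
    "(var X \<otimes>\<^bsub>?F\<^esub> var Y, q \<odot>\<^bsub>?F\<^esub> (var Y \<otimes>\<^bsub>?F\<^esub> var X)) \<in> Lq2_rels q"
    unfolding Lq2_rels_def Let_def by simp_all
  show "Lq2_of q X \<otimes>\<^bsub>Lq2 q\<^esub> Lq2_of q X' = \<one>\<^bsub>Lq2 q\<^esub>"
    using relation_holds[OF r(1)] unfolding m alg_mapD(2)[OF H] .
  show "Lq2_of q X' \<otimes>\<^bsub>Lq2 q\<^esub> Lq2_of q X = \<one>\<^bsub>Lq2 q\<^esub>"
    using relation_holds[OF r(2)] unfolding m alg_mapD(2)[OF H] .
  show "Lq2_of q X \<otimes>\<^bsub>Lq2 q\<^esub> Lq2_of q Y = q \<odot>\<^bsub>Lq2 q\<^esub> (Lq2_of q Y \<otimes>\<^bsub>Lq2 q\<^esub> Lq2_of q X)"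
    using relation_holds[OF r(3)] unfolding m s .
qed

text \<open>The matrix of \<open>psi\<close>, rewritten with \<open>\<not> ik > 0\<close> for
  \<open>ik < 0\<close> so that it is literally a bidiagonal matrix with \<open>up\<close> as
  \<open>ik > 0\<close>. For nonzero letters the two agree.\<close>

definition psi_entry :: "complex \<Rightarrow> int \<Rightarrow> nat \<Rightarrow> nat \<Rightarrow> Lq2_elem" where
  "psi_entry q ik i j =
    (if i = j then
      (if i = nat \<bar>ik\<bar> then Lq2_of q X else if i = Suc (nat \<bar>ik\<bar>) then Lq2_of q X' else \<one>\<^bsub>Lq2 q\<^esub>)
    else if ik > 0 \<and> (i, j) = (nat \<bar>ik\<bar>, Suc (nat \<bar>ik\<bar>)) \<or> \<not> ik > 0 \<and> (i, j) = (Suc (nat \<bar>ik\<bar>), nat \<bar>ik\<bar>)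
      then Lq2_of q Y
    else \<zero>\<^bsub>Lq2 q\<^esub>)"

lemma psi_entry_closed: "psi_entry q ik i j \<in> carrier (Lq2 q)"
proof -
  interpret calg "Lq2 q" by (rule calg_Lq2)
  show ?thesis by (simp add: psi_entry_def Lq2_of_closed)
qed

lemma psi_eq: "ik \<noteq> 0 \<Longrightarrow> psi q ik = presented_hom (Lq2 q) (\<lambda>(i, j). psi_entry q ik i j)"
  unfolding psi_def psi_entry_def Let_def
  by (intro arg_cong[where f = "presented_hom (Lq2 q)"] ext) auto

context
  fixes q :: complex and n :: nat and ik :: int
  assumes ik: "ik \<noteq> 0" "\<bar>ik\<bar> \<le> int n"
begin

lemma qmat_psi_entry: "qmat (Lq2 q) q N (psi_entry q ik)"
  using calg.qmat_bidiagonal[OF calg_Lq2 Lq2_of_closed Lq2_of_closed Lq2_of_closed Lq2_relations]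
  unfolding psi_entry_def[abs_def] .

lemma qdet_psi_entry: "qdet (Lq2 q) q (n+1) (psi_entry q ik) = \<one>\<^bsub>Lq2 q\<^esub>"
proof -
  have "1 \<le> nat \<bar>ik\<bar>" "nat \<bar>ik\<bar> < n + 1" using ik by linarith+
  from calg.qdet_bidiagonal[OF calg_Lq2 Lq2_of_closed Lq2_of_closed Lq2_of_closed Lq2_relations this]
  show ?thesis unfolding psi_entry_def[abs_def] .
qed

lemma lin_map_psi: "lin_map (qsl q n) (Lq2 q) (psi q ik)"
  unfolding psi_eq[OF ik(1)]
  by (rule alg_mapD(1)[OF qsl_hom(1)[OF calg_Lq2 qmat_psi_entry qdet_psi_entry]])

lemma psi_minor:
  assumes "C \<subseteq> {1..n+1}" "D \<subseteq> {1..n+1}" "card C = card D"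
  shows "psi q ik (quantum_minor q n C D) =
    list_prod (Lq2 q) (map (\<lambda>i. psi_entry q ik (enum C i) (enum D i)) [1..<Suc (card C)])"
proof -
  have f: "finite C" "finite D" using assms finite_subset by blast+
  have "psi q ik (quantum_minor q n C D) =
      qdet (Lq2 q) q (card C) (\<lambda>i j. psi_entry q ik (enum C i) (enum D j))"
    unfolding psi_eq[OF ik(1)] by (rule qsl_hom_minor[OF calg_Lq2 qmat_psi_entry qdet_psi_entry assms])
  also have "\<dots> = list_prod (Lq2 q) (map (\<lambda>i. psi_entry q ik (enum C i) (enum D i)) [1..<Suc (card C)])"
    unfolding psi_entry_def[abs_def]
    using enum_funcset[OF f(1) assms(1) refl] enum_funcset[OF f(2) assms(2) assms(3)[symmetric]]
      strict_mono_on_enum[OF f(1)] strict_mono_on_enum[OF f(2)] assms(3)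
    by (intro calg.qdet_bidiagonal_minor[OF calg_Lq2 Lq2_of_closed Lq2_of_closed Lq2_of_closed Lq2_relations]) simp_all
  finally show ?thesis .
qed

end

text \<open>Needed for the empty expression. The counit sends the generators to the identity matrix,
  which is banded, and its diagonal product along two enumerations is 1 or 0.\<close>

lemma counit_minor:
  assumes "C \<subseteq> {1..n+1}" "D \<subseteq> {1..n+1}" "card C = card D"
  shows "counit q n (quantum_minor q n C D) =
    (if C = D then \<one>\<^bsub>tensor_power (qsl q n) 0\<^esub> else \<zero>\<^bsub>tensor_power (qsl q n) 0\<^esub>)"
proof -
  interpret W: calg "qsl q n" by (rule calg_qsl)
  interpret T: calg "tensor_power (qsl q n) 0" by (rule W.calg_tensor_power)
  have f: "finite C" "finite D" using assms finite_subset by blast+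
  let ?y = "\<lambda>i j :: nat. if i = j then \<one>\<^bsub>tensor_power (qsl q n) 0\<^esub> else \<zero>\<^bsub>tensor_power (qsl q n) 0\<^esub>"
  \<comment> \<open>The identity matrix in bidiagonal shape, so that the quadratic relations need no
    separate check.\<close>
  have y: "?y = (\<lambda>i j. if i = j then (if i = 0 then \<one>\<^bsub>tensor_power (qsl q n) 0\<^esub>
      else if i = Suc 0 then \<one>\<^bsub>tensor_power (qsl q n) 0\<^esub> else \<one>\<^bsub>tensor_power (qsl q n) 0\<^esub>)
    else if True \<and> (i, j) = (0, Suc 0) \<or> \<not> True \<and> (i, j) = (Suc 0, 0) then \<zero>\<^bsub>tensor_power (qsl q n) 0\<^esub>
    else \<zero>\<^bsub>tensor_power (qsl q n) 0\<^esub>)"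
    by (intro ext) simp
  have qy: "qmat (tensor_power (qsl q n) 0) q {1..n+1} ?y"
    unfolding y by (intro T.qmat_bidiagonal) simp_all
  have minor: "qdet (tensor_power (qsl q n) 0) q r (\<lambda>i j. ?y (c i) (d j)) =
      list_prod (tensor_power (qsl q n) 0) (map (\<lambda>i. ?y (c i) (d i)) [1..<Suc r])"
    if "strict_mono_on {1..r} c" "strict_mono_on {1..r} d" for r c d
    by (rule T.qdet_banded[where N = UNIV]) (use that in \<open>auto split: if_splits\<close>)
  have "qdet (tensor_power (qsl q n) 0) q (n+1) ?y = \<one>\<^bsub>tensor_power (qsl q n) 0\<^esub>"
    unfolding minor[OF strict_mono_on_id strict_mono_on_id] by (rule T.list_prod_ones) auto
  from qsl_hom_minor[OF T.calg_axioms qy this assms]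
  have "counit q n (quantum_minor q n C D) =
      qdet (tensor_power (qsl q n) 0) q (card C) (\<lambda>i j. ?y (enum C i) (enum D j))"
    unfolding counit_def by simp
  also have "\<dots> = list_prod (tensor_power (qsl q n) 0) (map (\<lambda>i. ?y (enum C i) (enum D i)) [1..<Suc (card C)])"
    using minor[OF strict_mono_on_enum[OF f(1)]] strict_mono_on_enum[OF f(2)] assms(3) by simp
  also have "\<dots> = (if C = D then \<one>\<^bsub>tensor_power (qsl q n) 0\<^esub> else \<zero>\<^bsub>tensor_power (qsl q n) 0\<^esub>)"
  proof (cases "C = D")
    case True
    then show ?thesis by (simp del: upt_Suc) (rule T.list_prod_ones, auto)
  next
    case False
    \<comment> \<open>Different sets of equal size have different enumerations, and a position where
      they differ gives a zero factor.\<close>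
    have "\<exists>i\<in>{1..card C}. enum C i \<noteq> enum D i"
    proof (rule ccontr)
      assume "\<not> ?thesis"
      then have "enum C ` {1..card C} = enum D ` {1..card D}"
        unfolding assms(3) by (intro image_cong) auto
      then show False
        using False bij_betw_enum[OF f(1)] bij_betw_enum[OF f(2)] by (simp add: bij_betw_def)
    qed
    then obtain i where i: "i \<in> {1..card C}" "enum C i \<noteq> enum D i" by blast
    then have "\<zero>\<^bsub>tensor_power (qsl q n) 0\<^esub> \<in> set (map (\<lambda>i. ?y (enum C i) (enum D i)) [1..<Suc (card C)])"
      unfolding set_map by (intro image_eqI[of _ _ i]) auto
    then show ?thesis using False by (simp only: if_False) (intro T.list_prod_zero; auto)
  qed
  finally show ?thesis .
qed

section \<open>The image of a quantum minor as a sum over chains\<close>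

text \<open>By \<open>psi_minor\<close>, for equinumerous index sets this is the image under
  \<open>psi q ik\<close> of the minor with rows \<open>C\<close> and columns
  \<open>D\<close>.\<close>

definition layer_weight :: "complex \<Rightarrow> int \<Rightarrow> nat set \<Rightarrow> nat set \<Rightarrow> Lq2_elem" where
  "layer_weight q ik C D =
    list_prod (Lq2 q) (map (\<lambda>i. psi_entry q ik (enum C i) (enum D i)) [1..<Suc (card C)])"

definition chain_weight :: "complex \<Rightarrow> int list \<Rightarrow> nat set list \<Rightarrow> (Lq2_elem list \<Rightarrow>\<^sub>0 complex) set" where
  "chain_weight q is Cs =
    pure_tensor (Lq2 q) (map (\<lambda>k. layer_weight q (is ! k) (Cs ! k) (Cs ! Suc k)) [0..<length is])"

lemma layer_weight_closed: "layer_weight q ik C D \<in> carrier (Lq2 q)"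
proof -
  interpret calg "Lq2 q" by (rule calg_Lq2)
  show ?thesis
    unfolding layer_weight_def using psi_entry_closed by (intro list_prod_closed) auto
qed

lemma chain_weight_closed: "chain_weight q is Cs \<in> carrier (Lq q is)"
  unfolding chain_weight_def using layer_weight_closed
  by (intro calg.pure_tensor_closed[OF calg_Lq2]) auto

text \<open>The tensor product of the maps \<open>psi\<close> is applied to the chain expansion term
  by term; on a pure tensor of minors it acts factorwise.\<close>

lemma pi_tilde_minor:
  assumes q: "q \<noteq> 0" and set_is: "set is \<subseteq> {- int n..int n} - {0}"
    and A: "A \<subseteq> {1..n+1}" and B: "B \<subseteq> {1..n+1}" and AB: "card A = card B"
  shows "pi_tilde q n is (quantum_minor q n A B) =
    (\<Oplus>\<^bsub>Lq q is\<^esub>Cs\<in>chains n (length is) A B. chain_weight q is Cs)"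
proof -
  interpret W: calg "qsl q n" by (rule calg_qsl)
  interpret L: calg "Lq2 q" by (rule calg_Lq2)
  interpret LT: calg "Lq q is" by (rule L.calg_tensor_power)
  have ik: "ik \<noteq> 0" "\<bar>ik\<bar> \<le> int n" if "ik \<in> set is" for ik
  proof -
    have "ik \<in> {- int n..int n} - {0}" using set_is that by blast
    then show "ik \<noteq> 0" "\<bar>ik\<bar> \<le> int n" by auto
  qed
  have fs: "lin_map (qsl q n) (Lq2 q) f" if "f \<in> set (map (psi q) is)" for f
    using that lin_map_psi[OF ik] by auto
  have len: "length (map (psi q) is) = length is" by simp
  note lm = lin_map_tensor_map[OF W.calg_axioms L.calg_axioms fs len]
  note tp = tensor_map_pure[OF W.calg_axioms L.calg_axioms fs len]
  show ?thesis
  proof (cases "length is")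
    \<comment> \<open>With no layers the iterated comultiplication is the counit, a case outside
      \<open>iter_comult_minor\<close>.\<close>
    case 0
    then have is_Nil: "is = []" by simp
    have one: "tensor_map (Lq2 q) (map (psi q) is) \<one>\<^bsub>tensor_power (qsl q n) (length is)\<^esub> = \<one>\<^bsub>Lq q is\<^esub>"
      unfolding W.pure_tensor_one L.pure_tensor_one using tp[of "[]"] by (simp add: is_Nil)
    have zero: "tensor_map (Lq2 q) (map (psi q) is) \<zero>\<^bsub>tensor_power (qsl q n) (length is)\<^esub> = \<zero>\<^bsub>Lq q is\<^esub>"
      by (rule lin_map_zero[OF W.calg_tensor_power LT.calg_axioms lm])
    have w: "chain_weight q is Cs = \<one>\<^bsub>Lq q is\<^esub>" for Cs
      by (simp add: chain_weight_def is_Nil L.pure_tensor_one)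
    \<comment> \<open>A chain without layers is one set, which must equal both \<open>A\<close> and
      \<open>B\<close>; this matches the two values of the counit.\<close>
    have "chains n (length is) A B = (if A = B then {[A]} else {})"
      using A by (auto simp: chains_def is_Nil length_Suc_conv)
    interpret L0: calg "tensor_power (Lq2 q) 0" by (rule L.calg_tensor_power)
    have "(\<Oplus>\<^bsub>tensor_power (Lq2 q) 0\<^esub>Cs\<in>{[A]}. \<one>\<^bsub>tensor_power (Lq2 q) 0\<^esub>) = \<one>\<^bsub>tensor_power (Lq2 q) 0\<^esub>"
      using L0.finsum_insert[of "{}" "[A]" "\<lambda>_. \<one>\<^bsub>tensor_power (Lq2 q) 0\<^esub>"] by simp
    with \<open>chains n (length is) A B = _\<close> show ?thesis
      using one zero
      by (simp add: pi_tilde_def is_Nil counit_minor[OF A B AB] w[unfolded is_Nil])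
  next
    case (Suc m)
    have "pi_tilde q n is (quantum_minor q n A B) = (\<Oplus>\<^bsub>Lq q is\<^esub>Cs\<in>chains n (length is) A B.
        tensor_map (Lq2 q) (map (psi q) is) (pure_tensor (qsl q n) (minors q n Cs)))"
      unfolding pi_tilde_def comp_apply Suc iter_comult_minor[OF q A B AB]
      using lin_map_finsum[OF W.calg_tensor_power LT.calg_axioms lm,
          of "\<lambda>Cs. pure_tensor (qsl q n) (minors q n Cs)" "chains n (length is) A B"]
        minors_closed[of _ n "length is" A B q] length_minors[of _ n "length is" A B q]
      unfolding Suc by (simp add: Pi_iff W.pure_tensor_closed)
    also have "\<dots> = (\<Oplus>\<^bsub>Lq q is\<^esub>Cs\<in>chains n (length is) A B. chain_weight q is Cs)"
    proof (rule LT.finsum_cong'[OF refl])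
      show "chain_weight q is \<in> chains n (length is) A B \<rightarrow> carrier (Lq q is)"
        using chain_weight_closed by blast
      fix Cs assume Cs: "Cs \<in> chains n (length is) A B"
      have lCs: "length Cs = Suc (length is)" using Cs by (simp add: chains_def)
      have "map2 (\<lambda>f a. f a) (map (psi q) is) (minors q n Cs) =
          map (\<lambda>k. layer_weight q (is ! k) (Cs ! k) (Cs ! Suc k)) [0..<length is]"
      proof (rule nth_equalityI)
        show "length (map2 (\<lambda>f a. f a) (map (psi q) is) (minors q n Cs)) =
          length (map (\<lambda>k. layer_weight q (is ! k) (Cs ! k) (Cs ! Suc k)) [0..<length is])"
          by (simp add: length_minors[OF Cs])
        fix k assume "k < length (map2 (\<lambda>f a. f a) (map (psi q) is) (minors q n Cs))"
        then have k: "k < length is" by simp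
        then have "Cs ! k \<in> set Cs" "Cs ! Suc k \<in> set Cs" using lCs by auto
        then have "Cs ! k \<subseteq> {1..n+1}" "Cs ! Suc k \<subseteq> {1..n+1}" "card (Cs ! k) = card (Cs ! Suc k)"
          using Cs unfolding chains_def by auto
        note psi = psi_minor[OF ik[OF nth_mem[OF k]] this]
        have "map2 (\<lambda>f a. f a) (map (psi q) is) (minors q n Cs) ! k =
            psi q (is ! k) (quantum_minor q n (Cs ! k) (Cs ! Suc k))"
          using k lCs by (simp add: minors_def nth_tl)
        then show "map2 (\<lambda>f a. f a) (map (psi q) is) (minors q n Cs) ! k =
          map (\<lambda>k. layer_weight q (is ! k) (Cs ! k) (Cs ! Suc k)) [0..<length is] ! k"
          using k by (simp add: psi layer_weight_def del: upt_Suc)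
      qed
      then show "tensor_map (Lq2 q) (map (psi q) is) (pure_tensor (qsl q n) (minors q n Cs)) = chain_weight q is Cs"
        unfolding chain_weight_def using tp[OF _ length_minors[OF Cs] minors_closed[OF Cs]] by simp
    qed
    finally show ?thesis .
  qed
qed

section \<open>Families of disjoint paths\<close>

lemma vwalk_arcs_eq_zip: "vwalk_arcs p = zip p (tl p)"
  by (induction p rule: vwalk_arcs.induct) auto

text \<open>For a nonzero letter, the pairs outside this relation are zeros of
  \<open>psi_entry\<close>; this links arcs with matrix entries.\<close>

definition wire_step :: "int \<Rightarrow> nat \<Rightarrow> nat \<Rightarrow> bool" where
  "wire_step ik l l' \<longleftrightarrow> l' = l \<or> ik > 0 \<and> l = nat \<bar>ik\<bar> \<and> l' = Suc (nat \<bar>ik\<bar>) \<or>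
    ik < 0 \<and> l = Suc (nat \<bar>ik\<bar>) \<and> l' = nat \<bar>ik\<bar>"

text \<open>A layer has only one diagonal arc, and it joins neighbouring levels. Reversing the order
  of two levels would take both diagonals at once.\<close>

lemma wire_step_noncrossing:
  "wire_step ik l t \<Longrightarrow> wire_step ik l' t' \<Longrightarrow> l < l' \<Longrightarrow> t \<noteq> t' \<Longrightarrow> t < t'"
  unfolding wire_step_def by linarith

lemma psi_entry_not_wire_step: "ik \<noteq> 0 \<Longrightarrow> \<not> wire_step ik l l' \<Longrightarrow> psi_entry q ik l l' = \<zero>\<^bsub>Lq2 q\<^esub>"
  by (auto simp: wire_step_def psi_entry_def)

lemma arc_weight_eq_psi_entry:
  "wire_step (is ! k) l l' \<Longrightarrow> arc_weight q is ((k, l), (k', l')) = psi_entry q (is ! k) l l'"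
  by (auto simp: wire_step_def psi_entry_def)

section \<open>Left-to-right paths as functions of the column\<close>

definition layered_path :: "nat \<Rightarrow> (nat \<Rightarrow> nat) \<Rightarrow> (nat \<times> nat) list" where
  "layered_path m f = map (\<lambda>k. (k, f k)) [0..<Suc m]"

lemma length_layered_path [simp]: "length (layered_path m f) = Suc m"
  by (simp add: layered_path_def)

lemma nth_layered_path [simp]: "k \<le> m \<Longrightarrow> layered_path m f ! k = (k, f k)"
  unfolding layered_path_def by (subst nth_map) (auto simp del: upt_Suc)

lemma set_layered_path: "set (layered_path m f) = {(k, f k) |k. k \<le> m}"
  unfolding layered_path_def by (auto simp: less_Suc_eq_le image_iff simp del: upt_Suc)

lemma hd_layered_path [simp]: "hd (layered_path m f) = (0, f 0)"
  using nth_layered_path[of 0 m f] hd_conv_nth[of "layered_path m f"] length_layered_path[of m f]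
  by (metis le0 list.size(3) nat.distinct(1))

lemma last_layered_path [simp]: "last (layered_path m f) = (m, f m)"
  by (simp add: layered_path_def)

lemma layered_path_neq_Nil [simp]: "layered_path m f \<noteq> []"
  by (simp add: layered_path_def)

lemma vwalk_arcs_layered_path:
  "vwalk_arcs (layered_path m f) = map (\<lambda>k. ((k, f k), (Suc k, f (Suc k)))) [0..<m]"
  unfolding vwalk_arcs_eq_zip by (rule nth_equalityI) (simp_all add: nth_tl)

lemma wiring_arc_iff:
  assumes "set is \<subseteq> {- int n..int n} - {0}"
  shows "((k, l), (k', l')) \<in> parcs (wiring_diagram n is) \<and> l \<in> {1..n+1} \<longleftrightarrow>
    k < length is \<and> k' = Suc k \<and> l \<in> {1..n+1} \<and> l' \<in> {1..n+1} \<and> wire_step (is ! k) l l'"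
proof -
  have h: "1 \<le> nat \<bar>is ! k\<bar>" "nat \<bar>is ! k\<bar> \<le> n" if "k < length is"
  proof -
    have "is ! k \<in> {- int n..int n} - {0}" using assms nth_mem[OF that] by blast
    then show "1 \<le> nat \<bar>is ! k\<bar>" "nat \<bar>is ! k\<bar> \<le> n" by auto
  qed
  show ?thesis
  proof (cases "k < length is")
    case True
    then show ?thesis using h unfolding wiring_diagram_def wire_step_def by auto
  next
    case False
    then show ?thesis unfolding wiring_diagram_def by auto
  qed
qed

text \<open>All arcs go one column to the right, so a path from the left side to the right side
  meets every column exactly once and is a choice of level per column.\<close>

lemma vpath_wiring_diagram_iff:
  assumes "set is \<subseteq> {- int n..int n} - {0}"
  shows "vpath p (with_proj (wiring_diagram n is)) \<and> fst (hd p) = 0 \<and> fst (last p) = length is \<longleftrightarrow>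
    (\<exists>f. p = layered_path (length is) f \<and> (\<forall>k\<le>length is. f k \<in> {1..n+1}) \<and>
      (\<forall>k<length is. wire_step (is ! k) (f k) (f (Suc k))))"
proof
  assume L: "vpath p (with_proj (wiring_diagram n is)) \<and> fst (hd p) = 0 \<and> fst (last p) = length is"
  then have p: "set p \<subseteq> {0..length is} \<times> {1..n+1}" "set (vwalk_arcs p) \<subseteq> parcs (wiring_diagram n is)" "p \<noteq> []"
    by (auto simp: vpath_def vwalk_def wiring_diagram_def)
  have step: "fst (p ! k) < length is \<and> fst (p ! Suc k) = Suc (fst (p ! k)) \<and>
      wire_step (is ! fst (p ! k)) (snd (p ! k)) (snd (p ! Suc k))" if "Suc k < length p" for k
  proof -
    have "(p ! k, p ! Suc k) \<in> set (vwalk_arcs p)"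
      using that unfolding vwalk_arcs_eq_zip by (auto simp: set_zip nth_tl intro!: exI[of _ k])
    then have "((fst (p ! k), snd (p ! k)), (fst (p ! Suc k), snd (p ! Suc k))) \<in> parcs (wiring_diagram n is)"
      using p(2) by auto
    moreover have "p ! k \<in> set p" using that by simp
    then have "snd (p ! k) \<in> {1..n+1}" using p(1) by (metis SigmaD2 subsetD surjective_pairing)
    ultimately show ?thesis using wiring_arc_iff[OF assms] by blast
  qed
  \<comment> \<open>Vertex number \<open>k\<close> lies in column \<open>k\<close>: the path starts
    in column 0 and each arc adds one.\<close>
  have fst: "fst (p ! k) = k" if "k < length p" for k
    using that
  proof (induction k)
    case 0
    then show ?case using L p(3) by (simp add: hd_conv_nth)
  next
    case (Suc k)
    then show ?case using step[of k] by simp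
  qed
  have len: "length p = Suc (length is)"
  proof -
    have "length p - 1 = length is" using fst[of "length p - 1"] L p(3) by (simp add: last_conv_nth)
    then show ?thesis using p(3) by (cases p) simp_all
  qed
  have "p = layered_path (length is) (\<lambda>k. snd (p ! k))"
    by (rule nth_equalityI) (auto simp: len fst less_Suc_eq_le prod_eq_iff)
  moreover have "snd (p ! k) \<in> {1..n+1}" if "k \<le> length is" for k
  proof -
    have "p ! k \<in> set p" using that len by simp
    then show ?thesis using p(1) by (metis SigmaD2 subsetD surjective_pairing)
  qed
  moreover have "wire_step (is ! k) (snd (p ! k)) (snd (p ! Suc k))" if "k < length is" for k
    using step[of k] fst[of k] that len by simp
  ultimately show "\<exists>f. p = layered_path (length is) f \<and> (\<forall>k\<le>length is. f k \<in> {1..n+1}) \<and>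
      (\<forall>k<length is. wire_step (is ! k) (f k) (f (Suc k)))" by blast
next
  assume "\<exists>f. p = layered_path (length is) f \<and> (\<forall>k\<le>length is. f k \<in> {1..n+1}) \<and>
      (\<forall>k<length is. wire_step (is ! k) (f k) (f (Suc k)))"
  then obtain f where f: "p = layered_path (length is) f" "\<forall>k\<le>length is. f k \<in> {1..n+1}"
    "\<forall>k<length is. wire_step (is ! k) (f k) (f (Suc k))" by blast
  have "set p \<subseteq> pverts (wiring_diagram n is)"
    using f(2) unfolding f(1) set_layered_path wiring_diagram_def by auto
  moreover have "((k, f k), (Suc k, f (Suc k))) \<in> parcs (wiring_diagram n is)" if "k < length is" for k
    using wiring_arc_iff[OF assms, of k "f k" "Suc k" "f (Suc k)"] f(2,3) that by auto
  then have "set (vwalk_arcs p) \<subseteq> parcs (wiring_diagram n is)"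
    unfolding f(1) vwalk_arcs_layered_path by auto
  moreover have "distinct p"
    unfolding f(1) layered_path_def by (simp add: distinct_map inj_on_def del: upt_Suc)
  ultimately show "vpath p (with_proj (wiring_diagram n is)) \<and> fst (hd p) = 0 \<and> fst (last p) = length is"
    by (simp add: vpath_def vwalk_def f(1))
qed

text \<open>A finite set has one increasing enumeration. This identifies the i-th path of a family
  with the i-th smallest level of a column.\<close>

lemma enum_unique:
  assumes g: "strict_mono_on {1..r} g" and "i \<in> {1..r}"
  shows "enum (g ` {1..r}) i = g i"
proof -
  have "sorted_wrt (<) (map g [1..<Suc r])"
    unfolding sorted_wrt_map by (rule sorted_wrt_mono_rel[of _ "(<)"])
      (auto simp del: upt_Suc intro!: strict_mono_onD[OF g])
  then have "sorted_list_of_set (set (map g [1..<Suc r])) = map g [1..<Suc r]"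
    by (intro sorted_list_of_set.idem_if_sorted_distinct) (simp_all only: strict_sorted_iff)
  moreover have "set (map g [1..<Suc r]) = g ` {1..r}" by (auto simp del: upt_Suc)
  ultimately have "sorted_list_of_set (g ` {1..r}) = map g [1..<Suc r]" by simp
  moreover have "i - 1 < length [1..<Suc r]" "[1..<Suc r] ! (i - 1) = i"
    using assms(2) by (auto simp del: upt_Suc)
  ultimately show ?thesis unfolding enum_def by (simp only: nth_map)
qed

text \<open>The interpretation is over \<open>set xs\<close>, where the distinctness of the keys
  makes \<open>f\<close> injective as \<open>folding_insort_key\<close> requires.\<close>

lemma (in linorder) sorted_key_list_of_set_set:
  assumes "sorted (map f xs)" "distinct (map f xs)"
  shows "sorted_key_list_of_set f (set xs) = xs"
proof -
  interpret folding_insort_key less_eq less "set xs" f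
    using assms(2) by unfold_locales (simp add: distinct_map)
  show ?thesis using assms by (intro idem_if_sorted_distinct) (simp_all add: distinct_map)
qed

text \<open>Disjoint paths stay in order, so the i-th one has no choice but the i-th smallest level
  of each column.\<close>

definition chain_path :: "nat set list \<Rightarrow> nat \<Rightarrow> (nat \<times> nat) list" where
  "chain_path Cs i = layered_path (length Cs - 1) (\<lambda>k. enum (Cs ! k) i)"

text \<open>The chains along which all the paths \<open>chain_path Cs i\<close> really
  exist.\<close>

definition wired_chains :: "nat \<Rightarrow> int list \<Rightarrow> nat set \<Rightarrow> nat set \<Rightarrow> nat set list set" where
  "wired_chains n is A B = {Cs \<in> chains n (length is) A B.
    \<forall>k<length is. \<forall>i\<in>{1..card A}. wire_step (is ! k) (enum (Cs ! k) i) (enum (Cs ! Suc k) i)}"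

lemma chainsD:
  assumes "Cs \<in> chains n m A B"
  shows "length Cs = Suc m" "Cs ! 0 = A" "Cs ! m = B"
    and "k \<le> m \<Longrightarrow> Cs ! k \<subseteq> {1..n+1}" "k \<le> m \<Longrightarrow> card (Cs ! k) = card A" "k \<le> m \<Longrightarrow> finite (Cs ! k)"
proof -
  show l: "length Cs = Suc m" using assms by (simp add: chains_def)
  then have "Cs \<noteq> []" by auto
  then show "Cs ! 0 = A" "Cs ! m = B"
    using assms l by (auto simp: chains_def hd_conv_nth last_conv_nth)
  assume "k \<le> m"
  then have "Cs ! k \<in> set Cs" using l by simp
  then show "Cs ! k \<subseteq> {1..n+1}" "card (Cs ! k) = card A" using assms by (auto simp: chains_def)
  then show "finite (Cs ! k)" using finite_subset by blast
qed

context
  fixes n :: nat and "is" :: "int list" and A B :: "nat set"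
  assumes set_is: "set is \<subseteq> {- int n..int n} - {0}"
    and A: "A \<subseteq> {1..n+1}" and B: "B \<subseteq> {1..n+1}" and AB: "card A = card B"
begin

lemma chain_path_eq:
  "Cs \<in> chains n (length is) A B \<Longrightarrow> chain_path Cs i = layered_path (length is) (\<lambda>k. enum (Cs ! k) i)"
  by (simp add: chain_path_def chainsD(1))

text \<open>Paths with different numbers are disjoint because each column is enumerated injectively
  and vertices in different columns differ.\<close>

lemma chain_path_family:
  assumes Cs: "Cs \<in> wired_chains n is A B"
  shows "chain_path Cs ` {1..card A} \<in> path_families n is A B" "inj_on (chain_path Cs) {1..card A}"
proof -
  have c: "Cs \<in> chains n (length is) A B" using Cs by (simp add: wired_chains_def)
  note D = chainsD[OF c]
  have bij: "bij_betw (enum (Cs ! k)) {1..card A} (Cs ! k)" if "k \<le> length is" for k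
    using bij_betw_enum[OF D(6)[OF that]] D(5)[OF that] by simp
  have disj: "i = j"
    if ij: "i \<in> {1..card A}" "j \<in> {1..card A}" and v: "v \<in> set (chain_path Cs i)" "v \<in> set (chain_path Cs j)" for i j v
  proof -
    obtain k where "k \<le> length is" "enum (Cs ! k) i = enum (Cs ! k) j"
      using v unfolding chain_path_eq[OF c] set_layered_path by auto
    then show "i = j" using bij[of k] ij unfolding bij_betw_def inj_on_def by blast
  qed
  show inj: "inj_on (chain_path Cs) {1..card A}"
  proof (rule inj_onI)
    fix i j assume ij: "i \<in> {1..card A}" "j \<in> {1..card A}" and eq: "chain_path Cs i = chain_path Cs j"
    have "hd (chain_path Cs i) \<in> set (chain_path Cs i)"
      unfolding chain_path_eq[OF c] by (rule list.set_sel(1)) simp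
    then show "i = j" using disj[OF ij] eq by simp
  qed
  have enum_mem: "enum (Cs ! k) i \<in> Cs ! k" if "k \<le> length is" "i \<in> {1..card A}" for i k
    using bij_betwE[OF bij[OF that(1)]] that(2) by blast
  have vp: "vpath (chain_path Cs i) (with_proj (wiring_diagram n is))" if i: "i \<in> {1..card A}" for i
  proof -
    have "\<exists>f. chain_path Cs i = layered_path (length is) f \<and> (\<forall>k\<le>length is. f k \<in> {1..n+1}) \<and>
      (\<forall>k<length is. wire_step (is ! k) (f k) (f (Suc k)))"
    proof (intro exI conjI allI impI)
      show "chain_path Cs i = layered_path (length is) (\<lambda>k. enum (Cs ! k) i)" by (rule chain_path_eq[OF c])
      show "enum (Cs ! k) i \<in> {1..n+1}" if "k \<le> length is" for k
        using enum_mem[OF that i] D(4)[OF that] by blast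
      show "wire_step (is ! k) (enum (Cs ! k) i) (enum (Cs ! Suc k) i)" if "k < length is" for k
        using Cs that i by (simp add: wired_chains_def)
    qed
    then show ?thesis using vpath_wiring_diagram_iff[OF set_is] by blast
  qed
  have "hd (chain_path Cs i) \<in> {0} \<times> A" "last (chain_path Cs i) \<in> {length is} \<times> B" if i: "i \<in> {1..card A}" for i
    using enum_mem[of 0 i] enum_mem[of "length is" i] i D(2,3) by (simp_all add: chain_path_eq[OF c])
  then show "chain_path Cs ` {1..card A} \<in> path_families n is A B"
    unfolding path_families_def
  proof (intro CollectI conjI ballI impI)
    fix p p' assume "p \<in> chain_path Cs ` {1..card A}" "p' \<in> chain_path Cs ` {1..card A}" "p \<noteq> p'"
    then show "set p \<inter> set p' = {}" using disj by blast
  qed (use vp card_image[OF inj] in auto)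
qed

text \<open>The chain is recovered from its family of paths, which gives injectivity of the
  correspondence.\<close>

lemma chain_path_column:
  assumes c: "Cs \<in> chains n (length is) A B" and k: "k \<le> length is"
  shows "(\<lambda>p. snd (p ! k)) ` chain_path Cs ` {1..card A} = Cs ! k"
proof -
  have "(\<lambda>p. snd (p ! k)) ` chain_path Cs ` {1..card A} = enum (Cs ! k) ` {1..card A}"
    unfolding image_image chain_path_eq[OF c] using k by simp
  also have "\<dots> = Cs ! k"
    using bij_betw_enum[OF chainsD(6)[OF c k]] chainsD(5)[OF c k] by (simp add: bij_betw_def)
  finally show ?thesis .
qed

text \<open>Number the paths by starting level. Since they neither meet nor cross, the numbering is
  increasing in every column, so the family is the one threaded through the sets of levels it
  occupies.\<close>

lemma path_family_is_chain:
  assumes P: "P \<in> path_families n is A B"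
  shows "\<exists>Cs\<in>wired_chains n is A B. chain_path Cs ` {1..card A} = P"
proof -
  let ?m = "length is" and ?r = "card A"
  have fA: "finite A" using A finite_subset by blast
  have finP: "finite P" and cardP: "card P = ?r"
    and path: "\<And>p. p \<in> P \<Longrightarrow> vpath p (with_proj (wiring_diagram n is)) \<and> hd p \<in> {0} \<times> A \<and> last p \<in> {?m} \<times> B"
    and disj: "\<And>p p'. p \<in> P \<Longrightarrow> p' \<in> P \<Longrightarrow> p \<noteq> p' \<Longrightarrow> set p \<inter> set p' = {}"
    using P unfolding path_families_def by auto
  define l where "l p k = snd (p ! k)" for p :: "(nat \<times> nat) list" and k
  have layered: "p = layered_path ?m (l p)" "\<And>k. k \<le> ?m \<Longrightarrow> l p k \<in> {1..n+1}"
    "\<And>k. k < ?m \<Longrightarrow> wire_step (is ! k) (l p k) (l p (Suc k))" "l p 0 \<in> A" "l p ?m \<in> B"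
    if p: "p \<in> P" for p
  proof -
    have "fst (hd p) = 0" "fst (last p) = ?m" using path[OF p] by auto
    then obtain f where f: "p = layered_path ?m f" "\<forall>k\<le>?m. f k \<in> {1..n+1}"
      "\<forall>k<?m. wire_step (is ! k) (f k) (f (Suc k))"
      using vpath_wiring_diagram_iff[OF set_is, of p] path[OF p] by blast
    have lf: "l p k = f k" if "k \<le> ?m" for k using that by (simp add: l_def f(1))
    show "p = layered_path ?m (l p)"
      by (subst f(1), rule nth_equalityI) (simp_all add: lf less_Suc_eq_le)
    show "\<And>k. k \<le> ?m \<Longrightarrow> l p k \<in> {1..n+1}" using f(2) lf by simp
    show "\<And>k. k < ?m \<Longrightarrow> wire_step (is ! k) (l p k) (l p (Suc k))" using f(3) lf by simp
    have "hd p = (0, f 0)" "last p = (?m, f ?m)" by (simp_all add: f(1))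
    then show "l p 0 \<in> A" "l p ?m \<in> B" using path[OF p] lf[OF le0] lf[OF order_refl] by simp_all
  qed
  \<comment> \<open>Two paths at the same level of column \<open>k\<close> would share a
    vertex.\<close>
  have inj: "inj_on (\<lambda>p. l p k) P" if k: "k \<le> ?m" for k
  proof (rule inj_onI, rule ccontr)
    fix p p' assume p: "p \<in> P" "p' \<in> P" "l p k = l p' k" "p \<noteq> p'"
    have "(k, l p k) \<in> set p" if "p \<in> P" for p
      by (subst layered(1)[OF that]) (use k in \<open>auto simp: set_layered_path\<close>)
    from this[OF p(1)] this[OF p(2)] show False using disj[OF p(1,2,4)] p(3) by auto
  qed
  \<comment> \<open>An injective map between finite sets of equal size is onto, so every level of
    \<open>A\<close> starts a path. The same count serves for \<open>B\<close> below.\<close>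
  have start: "(\<lambda>p. l p 0) ` P = A"
    using layered(4) card_image[OF inj[of 0]] cardP fA by (intro card_subset_eq) auto
  have "(\<lambda>p. l p ?m) ` P = B"
    using layered(5) card_image[OF inj[of ?m]] cardP AB finite_subset[OF B] by (intro card_subset_eq) auto
  note finish = this
  \<comment> \<open>The path that starts at the i-th smallest level of \<open>A\<close>.\<close>
  define g where "g i = inv_into P (\<lambda>p. l p 0) (enum A i)" for i
  have bA: "bij_betw (enum A) {1..?r} A" by (rule bij_betw_enum[OF fA])
  have g: "g i \<in> P" "l (g i) 0 = enum A i" if "i \<in> {1..?r}" for i
  proof -
    have "enum A i \<in> (\<lambda>p. l p 0) ` P" unfolding start using bA that by (auto simp: bij_betw_def)
    then show "g i \<in> P" "l (g i) 0 = enum A i"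
      unfolding g_def by (rule inv_into_into, rule f_inv_into_f)
  qed
  have gP: "g ` {1..?r} = P"
  proof
    show "P \<subseteq> g ` {1..?r}"
    proof
      fix p assume p: "p \<in> P"
      then have "l p 0 \<in> enum A ` {1..?r}" using layered(4) bA by (simp add: bij_betw_def)
      then obtain i where i: "i \<in> {1..?r}" "l p 0 = enum A i" by blast
      then have "p = g i" using inj_onD[OF inj[OF le0] _ p g(1)[OF i(1)]] g(2)[OF i(1)] by simp
      then show "p \<in> g ` {1..?r}" using i(1) by blast
    qed
  qed (use g in blast)
  \<comment> \<open>Induction on the column: \<open>inj\<close> excludes that two paths meet, and
    \<open>wire_step_noncrossing\<close> then excludes that they cross.\<close>
  have mono: "strict_mono_on {1..?r} (\<lambda>i. l (g i) k)" if "k \<le> ?m" for k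
    using that
  proof (induction k)
    case 0
    show ?case
      using strict_mono_on_enum[OF fA] g(2) unfolding strict_mono_on_def by auto
  next
    case (Suc k)
    show ?case
    proof (rule strict_mono_onI)
      fix i j assume ij: "i \<in> {1..?r}" "j \<in> {1..?r}" "i < j"
      have less: "l (g i) k < l (g j) k" using strict_mono_onD[OF Suc.IH ij] Suc.prems by simp
      then have "g i \<noteq> g j" by auto
      then have "l (g i) (Suc k) \<noteq> l (g j) (Suc k)"
        using inj_onD[OF inj[OF Suc.prems] _ g(1)[OF ij(1)] g(1)[OF ij(2)]] by blast
      then show "l (g i) (Suc k) < l (g j) (Suc k)"
        using wire_step_noncrossing[OF layered(3)[OF g(1)[OF ij(1)]] layered(3)[OF g(1)[OF ij(2)]] less] Suc.prems
        by simp
    qed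
  qed
  define Cs where "Cs = map (\<lambda>k. (\<lambda>i. l (g i) k) ` {1..?r}) [0..<Suc ?m]"
  have nth: "Cs ! k = (\<lambda>i. l (g i) k) ` {1..?r}" if "k \<le> ?m" for k
    using that unfolding Cs_def by (subst nth_map) (auto simp del: upt_Suc)
  have len: "length Cs = Suc ?m" by (simp add: Cs_def)
  have img: "(\<lambda>i. l (g i) k) ` {1..?r} = (\<lambda>p. l p k) ` P" for k
    unfolding gP[symmetric] image_image ..
  have "Cs \<noteq> []" using len by auto
  then have "hd Cs = A" "last Cs = B"
    using nth[OF le0, unfolded img start] nth[OF order_refl, unfolded img finish] len
    by (simp_all add: hd_conv_nth last_conv_nth)
  moreover have "C \<subseteq> {1..n+1} \<and> card C = ?r" if C: "C \<in> set Cs" for C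
  proof -
    obtain k where k: "k \<le> ?m" "C = (\<lambda>p. l p k) ` P"
      using C unfolding Cs_def img by (auto simp: less_Suc_eq_le simp del: upt_Suc)
    then show ?thesis using layered(2) card_image[OF inj[OF k(1)]] cardP by auto
  qed
  ultimately have c: "Cs \<in> chains n ?m A B" using len by (simp add: chains_def)
  \<comment> \<open>By monotonicity \<open>g i\<close> holds the i-th smallest level, the one that
    \<open>chain_path\<close> selects.\<close>
  have enum: "enum (Cs ! k) i = l (g i) k" if "k \<le> ?m" "i \<in> {1..?r}" for k i
    unfolding nth[OF that(1)] by (rule enum_unique[OF mono[OF that(1)] that(2)])
  have "Cs \<in> wired_chains n is A B"
    using c layered(3)[OF g(1)] enum unfolding wired_chains_def by simp
  moreover have "chain_path Cs i = g i" if "i \<in> {1..?r}" for i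
    unfolding chain_path_eq[OF c]
    by (rule trans[OF _ layered(1)[OF g(1)[OF that], symmetric]], rule nth_equalityI)
      (simp_all add: enum[OF _ that] less_Suc_eq_le)
  then have "chain_path Cs ` {1..?r} = P" unfolding gP[symmetric] by (intro image_cong) auto
  ultimately show ?thesis by blast
qed

lemma bij_betw_chains_families:
  "bij_betw (\<lambda>Cs. chain_path Cs ` {1..card A}) (wired_chains n is A B) (path_families n is A B)"
  unfolding bij_betw_def
proof
  show "inj_on (\<lambda>Cs. chain_path Cs ` {1..card A}) (wired_chains n is A B)"
  proof (rule inj_onI)
    fix Cs Ds assume "Cs \<in> wired_chains n is A B" "Ds \<in> wired_chains n is A B"
      and eq: "chain_path Cs ` {1..card A} = chain_path Ds ` {1..card A}"
    then have c: "Cs \<in> chains n (length is) A B" "Ds \<in> chains n (length is) A B"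
      by (simp_all add: wired_chains_def)
    show "Cs = Ds"
    proof (rule nth_equalityI)
      show "length Cs = length Ds" using chainsD(1)[OF c(1)] chainsD(1)[OF c(2)] by simp
      fix k assume "k < length Cs"
      then have k: "k \<le> length is" using chainsD(1)[OF c(1)] by simp
      show "Cs ! k = Ds ! k"
        using chain_path_column[OF c(1) k] chain_path_column[OF c(2) k] eq by simp
    qed
  qed
  show "(\<lambda>Cs. chain_path Cs ` {1..card A}) ` wired_chains n is A B = path_families n is A B"
    using chain_path_family(1) path_family_is_chain by blast
qed

end

section \<open>Weights of families and weights of chains\<close>

lemma list_prod_pure_tensor:
  assumes "calg V" and "\<And>i. i \<in> set is \<Longrightarrow> length (u i) = m \<and> set (u i) \<subseteq> carrier V"
  shows "list_prod (tensor_power V m) (map (\<lambda>i. pure_tensor V (u i)) is) =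
    pure_tensor V (map (\<lambda>k. list_prod V (map (\<lambda>i. u i ! k) is)) [0..<m])"
proof -
  interpret V: calg V by (rule assms(1))
  interpret T: calg "tensor_power V m" by (rule V.calg_tensor_power)
  show ?thesis
    using assms(2)
  proof (induction "is")
    case Nil
    then show ?case by (simp add: V.pure_tensor_one map_replicate_const)
  next
    case (Cons i as)
    let ?w = "map (\<lambda>k. list_prod V (map (\<lambda>i. u i ! k) as)) [0..<m]"
    have "u j ! k \<in> carrier V" if "j \<in> set as" "k < m" for j k
      using Cons.prems[of j] that nth_mem[of k "u j"] by auto
    then have w: "set ?w \<subseteq> carrier V" by (auto intro!: V.list_prod_closed)
    have ui: "length (u i) = m" "set (u i) \<subseteq> carrier V" using Cons.prems[of i] by auto
    have "list_prod (tensor_power V m) (map (\<lambda>i. pure_tensor V (u i)) (i # as)) =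
        pure_tensor V (u i) \<otimes>\<^bsub>tensor_power V m\<^esub> pure_tensor V ?w"
      using Cons by (simp add: T.list_prod_Cons)
    also have "\<dots> = pure_tensor V (map2 (\<otimes>\<^bsub>V\<^esub>) (u i) ?w)"
      using ui w by (intro V.pure_tensor_mult) auto
    also have "map2 (\<otimes>\<^bsub>V\<^esub>) (u i) ?w = map (\<lambda>k. list_prod V (map (\<lambda>i. u i ! k) (i # as))) [0..<m]"
      using ui by (intro nth_equalityI) (auto simp: V.list_prod_Cons)
    finally show ?case .
  qed
qed

text \<open>The same array of matrix entries is multiplied in two ways: path by path in the tensor
  power, and layer by layer in the single factors. Both take the paths in order of increasing
  level.\<close>

lemma family_weight_chain:
  assumes "set is \<subseteq> {- int n..int n} - {0}" and Cs: "Cs \<in> wired_chains n is A B"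
  shows "family_weight q is (chain_path Cs ` {1..card A}) = chain_weight q is Cs"
proof -
  let ?m = "length is" and ?r = "card A"
  have c: "Cs \<in> chains n ?m A B" using Cs by (simp add: wired_chains_def)
  note D = chainsD[OF c]
  have path: "chain_path Cs i = layered_path ?m (\<lambda>k. enum (Cs ! k) i)" for i
    by (simp add: chain_path_def D(1))
  have fA: "finite A" using D(6)[of 0] D(2) by simp
  have key: "snd (hd (chain_path Cs i)) = enum A i" for i by (simp add: path D(2))
  have "sorted_wrt (<) (map (\<lambda>p. snd (hd p)) (map (chain_path Cs) [1..<Suc ?r]))"
    unfolding map_map comp_def key sorted_wrt_map
    by (rule sorted_wrt_mono_rel[of _ "(<)"])
      (auto simp del: upt_Suc intro!: strict_mono_onD[OF strict_mono_on_enum[OF fA]])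
  then have s: "sorted (map (\<lambda>p. snd (hd p)) (map (chain_path Cs) [1..<Suc ?r]))"
    "distinct (map (\<lambda>p. snd (hd p)) (map (chain_path Cs) [1..<Suc ?r]))"
    by (simp_all only: strict_sorted_iff)
  have set: "set (map (chain_path Cs) [1..<Suc ?r]) = chain_path Cs ` {1..?r}"
    by (auto simp del: upt_Suc)
  \<comment> \<open>Starting levels are \<open>enum A i\<close>, so sorting by them lists the paths
    in the order of \<open>i\<close>.\<close>
  have "sorted_key_list_of_set (\<lambda>p. snd (hd p)) (chain_path Cs ` {1..?r}) = map (chain_path Cs) [1..<Suc ?r]"
    unfolding set[symmetric] by (rule sorted_key_list_of_set_set[OF s])
  then have "family_weight q is (chain_path Cs ` {1..?r}) =
      list_prod (Lq q is) (map (\<lambda>i. path_weight q is (chain_path Cs i)) [1..<Suc ?r])"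
    by (simp add: family_weight_def comp_def del: upt_Suc)
  also have "map (\<lambda>i. path_weight q is (chain_path Cs i)) [1..<Suc ?r] =
      map (\<lambda>i. pure_tensor (Lq2 q) (map (\<lambda>k. psi_entry q (is ! k) (enum (Cs ! k) i) (enum (Cs ! Suc k) i)) [0..<?m])) [1..<Suc ?r]"
  proof (rule map_cong[OF refl])
    fix i assume "i \<in> set [1..<Suc ?r]"
    then have i: "i \<in> {1..?r}" by auto
    have "map (arc_weight q is) (vwalk_arcs (chain_path Cs i)) =
        map (\<lambda>k. psi_entry q (is ! k) (enum (Cs ! k) i) (enum (Cs ! Suc k) i)) [0..<?m]"
      unfolding path vwalk_arcs_layered_path map_map
    proof (rule map_cong[OF refl])
      fix k assume "k \<in> set [0..<?m]"
      then have "wire_step (is ! k) (enum (Cs ! k) i) (enum (Cs ! Suc k) i)"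
        using Cs i by (simp add: wired_chains_def)
      then show "(arc_weight q is \<circ> (\<lambda>k. ((k, enum (Cs ! k) i), Suc k, enum (Cs ! Suc k) i))) k =
        psi_entry q (is ! k) (enum (Cs ! k) i) (enum (Cs ! Suc k) i)"
        unfolding comp_apply by (rule arc_weight_eq_psi_entry)
    qed
    then show "path_weight q is (chain_path Cs i) =
      pure_tensor (Lq2 q) (map (\<lambda>k. psi_entry q (is ! k) (enum (Cs ! k) i) (enum (Cs ! Suc k) i)) [0..<?m])"
      by (simp add: path_weight_def)
  qed
  \<comment> \<open>Componentwise multiplication exchanges the roles of paths and layers and keeps
    the order of the paths.\<close>
  also have "list_prod (Lq q is) \<dots> = pure_tensor (Lq2 q) (map (\<lambda>k. list_prod (Lq2 q)
      (map (\<lambda>i. map (\<lambda>k. psi_entry q (is ! k) (enum (Cs ! k) i) (enum (Cs ! Suc k) i)) [0..<?m] ! k)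
        [1..<Suc ?r])) [0..<?m])"
    using psi_entry_closed by (intro list_prod_pure_tensor[OF calg_Lq2]) auto
  also have "\<dots> = chain_weight q is Cs"
    unfolding chain_weight_def layer_weight_def
    by (intro arg_cong[where f = "pure_tensor (Lq2 q)"] map_cong refl) (simp add: D(5) del: upt_Suc)
  finally show ?thesis .
qed

text \<open>A missing arc is a zero entry in the diagonal product of its layer, and one zero factor
  makes the pure tensor zero.\<close>

lemma chain_weight_zero:
  assumes set_is: "set is \<subseteq> {- int n..int n} - {0}" and Cs: "Cs \<in> chains n (length is) A B - wired_chains n is A B"
  shows "chain_weight q is Cs = \<zero>\<^bsub>Lq q is\<^esub>"
proof -
  interpret L: calg "Lq2 q" by (rule calg_Lq2)
  have c: "Cs \<in> chains n (length is) A B" using Cs by blast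
  from Cs obtain k i where k: "k < length is" and i: "i \<in> {1..card A}"
    and not: "\<not> wire_step (is ! k) (enum (Cs ! k) i) (enum (Cs ! Suc k) i)"
    unfolding wired_chains_def by blast
  have "is ! k \<noteq> 0" using set_is nth_mem[OF k] by blast
  note z = psi_entry_not_wire_step[OF this not]
  have "i \<in> set [1..<Suc (card (Cs ! k))]" using i chainsD(5)[OF c, of k] k by auto
  then have "\<zero>\<^bsub>Lq2 q\<^esub> \<in> set (map (\<lambda>i. psi_entry q (is ! k) (enum (Cs ! k) i) (enum (Cs ! Suc k) i)) [1..<Suc (card (Cs ! k))])"
    unfolding set_map by (intro image_eqI[of _ _ i]) (simp_all only: z)
  then have "layer_weight q (is ! k) (Cs ! k) (Cs ! Suc k) = \<zero>\<^bsub>Lq2 q\<^esub>"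
    unfolding layer_weight_def using psi_entry_closed by (intro L.list_prod_zero) auto
  moreover have "k \<in> set [0..<length is]" using k by simp
  ultimately have "\<zero>\<^bsub>Lq2 q\<^esub> \<in> set (map (\<lambda>k. layer_weight q (is ! k) (Cs ! k) (Cs ! Suc k)) [0..<length is])"
    unfolding set_map by (intro image_eqI[OF sym])
  then show ?thesis
    unfolding chain_weight_def using layer_weight_closed by (intro L.pure_tensor_zero) auto
qed

theorem proposition3p65:
  fixes q :: complex and n :: nat and w1 w2 :: "nat \<Rightarrow> nat" and "is" :: "int list"
    and A B :: "nat set"
  assumes "q \<noteq> 0"
    and "\<forall>k::nat. k > 0 \<longrightarrow> q ^ k \<noteq> 1"
    and "w1 permutes {1..n+1}"
    and "w2 permutes {1..n+1}"
    and "reduced_expression n w1 w2 is"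
    and "A \<subseteq> {1..n+1}"
    and "B \<subseteq> {1..n+1}"
    and "card A = card B"
  shows "pi_tilde q n is (quantum_minor q n A B) =
    (\<Oplus>\<^bsub>Lq q is\<^esub>P\<in>path_families n is A B. family_weight q is P)"
proof -
  interpret LT: calg "Lq q is" by (rule calg.calg_tensor_power[OF calg_Lq2])
  have set_is: "set is \<subseteq> {- int n..int n} - {0}"
    using assms(5) by (simp add: reduced_expression_def)
  let ?W = "wired_chains n is A B"
  have WC: "?W \<subseteq> chains n (length is) A B" by (auto simp: wired_chains_def)
  note bij = bij_betw_chains_families[OF set_is assms(6-8)]
  have "pi_tilde q n is (quantum_minor q n A B) =
      (\<Oplus>\<^bsub>Lq q is\<^esub>Cs\<in>chains n (length is) A B. chain_weight q is Cs)"
    by (rule pi_tilde_minor[OF assms(1) set_is assms(6-8)])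
  \<comment> \<open>The omitted chains lack an arc and have weight zero.\<close>
  also have "\<dots> = (\<Oplus>\<^bsub>Lq q is\<^esub>Cs\<in>?W. chain_weight q is Cs)"
    using chain_weight_zero[OF set_is] chain_weight_closed
    by (intro LT.finsum_neutral_subset[OF finite_chains WC]) blast+
  also have "\<dots> = (\<Oplus>\<^bsub>Lq q is\<^esub>Cs\<in>?W. family_weight q is (chain_path Cs ` {1..card A}))"
    using family_weight_chain[OF set_is] chain_weight_closed by (intro LT.finsum_cong') simp_all
  also have "\<dots> = (\<Oplus>\<^bsub>Lq q is\<^esub>P\<in>path_families n is A B. family_weight q is P)"
  proof (rule LT.finsum_bij_betw[OF bij, symmetric])
    \<comment> \<open>Each family comes from a wired chain, and the weight of that chain is known to
      lie in the carrier.\<close>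
    show "family_weight q is \<in> path_families n is A B \<rightarrow> carrier (Lq q is)"
    proof
      fix P assume "P \<in> path_families n is A B"
      then obtain Cs where "Cs \<in> ?W" "P = chain_path Cs ` {1..card A}"
        using bij unfolding bij_betw_def by blast
      then show "family_weight q is P \<in> carrier (Lq q is)"
        using family_weight_chain[OF set_is] chain_weight_closed by simp
    qed
  qed
  finally show ?thesis .
qed

end
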